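(* Let $m \ge 0$ be an integer. In a system of anonymous processes, consider any correct binary consensus algorithm satisfying nondeterministic solo termination, with the property that every execution uses at most $m$ registers. For each $r$ with $0 \le r \le m$, provided the system has at least $2(5m+6+2r)$ processes, there exists a set $U$ containing $5m+6+2r$ process-clone pairs such that a configuration $C_r$ is reachable through an execution $E_r$ by processes and clones in $U$ (for some assignment of inputs) with the following properties: 1. There exists a set $R$ of $r$ registers that can be partitioned into two disjoint subsets $R = R_s \cup R_c$, where: - $R_s$ consists of all registers in the system that each have one fresh split pair on them, i.e. that were last written by some process whose clone has not yet performed the write and is covering the register; - $R_c = R \setminus R_s$, and each register in $R_c$ is covered by a unique pair of both a process and its clone (distinct registers in $R_c$ are assigned distinct non-split pairs, both members of which cover the register). Thus, each fresh pair is split on a different register in $R_s$, and an additional $|R_c|$ pairs are covering the registers in $R_c$. Let $V$ be the set of these $|R_s|+|R_c| = r$ pairs. 2. There are at most $r$ stale split pairs in the system, and they are all split on pairwise different registers from $R$. Let $L$ be the set of these at most $r$ stale split pairs. 3. There exist disjoint sets $P, Q \subseteq U \setminus V \setminus L$ of process-clone pairs that are not split, with $|P|+|Q| \le 2m+4$, such that an execution in $\mathrm{Res}(C_r,P)$ returns $0$ and an execution in $\mathrm{Res}(C_r,Q)$ returns $1$.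
   Context: Model. Asynchronous shared memory with atomic read-write registers. An algorithm specifies, for each process state, which operations (read of a register, write of a value to a register, local coin flip, or return of an output) the process can perform next; this choice may be nondeterministic. A configuration consists of the states of all processes and the contents of all registers. An execution is a sequence of steps by processes starting from an initial configuration; each step is one operation by one process, and the scheduling is arbitrary. An execution interval is a sequence of consecutive steps of an execution. A configuration is reachable if some execution leads to it. After returning, a process takes no more steps. Anonymous processes. All processes run the same code: processes with the same input start in the same initial state; if a process in state $s$ can perform an operation, then any process in state $s$ (in any configuration) can perform the same operation; and two processes that perform the same operation from the same state with the same outcome (e.g. read the same value) end up in the same state. Binary consensus. Each participating process starts with an input in $\{0,1\}$ and may return an output in $\{0,1\}$. The algorithm is correct if, in every execution, all outputs returned are equal and equal to the input of some participating process. Nondeterministic solo termination. From each reachable configuration, for each process, there exists a finite solo execution by that process (all steps are taken by that process) in which it terminates and returns an output. Registers used. The registers used in an execution are those written to during it. Covering. A process covers a register if its next step can be a write to that register. Process-clone pairs. A process-clone pair consists of two processes, called the process and its clone, with the same input; distinct pairs involve disjoint processes. In the executions considered, a pair acts in one of the following ways. (a) When the pair is not split, the process and the clone are in the same state, and the pair may take a joint step: the process performs an operation and its clone immediately afterwards performs the same operation with the same outcome, so they remain in the same state. (b) A pair that is not split may be split on a register: only the process performs a write to that register, while the clone remains in the state before the write, covering the register and poised to perform the same write. While the pair is split the process takes no further steps. (c) A split pair is united (is no longer split) when its clone performs that pending write, after which the clone is again in the same state as the process. A pair split on a register is called fresh as long as that register has not been overwritten since the process's write, and stale once it has been overwritten.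 A non-split pair is treated as a single process: a step of the pair means a joint step, the pair covers a register if both its process and its clone do, and the pair returns a value when its process and clone return it. Reserving execution intervals. Let $C$ be a reachable configuration and $P$ a set of at least $m+1$ non-split pairs, each treated as a single process. An execution interval $\gamma$ starting from $C$ is reserving from $C$ by $P$ if: (i) every step in $\gamma$ is by a member of $P$; (ii) at any time during $\gamma$, if $R_w$ is the set of registers written to so far during $\gamma$, then for each register in $R_w$ there is a reserved member of $P$ covering that register, one per register (distinct registers have distinct reserved members); (iii) if a member of $P$ returns during $\gamma$, it does so in the last step of $\gamma$. $\mathrm{Res}(C,P)$ denotes the set of all reserving execution intervals from $C$ by $P$ that end with a member of $P$ returning; such an interval returns $v$ if the value returned is $v$. *)

theory Defs
  imports Main "HOL-Library.Disjoint_Sets"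
begin

section \<open>Anonymous shared-memory systems\<close>

text \<open>
  Type variables: \<open>'p\<close> processes, \<open>'s\<close> local states, \<open>'r\<close> registers, \<open>'v\<close> register contents,
  \<open>'c\<close> coin-flip outcomes.  Inputs and outputs 0 and 1 are \<open>False\<close> and \<open>True\<close>.
\<close>

datatype ('r, 'v) operation = Read 'r | Write 'r 'v | Flip | Return bool

datatype ('v, 'c) outcome = Value 'v | Coin 'c | Ack

text \<open>
  Anonymity is built in: neither the initial state, nor the set of operations that can be performed
  next, nor the successor state depends on the identity of the process.
\<close>

record ('p, 's, 'r, 'v, 'c) system =
  procs :: "'p set"
  init_state :: "bool \<Rightarrow> 's"
  init_value :: "'r \<Rightarrow> 'v"
  ops :: "'s \<Rightarrow> ('r, 'v) operation set"
  succ_state :: "'s \<Rightarrow> ('r, 'v) operation \<Rightarrow> ('v, 'c) outcome \<Rightarrow> 's"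

datatype 's proc_state = Active 's | Returned bool

record ('p, 's, 'r, 'v) config =
  proc :: "'p \<Rightarrow> 's proc_state"
  reg :: "'r \<Rightarrow> 'v"

type_synonym ('p, 'r, 'v, 'c) event = "'p \<times> ('r, 'v) operation \<times> ('v, 'c) outcome"

definition initial :: "('p, 's, 'r, 'v, 'c) system \<Rightarrow> ('p \<Rightarrow> bool) \<Rightarrow> ('p, 's, 'r, 'v) config" where
  "initial A inp = \<lparr>proc = (\<lambda>p. Active (init_state A (inp p))), reg = init_value A\<rparr>"

inductive step ::
  "('p, 's, 'r, 'v, 'c) system \<Rightarrow> ('p, 's, 'r, 'v) config \<Rightarrow> ('p, 'r, 'v, 'c) event
    \<Rightarrow> ('p, 's, 'r, 'v) config \<Rightarrow> bool"
  for A where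
  step_read:
    "\<lbrakk>p \<in> procs A; proc C p = Active s; Read x \<in> ops A s; w = Value (reg C x)\<rbrakk>
      \<Longrightarrow> step A C (p, Read x, w)
            (C\<lparr>proc := (proc C)(p := Active (succ_state A s (Read x) w))\<rparr>)"
| step_write:
    "\<lbrakk>p \<in> procs A; proc C p = Active s; Write x v \<in> ops A s\<rbrakk>
      \<Longrightarrow> step A C (p, Write x v, Ack)
            (C\<lparr>proc := (proc C)(p := Active (succ_state A s (Write x v) Ack)),
               reg := (reg C)(x := v)\<rparr>)"
| step_flip:
    "\<lbrakk>p \<in> procs A; proc C p = Active s; Flip \<in> ops A s\<rbrakk>
      \<Longrightarrow> step A C (p, Flip, Coin b)
            (C\<lparr>proc := (proc C)(p := Active (succ_state A s Flip (Coin b)))\<rparr>)"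
| step_return:
    "\<lbrakk>p \<in> procs A; proc C p = Active s; Return v \<in> ops A s\<rbrakk>
      \<Longrightarrow> step A C (p, Return v, Ack) (C\<lparr>proc := (proc C)(p := Returned v)\<rparr>)"

inductive execution ::
  "('p, 's, 'r, 'v, 'c) system \<Rightarrow> ('p, 's, 'r, 'v) config \<Rightarrow> ('p, 'r, 'v, 'c) event list
    \<Rightarrow> ('p, 's, 'r, 'v) config \<Rightarrow> bool"
  for A where
  execution_Nil: "execution A C [] C"
| execution_Cons: "\<lbrakk>step A C e C'; execution A C' es D\<rbrakk> \<Longrightarrow> execution A C (e # es) D"

definition reachable :: "('p, 's, 'r, 'v, 'c) system \<Rightarrow> ('p, 's, 'r, 'v) config \<Rightarrow> bool" where
  "reachable A C \<longleftrightarrow> (\<exists>inp es. execution A (initial A inp) es C)"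

definition written :: "('p, 'r, 'v, 'c) event list \<Rightarrow> 'r set" where
  "written es = {x. \<exists>p v w. (p, Write x v, w) \<in> set es}"

text \<open>The processes participating in an execution are those that take a step in it.\<close>

definition correct_consensus :: "('p, 's, 'r, 'v, 'c) system \<Rightarrow> bool" where
  "correct_consensus A \<longleftrightarrow>
    (\<forall>inp es C. execution A (initial A inp) es C \<longrightarrow>
      (\<forall>p v w. (p, Return v, w) \<in> set es \<longrightarrow>
        (\<forall>p' v' w'. (p', Return v', w') \<in> set es \<longrightarrow> v' = v) \<and>
        (\<exists>q \<in> fst ` set es. inp q = v)))"

text \<open>For a process that has already returned, the empty solo execution is a witness.\<close>

definition nondet_solo_termination :: "('p, 's, 'r, 'v, 'c) system \<Rightarrow> bool" where
  "nondet_solo_termination A \<longleftrightarrow>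
    (\<forall>C. reachable A C \<longrightarrow> (\<forall>p \<in> procs A.
      \<exists>es D v. execution A C es D \<and> fst ` set es \<subseteq> {p} \<and> proc D p = Returned v))"

definition uses_at_most :: "('p, 's, 'r, 'v, 'c) system \<Rightarrow> nat \<Rightarrow> bool" where
  "uses_at_most A m \<longleftrightarrow>
    (\<forall>inp es C. execution A (initial A inp) es C \<longrightarrow> card (written es) \<le> m)"

definition covers ::
  "('p, 's, 'r, 'v, 'c) system \<Rightarrow> ('p, 's, 'r, 'v) config \<Rightarrow> 'p \<Rightarrow> 'r \<Rightarrow> bool" where
  "covers A C p x \<longleftrightarrow> (\<exists>s v. proc C p = Active s \<and> Write x v \<in> ops A s)"


section \<open>Process-clone pairs\<close>

text \<open>A pair is written \<open>(process, clone)\<close>.\<close>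

definition clone_pairs ::
  "('p, 's, 'r, 'v, 'c) system \<Rightarrow> ('p \<Rightarrow> bool) \<Rightarrow> ('p \<times> 'p) set \<Rightarrow> bool" where
  "clone_pairs A inp U \<longleftrightarrow>
    (\<forall>(p, c) \<in> U. p \<in> procs A \<and> c \<in> procs A \<and> p \<noteq> c \<and> inp p = inp c) \<and>
    disjoint_family_on (\<lambda>(p, c). {p, c}) U"

definition pair_covers ::
  "('p, 's, 'r, 'v, 'c) system \<Rightarrow> ('p, 's, 'r, 'v) config \<Rightarrow> 'p \<times> 'p \<Rightarrow> 'r \<Rightarrow> bool" where
  "pair_covers A C q x \<longleftrightarrow> covers A C (fst q) x \<and> covers A C (snd q) x"

text \<open>
  \<open>Split q x v\<close>: only the process of \<open>q\<close> writes \<open>v\<close> to \<open>x\<close>;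
  \<open>Unite q x v\<close>: the clone of \<open>q\<close> performs that pending write.
\<close>

datatype ('p, 'r, 'v, 'c) action =
  Joint (actor: "'p \<times> 'p") "('r, 'v) operation" "('v, 'c) outcome"
| Split (actor: "'p \<times> 'p") 'r 'v
| Unite (actor: "'p \<times> 'p") 'r 'v

fun events_of :: "('p, 'r, 'v, 'c) action \<Rightarrow> ('p, 'r, 'v, 'c) event list" where
  "events_of (Joint q f w) = [(fst q, f, w), (snd q, f, w)]"
| "events_of (Split q x v) = [(fst q, Write x v, Ack)]"
| "events_of (Unite q x v) = [(snd q, Write x v, Ack)]"

definition events :: "('p, 'r, 'v, 'c) action list \<Rightarrow> ('p, 'r, 'v, 'c) event list" where
  "events E = concat (map events_of E)"

text \<open>
  After the actions \<open>E\<close>, the pair \<open>q\<close> is split by its process's write of \<open>v\<close> to \<open>x\<close>, and \<open>F\<close> is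
  what happened since that write.  A pair that is split can act next only by being united.
\<close>

definition split_since ::
  "('p, 'r, 'v, 'c) action list \<Rightarrow> 'p \<times> 'p \<Rightarrow> 'r \<Rightarrow> 'v \<Rightarrow> ('p, 'r, 'v, 'c) action list \<Rightarrow> bool" where
  "split_since E q x v F \<longleftrightarrow> (\<exists>E'. E = E' @ Split q x v # F) \<and> q \<notin> actor ` set F"

definition is_split :: "('p, 'r, 'v, 'c) action list \<Rightarrow> 'p \<times> 'p \<Rightarrow> bool" where
  "is_split E q \<longleftrightarrow> (\<exists>x v F. split_since E q x v F)"

definition fresh_on :: "('p, 'r, 'v, 'c) action list \<Rightarrow> 'p \<times> 'p \<Rightarrow> 'r \<Rightarrow> bool" where
  "fresh_on E q x \<longleftrightarrow> (\<exists>v F. split_since E q x v F \<and> x \<notin> written (events F))"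

definition stale_on :: "('p, 'r, 'v, 'c) action list \<Rightarrow> 'p \<times> 'p \<Rightarrow> 'r \<Rightarrow> bool" where
  "stale_on E q x \<longleftrightarrow> (\<exists>v F. split_since E q x v F \<and> x \<in> written (events F))"

fun allowed_after :: "('p, 'r, 'v, 'c) action list \<Rightarrow> ('p, 'r, 'v, 'c) action \<Rightarrow> bool" where
  "allowed_after E (Joint q f w) \<longleftrightarrow> \<not> is_split E q"
| "allowed_after E (Split q x v) \<longleftrightarrow> \<not> is_split E q"
| "allowed_after E (Unite q x v) \<longleftrightarrow> (\<exists>F. split_since E q x v F)"

text \<open>
  Executions from an initial configuration in which only the pairs in \<open>U\<close> act.  If \<open>U\<close> consists of
  process-clone pairs, both members of a pair that is not split are in the same state: this holds
  initially and is preserved by the three kinds of actions.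
\<close>

definition pair_execution ::
  "('p, 's, 'r, 'v, 'c) system \<Rightarrow> ('p \<Rightarrow> bool) \<Rightarrow> ('p \<times> 'p) set
    \<Rightarrow> ('p, 'r, 'v, 'c) action list \<Rightarrow> ('p, 's, 'r, 'v) config \<Rightarrow> bool" where
  "pair_execution A inp U E C \<longleftrightarrow>
    execution A (initial A inp) (events E) C \<and>
    actor ` set E \<subseteq> U \<and>
    (\<forall>k < length E. allowed_after (take k E) (E ! k))"


section \<open>Reserving execution intervals\<close>

text \<open>
  The members of \<open>P\<close> are meant to be non-split pairs in the reachable configuration \<open>C\<close>; whether a
  pair is split depends on the execution leading to \<open>C\<close>, so this is to be required separately.
  The number \<open>m\<close> is the bound on the number of registers.
  Executions are determined by their events, so there is only one \<open>D\<close> for every \<open>k\<close>.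
\<close>

definition reserving ::
  "('p, 's, 'r, 'v, 'c) system \<Rightarrow> nat \<Rightarrow> ('p, 's, 'r, 'v) config \<Rightarrow> ('p \<times> 'p) set
    \<Rightarrow> ('p, 'r, 'v, 'c) action list \<Rightarrow> bool" where
  "reserving A m C P \<gamma> \<longleftrightarrow>
    m + 1 \<le> card P \<and>
    (\<exists>D. execution A C (events \<gamma>) D) \<and>
    (\<forall>a \<in> set \<gamma>. \<exists>q \<in> P. \<exists>f w. a = Joint q f w) \<and>
    (\<forall>k \<le> length \<gamma>. \<forall>D. execution A C (events (take k \<gamma>)) D \<longrightarrow>
      (\<exists>reserved. inj_on reserved (written (events (take k \<gamma>))) \<and>
        (\<forall>x \<in> written (events (take k \<gamma>)). reserved x \<in> P \<and> pair_covers A D (reserved x) x))) \<and>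
    (\<forall>i < length \<gamma>. \<forall>q v w. \<gamma> ! i = Joint q (Return v) w \<longrightarrow> i = length \<gamma> - 1)"

definition returns :: "('p, 'r, 'v, 'c) action list \<Rightarrow> bool \<Rightarrow> bool" where
  "returns \<gamma> b \<longleftrightarrow> \<gamma> \<noteq> [] \<and> (\<exists>q w. last \<gamma> = Joint q (Return b) w)"

definition Res ::
  "('p, 's, 'r, 'v, 'c) system \<Rightarrow> nat \<Rightarrow> ('p, 's, 'r, 'v) config \<Rightarrow> ('p \<times> 'p) set
    \<Rightarrow> ('p, 'r, 'v, 'c) action list set" where
  "Res A m C P = {\<gamma>. reserving A m C P \<gamma> \<and> (\<exists>b. returns \<gamma> b)}"

end

theory Submission
  imports Defs
begin

text \<open>
  Induction on \<open>r\<close>. Given disjoint sets of pairs that can return 0 and 1 by reserving executions,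
  split all pairs covering \<open>R\<^sub>c\<close>. The remaining pairs, which have not been used, can now
  return some value \<open>b\<close>. Let \<open>\<gamma>\<close> be the given reserving execution that returns
  the other value. It must write outside \<open>R\<close>, since otherwise the pending writes on
  \<open>R\<close> (those of covering pairs and of clones whose pairs \<open>\<gamma>\<close> made stale) would
  hide it completely. Just before its first write to a register \<open>x \<notin> R\<close>, the pairs reserved
  by \<open>\<gamma>\<close> take over the covering of the overwritten registers and of \<open>x\<close>, so
  \<open>R \<union> {x}\<close> is covered. From this point one can either restore the memory, write by write,
  and arrive where unused pairs return \<open>b\<close>, or complete \<open>\<gamma>\<close> and arrive where
  they can only return the other value. Along one of these two ways there is a critical write, performed by some
  process \<open>z\<close>, before which one unused set of pairs returns one value and after which another
  returns the opposite value. Anonymity allows us to assume in hindsight that two further pairs have imitated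
  \<open>z\<close> all along: one of them performs the critical write and the other one is reserved for it,
  which makes both values possible just before the critical write.
\<close>

section \<open>Steps and executions\<close>

definition next_state :: "('p, 's, 'r, 'v, 'c) system \<Rightarrow> 's \<Rightarrow> ('r, 'v) operation \<Rightarrow> ('v, 'c) outcome \<Rightarrow> 's proc_state" where
  "next_state A s f w = (case f of Return v \<Rightarrow> Returned v | _ \<Rightarrow> Active (succ_state A s f w))"

definition apply_op :: "('r, 'v) operation \<Rightarrow> ('r \<Rightarrow> 'v) \<Rightarrow> 'r \<Rightarrow> 'v" where
  "apply_op f M = (case f of Write x v \<Rightarrow> M(x := v) | _ \<Rightarrow> M)"

definition outcome_ok :: "('r \<Rightarrow> 'v) \<Rightarrow> ('r, 'v) operation \<Rightarrow> ('v, 'c) outcome \<Rightarrow> bool" where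
  "outcome_ok M f w \<longleftrightarrow> (case f of Read x \<Rightarrow> w = Value (M x) | Flip \<Rightarrow> (\<exists>c. w = Coin c) | _ \<Rightarrow> w = Ack)"

definition op_writes :: "('r, 'v) operation \<Rightarrow> 'r set" where
  "op_writes f = {x. \<exists>v. f = Write x v}"

lemma op_writes_simps [simp]:
  "op_writes (Write x v) = {x}" "op_writes (Read x) = {}" "op_writes Flip = {}" "op_writes (Return b) = {}"
  by (auto simp: op_writes_def)

lemma apply_op_simps [simp]:
  "apply_op (Write x v) M = M(x := v)" "apply_op (Read x) M = M" "apply_op Flip M = M" "apply_op (Return b) M = M"
  by (auto simp: apply_op_def)

lemma next_state_simps [simp]:
  "next_state A s (Write x v) w = Active (succ_state A s (Write x v) w)"
  "next_state A s (Read x) w = Active (succ_state A s (Read x) w)"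
  "next_state A s Flip w = Active (succ_state A s Flip w)"
  "next_state A s (Return b) w = Returned b"
  by (auto simp: next_state_def)

lemma outcome_ok_simps [simp]:
  "outcome_ok M (Write x v) w \<longleftrightarrow> w = Ack"
  "outcome_ok M (Return b) w \<longleftrightarrow> w = Ack"
  by (auto simp: outcome_ok_def)

text \<open>Idempotence is what makes joint steps possible: whoever repeats an operation immediately
  gets the same outcome and leaves the memory as it is.\<close>

lemma apply_op_apply_op [simp]: "apply_op f (apply_op f M) = apply_op f M"
  by (cases f) auto

lemma outcome_ok_apply_op [simp]: "outcome_ok (apply_op f M) f w = outcome_ok M f w"
  by (cases f) (auto simp: outcome_ok_def)

lemma apply_op_other: "x \<notin> op_writes f \<Longrightarrow> apply_op f M x = M x"
  by (cases f) auto

lemma apply_op_id: "op_writes f = {} \<Longrightarrow> apply_op f M = M"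
  by (cases f) auto

text \<open>One form for all four kinds of step, so that operations need to be distinguished only
  where a write or a return matters.\<close>

lemma step_iff:
  "step A C (p, f, w) D \<longleftrightarrow> p \<in> procs A \<and>
    (\<exists>s. proc C p = Active s \<and> f \<in> ops A s \<and> outcome_ok (reg C) f w \<and>
      D = C\<lparr>proc := (proc C)(p := next_state A s f w), reg := apply_op f (reg C)\<rparr>)"
  by (cases f; cases w) (auto simp: step.simps outcome_ok_def)

lemma execution_Nil_iff [simp]: "execution A C [] D \<longleftrightarrow> D = C"
  by (auto intro: execution.intros elim: execution.cases)

lemma execution_Cons_iff: "execution A C (e # es) D \<longleftrightarrow> (\<exists>C'. step A C e C' \<and> execution A C' es D)"
  by (auto intro: execution.intros elim: execution.cases)

lemma execution_append: "execution A C (es @ fs) D \<longleftrightarrow> (\<exists>C'. execution A C es C' \<and> execution A C' fs D)"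
  by (induction es arbitrary: C) (auto simp: execution_Cons_iff)

lemma step_det: "step A C e D \<Longrightarrow> step A C e D' \<Longrightarrow> D = D'"
  by (cases e) (auto simp: step_iff)

lemma execution_det: "execution A C es D \<Longrightarrow> execution A C es D' \<Longrightarrow> D = D'"
proof (induction es arbitrary: C)
  case (Cons e es)
  then show ?case by (metis execution_Cons_iff step_det)
qed simp

lemma joint_iff:
  assumes "a \<noteq> b" "proc C a = proc C b"
  shows "execution A C [(a, f, w), (b, f, w)] D \<longleftrightarrow> a \<in> procs A \<and> b \<in> procs A \<and>
    (\<exists>s. proc C a = Active s \<and> f \<in> ops A s \<and> outcome_ok (reg C) f w \<and>
      D = C\<lparr>proc := (proc C)(a := next_state A s f w, b := next_state A s f w), reg := apply_op f (reg C)\<rparr>)"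
  using assms by (auto simp: execution_Cons_iff step_iff)

lemma events_simps [simp]:
  "events [] = []" "events (a # E) = events_of a @ events E" "events (E @ F) = events E @ events F"
  by (auto simp: events_def)

lemma written_simps [simp]:
  "written [] = {}" "written (es @ fs) = written es \<union> written fs"
  "written ((p, f, w) # es) = op_writes f \<union> written es"
  by (auto simp: written_def op_writes_def)

lemma finite_written [simp]: "finite (written es)"
proof (induction es)
  case (Cons e es)
  obtain p f w where "e = (p, f, w)" by (cases e)
  then show ?case using Cons by (cases f) auto
qed simp

lemma execution_Returned:
  "execution A C es D \<Longrightarrow> proc C p = Returned b \<Longrightarrow> proc D p = Returned b"
proof (induction rule: execution.induct)
  case (execution_Cons C e C' es D)
  obtain q f w where "e = (q, f, w)" by (cases e)
  then have "proc C' p = Returned b" using execution_Cons by (auto simp: step_iff)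
  then show ?case by (rule execution_Cons.IH)
qed

lemma execution_reg_unwritten:
  "execution A C es D \<Longrightarrow> x \<notin> written es \<Longrightarrow> reg D x = reg C x"
proof (induction rule: execution.induct)
  case (execution_Cons C e C' es D)
  obtain p f w where "e = (p, f, w)" by (cases e)
  then show ?case using execution_Cons by (auto simp: step_iff apply_op_other)
qed simp

lemma execution_proc_idle:
  "execution A C es D \<Longrightarrow> p \<notin> fst ` set es \<Longrightarrow> proc D p = proc C p"
proof (induction rule: execution.induct)
  case (execution_Cons C e C' es D)
  obtain p f w where "e = (p, f, w)" by (cases e)
  then show ?case using execution_Cons by (auto simp: step_iff)
qed simp

section \<open>Configurations that look alike to some processes\<close>

definition agree :: "'p set \<Rightarrow> ('p, 's, 'r, 'v) config \<Rightarrow> ('p, 's, 'r, 'v) config \<Rightarrow> bool" where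
  "agree S C D \<longleftrightarrow> reg C = reg D \<and> (\<forall>p \<in> S. proc C p = proc D p)"

lemma agree_sym: "agree S C D \<Longrightarrow> agree S D C"
  by (auto simp: agree_def)

lemma agree_mono: "agree S C D \<Longrightarrow> T \<subseteq> S \<Longrightarrow> agree T C D"
  by (auto simp: agree_def)

lemma agree_trans: "agree S C D \<Longrightarrow> agree S D E \<Longrightarrow> agree S C E"
  by (auto simp: agree_def)

text \<open>A step depends only on the memory and on the state of the acting process, so the
  processes outside \<open>S\<close> may be in arbitrary states.\<close>

lemma execution_agree:
  assumes "execution A C es D" "agree S C C'" "fst ` set es \<subseteq> S"
  shows "\<exists>D'. execution A C' es D' \<and> agree S D D'"
  using assms
proof (induction arbitrary: C' rule: execution.induct)
  case (execution_Cons C e C1 es D)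
  obtain p f w where e: "e = (p, f, w)" by (cases e)
  have p: "p \<in> S" "reg C' = reg C" "proc C' p = proc C p"
    using execution_Cons.prems e by (auto simp: agree_def)
  obtain s where s: "p \<in> procs A" "proc C p = Active s" "f \<in> ops A s" "outcome_ok (reg C) f w"
    "C1 = C\<lparr>proc := (proc C)(p := next_state A s f w), reg := apply_op f (reg C)\<rparr>"
    using execution_Cons.hyps(1) unfolding e step_iff by blast
  define C1' where "C1' = C'\<lparr>proc := (proc C')(p := next_state A s f w), reg := apply_op f (reg C')\<rparr>"
  have "step A C' e C1'" unfolding e step_iff C1'_def using p s by auto
  moreover have "agree S C1 C1'"
    using execution_Cons.prems(1) p by (auto simp: agree_def s(5) C1'_def)
  from execution_Cons.IH[OF this] obtain D' where "execution A C1' es D'" "agree S D D'"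
    using execution_Cons.prems(2) by auto
  ultimately show ?case by (auto simp: execution_Cons_iff)
qed auto

lemma reachable_execution: "reachable A C \<Longrightarrow> execution A C es D \<Longrightarrow> reachable A D"
  unfolding reachable_def by (metis execution_append)

section \<open>Returned values\<close>

lemma Returned_event:
  assumes "execution A C es D" "proc D p = Returned b" "proc C p \<noteq> Returned b"
  shows "(p, Return b, Ack) \<in> set es"
  using assms
proof (induction rule: execution.induct)
  case (execution_Cons C e C' es D)
  obtain q f w where e: "e = (q, f, w)" by (cases e)
  show ?case
  proof (cases "proc C' p = Returned b")
    case True
    then show ?thesis using execution_Cons.hyps(1) execution_Cons.prems unfolding e
      by (cases f) (auto simp: step_iff split: if_splits)
  qed (use execution_Cons in auto)
qed simp

lemma agreement:
  assumes "correct_consensus A" "reachable A C" "proc C p = Returned b" "proc C q = Returned b'"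
  shows "b = b'"
proof -
  obtain inp es where es: "execution A (initial A inp) es C" using assms(2) by (auto simp: reachable_def)
  have "(p, Return b, Ack) \<in> set es" "(q, Return b', Ack) \<in> set es"
    using Returned_event[OF es] assms(3,4) by (auto simp: initial_def)
  then show ?thesis using assms(1) es unfolding correct_consensus_def by blast
qed

lemma validity:
  assumes "correct_consensus A" "execution A (initial A inp) es C" "(p, Return v, w) \<in> set es"
  shows "\<exists>q \<in> fst ` set es. inp q = v"
proof -
  have "\<forall>p v w. (p, Return v, w) \<in> set es \<longrightarrow>
      (\<forall>p' v' w'. (p', Return v', w') \<in> set es \<longrightarrow> v' = v) \<and> (\<exists>q \<in> fst ` set es. inp q = v)"
    by (rule assms(1)[unfolded correct_consensus_def, THEN spec, THEN spec, THEN spec, THEN mp, OF assms(2)])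
  then show ?thesis using assms(3) by blast
qed

section \<open>Split pairs\<close>

lemma split_since_Nil [simp]: "\<not> split_since [] q x v F"
  by (auto simp: split_since_def)

text \<open>Peeling off the last action turns the global condition on the history into a recursion;
  the status of every pair is updated in this way as an execution grows.\<close>

lemma split_since_snoc:
  "split_since (E @ [a]) q x v F \<longleftrightarrow>
    a = Split q x v \<and> F = [] \<or> actor a \<noteq> q \<and> (\<exists>F'. F = F' @ [a] \<and> split_since E q x v F')"
proof (cases F rule: rev_cases)
  case (snoc F' b)
  then show ?thesis by (auto simp: split_since_def)
qed (auto simp: split_since_def)

lemma is_split_Nil [simp]: "\<not> is_split [] q"
  by (simp add: is_split_def)

lemma fresh_on_Nil [simp]: "\<not> fresh_on [] q x"
  by (simp add: fresh_on_def)

lemma stale_on_Nil [simp]: "\<not> stale_on [] q x"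
  by (simp add: stale_on_def)

lemma is_split_snoc:
  "is_split (E @ [a]) q \<longleftrightarrow> (if actor a = q then (\<exists>x v. a = Split q x v) else is_split E q)"
  unfolding is_split_def split_since_snoc by auto

lemma fresh_on_snoc:
  "fresh_on (E @ [a]) q x \<longleftrightarrow>
    (if actor a = q then (\<exists>v. a = Split q x v) else fresh_on E q x \<and> x \<notin> written (events_of a))"
proof (cases "actor a = q")
  case False
  have "fresh_on (E @ [a]) q x \<longleftrightarrow> (\<exists>v F'. split_since E q x v F' \<and> x \<notin> written (events (F' @ [a])))"
    unfolding fresh_on_def split_since_snoc using False by fastforce
  then show ?thesis using False by (auto simp: fresh_on_def)
qed (auto simp: fresh_on_def split_since_snoc)

lemma stale_on_snoc:
  "stale_on (E @ [a]) q x \<longleftrightarrow>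
    actor a \<noteq> q \<and> (stale_on E q x \<or> fresh_on E q x \<and> x \<in> written (events_of a))"
proof (cases "actor a = q")
  case False
  have "stale_on (E @ [a]) q x \<longleftrightarrow> (\<exists>v F'. split_since E q x v F' \<and> x \<in> written (events (F' @ [a])))"
    unfolding stale_on_def split_since_snoc using False by fastforce
  then show ?thesis using False by (auto simp: fresh_on_def stale_on_def)
qed (auto simp: stale_on_def split_since_snoc)

lemma is_split_iff: "is_split E q \<longleftrightarrow> (\<exists>x. fresh_on E q x \<or> stale_on E q x)"
  unfolding is_split_def fresh_on_def stale_on_def by blast

lemma split_since_register:
  "split_since E q x v F \<Longrightarrow> split_since E q y u G \<Longrightarrow> x = y \<and> v = u \<and> F = G"
  by (induction E arbitrary: F G rule: rev_induct) (auto simp: split_since_snoc)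

lemma fresh_on_unique: "fresh_on E q x \<Longrightarrow> fresh_on E q y \<Longrightarrow> x = y"
  unfolding fresh_on_def by (meson split_since_register)

lemma stale_on_unique: "stale_on E q x \<Longrightarrow> stale_on E q y \<Longrightarrow> x = y"
  unfolding stale_on_def by (meson split_since_register)

lemma pair_execution_Nil [simp]: "pair_execution A inp U [] C \<longleftrightarrow> C = initial A inp"
  by (simp add: pair_execution_def)

lemma pair_execution_snoc:
  "pair_execution A inp U (E @ [a]) D \<longleftrightarrow>
    (\<exists>C. pair_execution A inp U E C \<and> actor a \<in> U \<and> allowed_after E a \<and> execution A C (events_of a) D)"
proof -
  have "(\<forall>k < length (E @ [a]). allowed_after (take k (E @ [a])) ((E @ [a]) ! k)) \<longleftrightarrow>
      (\<forall>k < length E. allowed_after (take k E) (E ! k)) \<and> allowed_after E a"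
    by (auto simp: less_Suc_eq nth_append)
  then show ?thesis unfolding pair_execution_def by (auto simp: execution_append)
qed

lemma pair_execution_reachable: "pair_execution A inp U E C \<Longrightarrow> reachable A C"
  by (auto simp: pair_execution_def reachable_def)

lemma clone_pairs_iff:
  "clone_pairs A inp U \<longleftrightarrow>
    (\<forall>q \<in> U. fst q \<in> procs A \<and> snd q \<in> procs A \<and> fst q \<noteq> snd q \<and> inp (fst q) = inp (snd q)) \<and>
    (\<forall>q \<in> U. \<forall>q' \<in> U. q \<noteq> q' \<longrightarrow> {fst q, snd q} \<inter> {fst q', snd q'} = {})"
  unfolding clone_pairs_def disjoint_family_on_def case_prod_beta by blast

text \<open>The two parts need a common induction: splitting uses the equality of the two states,
  and uniting uses the write at which the clone is poised.\<close>

lemma pair_states: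
  assumes "clone_pairs A inp U" "pair_execution A inp U E C" "q \<in> U"
  shows "(\<not> is_split E q \<longrightarrow> proc C (fst q) = proc C (snd q)) \<and>
    (\<forall>x v F. split_since E q x v F \<longrightarrow>
      (\<exists>s. proc C (snd q) = Active s \<and> Write x v \<in> ops A s \<and>
           proc C (fst q) = next_state A s (Write x v) Ack) \<and>
      (x \<notin> written (events F) \<longrightarrow> reg C x = v))"
  using assms(2)
proof (induction E arbitrary: C rule: rev_induct)
  case Nil
  then show ?case using assms(1,3) by (auto simp: initial_def clone_pairs_iff)
next
  case (snoc a E)
  then obtain C0 where C0: "pair_execution A inp U E C0" and a: "actor a \<in> U" "allowed_after E a"
    and ex: "execution A C0 (events_of a) C"
    by (auto simp: pair_execution_snoc)
  note IH = snoc.IH[OF C0]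
  show ?case
  proof (cases "actor a = q")
    case False
    then have disj: "{fst q, snd q} \<inter> {fst (actor a), snd (actor a)} = {}"
      using assms a by (auto simp: clone_pairs_iff)
    then have idle: "proc C (fst q) = proc C0 (fst q)" "proc C (snd q) = proc C0 (snd q)"
      using execution_proc_idle[OF ex] by (cases a; auto)+
    have since: "split_since (E @ [a]) q x v F \<longleftrightarrow> (\<exists>F'. F = F' @ [a] \<and> split_since E q x v F')" for x v F
      using False by (auto simp: split_since_snoc)
    have split: "is_split (E @ [a]) q = is_split E q"
      using False by (simp add: is_split_snoc)
    show ?thesis unfolding since split idle using IH execution_reg_unwritten[OF ex] by force
  next
    case True
    have q: "fst q \<noteq> snd q" using assms by (auto simp: clone_pairs_iff)
    show ?thesis
    proof (cases a)
      case (Joint q' f w)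
      then have eq: "proc C0 (fst q) = proc C0 (snd q)" and [simp]: "q' = q" using True a IH by auto
      have "execution A C0 [(fst q, f, w), (snd q, f, w)] C" using ex Joint by simp
      then have "proc C (fst q) = proc C (snd q)" unfolding joint_iff[OF q eq] using q by auto
      then show ?thesis using Joint by (simp add: is_split_snoc split_since_snoc)
    next
      case (Split q' x v)
      then have eq: "proc C0 (fst q) = proc C0 (snd q)" and [simp]: "q' = q" using True a IH by auto
      have "step A C0 (fst q, Write x v, Ack) C" using ex Split by (simp add: execution_Cons_iff)
      then have "\<exists>s. proc C (snd q) = Active s \<and> Write x v \<in> ops A s \<and>
          proc C (fst q) = next_state A s (Write x v) Ack" "reg C x = v"
        unfolding step_iff using q eq by auto
      then show ?thesis using Split by (simp add: is_split_snoc split_since_snoc)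
    next
      case (Unite q' x v)
      then have [simp]: "q' = q" using True by simp
      obtain F where "split_since E q x v F" using a Unite by auto
      then obtain s where s: "proc C0 (snd q) = Active s" "proc C0 (fst q) = next_state A s (Write x v) Ack"
        using IH by blast
      have "step A C0 (snd q, Write x v, Ack) C" using ex Unite by (simp add: execution_Cons_iff)
      then have "proc C (fst q) = proc C (snd q)" unfolding step_iff using q s by auto
      then show ?thesis using Unite by (simp add: is_split_snoc split_since_snoc)
    qed
  qed
qed

section \<open>Reserving executions with immobile reserved pairs\<close>

text \<open>Replaces "not split", which depends on the history, by a property of the configuration,
  so that reserving executions can be studied without the execution that leads to
  \<open>C\<close>.\<close>

definition synced :: "('p, 's, 'r, 'v, 'c) system \<Rightarrow> ('p, 's, 'r, 'v) config \<Rightarrow> ('p \<times> 'p) set \<Rightarrow> bool" where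
  "synced A C P \<longleftrightarrow>
    (\<forall>q \<in> P. fst q \<in> procs A \<and> snd q \<in> procs A \<and> fst q \<noteq> snd q \<and> proc C (fst q) = proc C (snd q)) \<and>
    (\<forall>q \<in> P. \<forall>q' \<in> P. q \<noteq> q' \<longrightarrow> {fst q, snd q} \<inter> {fst q', snd q'} = {})"

abbreviation members :: "('p \<times> 'p) set \<Rightarrow> 'p set" where
  "members P \<equiv> fst ` P \<union> snd ` P"

lemma agree_members_Un:
  assumes "agree (members (P \<union> Q)) C D"
  shows "agree (members P) C D" "agree (members Q) C D"
  using assms by (auto simp: agree_def)

text \<open>
  The reserved pair of \<open>x\<close> is the same at all times and never moves once \<open>x\<close> is written. Unlike
  \<open>reserving\<close>, which allows the assignment to change, this makes it possible to hand reserved pairs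
  over as covering pairs.
\<close>

definition steady ::
  "('p, 's, 'r, 'v, 'c) system \<Rightarrow> ('p, 's, 'r, 'v) config \<Rightarrow> ('p \<times> 'p) set \<Rightarrow> ('r \<Rightarrow> 'p \<times> 'p)
    \<Rightarrow> ('p, 'r, 'v, 'c) action list \<Rightarrow> bool" where
  "steady A C P \<rho> \<gamma> \<longleftrightarrow>
    (\<exists>D. execution A C (events \<gamma>) D) \<and>
    (\<forall>a \<in> set \<gamma>. \<exists>q \<in> P. \<exists>f w. a = Joint q f w) \<and>
    inj_on \<rho> (written (events \<gamma>)) \<and> \<rho> ` written (events \<gamma>) \<subseteq> P \<and>
    (\<forall>a \<in> set (butlast \<gamma>). \<forall>q v w. a \<noteq> Joint q (Return v) w) \<and>
    (\<forall>\<gamma>1 a \<gamma>2 D. \<gamma> = \<gamma>1 @ a # \<gamma>2 \<and> execution A C (events \<gamma>1) D \<longrightarrow>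
      (\<forall>x \<in> written (events (\<gamma>1 @ [a])). \<rho> x \<noteq> actor a \<and> pair_covers A D (\<rho> x) x))"

definition can_return :: "('p, 's, 'r, 'v, 'c) system \<Rightarrow> ('p, 's, 'r, 'v) config \<Rightarrow> ('p \<times> 'p) set \<Rightarrow> bool \<Rightarrow> bool" where
  "can_return A C P b \<longleftrightarrow> (\<exists>\<rho> \<gamma>. steady A C P \<rho> \<gamma> \<and> returns \<gamma> b)"

lemma steadyD:
  assumes "steady A C P \<rho> \<gamma>"
  shows "\<exists>D. execution A C (events \<gamma>) D"
    and "\<forall>a \<in> set \<gamma>. \<exists>q \<in> P. \<exists>f w. a = Joint q f w"
    and "inj_on \<rho> (written (events \<gamma>))" and "\<rho> ` written (events \<gamma>) \<subseteq> P"
    and "\<forall>a \<in> set (butlast \<gamma>). \<forall>q v w. a \<noteq> Joint q (Return v) w"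
    and "\<lbrakk>\<gamma> = \<gamma>1 @ a # \<gamma>2; execution A C (events \<gamma>1) D; x \<in> written (events (\<gamma>1 @ [a]))\<rbrakk>
      \<Longrightarrow> \<rho> x \<noteq> actor a \<and> pair_covers A D (\<rho> x) x"
proof -
  show "\<exists>D. execution A C (events \<gamma>) D" "\<forall>a \<in> set \<gamma>. \<exists>q \<in> P. \<exists>f w. a = Joint q f w"
    "inj_on \<rho> (written (events \<gamma>))" "\<rho> ` written (events \<gamma>) \<subseteq> P"
    "\<forall>a \<in> set (butlast \<gamma>). \<forall>q v w. a \<noteq> Joint q (Return v) w"
    by (insert assms, unfold steady_def) (elim conjE, assumption)+
  have "\<forall>\<gamma>1 a \<gamma>2 D. \<gamma> = \<gamma>1 @ a # \<gamma>2 \<and> execution A C (events \<gamma>1) D \<longrightarrow>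
      (\<forall>x \<in> written (events (\<gamma>1 @ [a])). \<rho> x \<noteq> actor a \<and> pair_covers A D (\<rho> x) x)"
    by (insert assms, unfold steady_def) (elim conjE, assumption)
  then show "\<lbrakk>\<gamma> = \<gamma>1 @ a # \<gamma>2; execution A C (events \<gamma>1) D; x \<in> written (events (\<gamma>1 @ [a]))\<rbrakk>
      \<Longrightarrow> \<rho> x \<noteq> actor a \<and> pair_covers A D (\<rho> x) x" by blast
qed

lemma steadyI:
  assumes "\<exists>D. execution A C (events \<gamma>) D"
    and "\<forall>a \<in> set \<gamma>. \<exists>q \<in> P. \<exists>f w. a = Joint q f w"
    and "inj_on \<rho> (written (events \<gamma>))" and "\<rho> ` written (events \<gamma>) \<subseteq> P"
    and "\<forall>a \<in> set (butlast \<gamma>). \<forall>q v w. a \<noteq> Joint q (Return v) w"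
    and "\<And>\<gamma>1 a \<gamma>2 D x. \<lbrakk>\<gamma> = \<gamma>1 @ a # \<gamma>2; execution A C (events \<gamma>1) D; x \<in> written (events (\<gamma>1 @ [a]))\<rbrakk>
      \<Longrightarrow> \<rho> x \<noteq> actor a \<and> pair_covers A D (\<rho> x) x"
  shows "steady A C P \<rho> \<gamma>"
  unfolding steady_def
proof (intro conjI)
  show "\<forall>\<gamma>1 a \<gamma>2 D. \<gamma> = \<gamma>1 @ a # \<gamma>2 \<and> execution A C (events \<gamma>1) D \<longrightarrow>
      (\<forall>x \<in> written (events (\<gamma>1 @ [a])). \<rho> x \<noteq> actor a \<and> pair_covers A D (\<rho> x) x)"
    using assms(6) by blast
qed (fact assms)+

lemma synced_disjoint:
  "synced A C P \<Longrightarrow> q \<in> P \<Longrightarrow> q' \<in> P \<Longrightarrow> q \<noteq> q' \<Longrightarrow>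
    fst q \<noteq> fst q' \<and> fst q \<noteq> snd q' \<and> snd q \<noteq> fst q' \<and> snd q \<noteq> snd q'"
  unfolding synced_def by blast

lemma synced_joint_iff:
  assumes "synced A C P" "q \<in> P"
  shows "execution A C [(fst q, f, w), (snd q, f, w)] D \<longleftrightarrow>
    (\<exists>s. proc C (fst q) = Active s \<and> f \<in> ops A s \<and> outcome_ok (reg C) f w \<and>
      D = C\<lparr>proc := (proc C)(fst q := next_state A s f w, snd q := next_state A s f w), reg := apply_op f (reg C)\<rparr>)"
proof -
  have "fst q \<noteq> snd q" "proc C (fst q) = proc C (snd q)" "fst q \<in> procs A" "snd q \<in> procs A"
    using assms by (auto simp: synced_def)
  then show ?thesis using joint_iff[of "fst q" "snd q" C A f w D] by simp
qed

lemma synced_joint: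
  assumes "synced A C P" "q \<in> P" "execution A C [(fst q, f, w), (snd q, f, w)] D"
  shows "synced A D P"
proof -
  obtain s where D: "D = C\<lparr>proc := (proc C)(fst q := next_state A s f w, snd q := next_state A s f w), reg := apply_op f (reg C)\<rparr>"
    using assms(3) unfolding synced_joint_iff[OF assms(1,2)] by blast
  have "proc D (fst q') = proc D (snd q')" if "q' \<in> P" for q'
  proof (cases "q' = q")
    case True
    then show ?thesis by (simp add: D)
  next
    case False
    then show ?thesis using synced_disjoint[OF assms(1,2) that] assms(1) that
      unfolding D synced_def by auto
  qed
  then show ?thesis using assms(1) unfolding synced_def by blast
qed

lemma synced_execution:
  assumes "synced A C P" "\<forall>a \<in> set \<gamma>. \<exists>q \<in> P. \<exists>f w. a = Joint q f w" "execution A C (events \<gamma>) D"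
  shows "synced A D P"
  using assms
proof (induction \<gamma> arbitrary: C)
  case (Cons a \<gamma>)
  obtain q f w where a: "a = Joint q f w" "q \<in> P" using Cons.prems by auto
  obtain C1 where C1: "execution A C [(fst q, f, w), (snd q, f, w)] C1" "execution A C1 (events \<gamma>) D"
    using Cons.prems(3) execution_append[of A C "events_of a" "events \<gamma>" D] a by auto
  then show ?case using Cons.IH[of C1] synced_joint[OF Cons.prems(1) a(2) C1(1)] Cons.prems(2) by simp
qed simp

lemma events_Joint_members:
  "\<forall>a \<in> set \<gamma>. \<exists>q \<in> P. \<exists>f w. a = Joint q f w \<Longrightarrow> fst ` set (events \<gamma>) \<subseteq> members P"
proof (induction \<gamma>)
  case (Cons a \<gamma>)
  obtain q f w where "a = Joint q f w" "q \<in> P" using Cons.prems by auto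
  then show ?case using Cons by simp
qed simp

lemma pair_covers_idle:
  assumes "execution A C es D" "fst q \<notin> fst ` set es" "snd q \<notin> fst ` set es"
  shows "pair_covers A D q x = pair_covers A C q x"
  using execution_proc_idle[OF assms(1)] assms by (simp add: pair_covers_def covers_def)

lemma idle_pair:
  assumes "synced A C P" "\<forall>a \<in> set \<gamma>. \<exists>q \<in> P. \<exists>f w. a = Joint q f w" "q \<in> P" "q \<notin> actor ` set \<gamma>"
  shows "fst q \<notin> fst ` set (events \<gamma>)" "snd q \<notin> fst ` set (events \<gamma>)"
proof -
  have "\<forall>a \<in> set \<gamma>. \<exists>q \<in> P - {q}. \<exists>f w. a = Joint q f w"
    using assms(2,4) by (metis DiffI action.sel(1) image_eqI singletonD)
  then have "fst ` set (events \<gamma>) \<subseteq> members (P - {q})"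
    by (rule events_Joint_members)
  moreover have "fst q \<notin> members (P - {q}) \<and> snd q \<notin> members (P - {q})"
    using assms(1,3) by (fastforce dest: synced_disjoint)
  ultimately show "fst q \<notin> fst ` set (events \<gamma>)" "snd q \<notin> fst ` set (events \<gamma>)" by auto
qed

text \<open>The condition in \<open>steady\<close> speaks about the configuration before each action
  and already includes the register which that action writes. The reserved pair is not the actor, so
  its covering survives the action.\<close>

lemma steady_covers_after:
  assumes "steady A C P \<rho> \<gamma>" "synced A C P" "k \<le> length \<gamma>" "execution A C (events (take k \<gamma>)) D"
    "x \<in> written (events (take k \<gamma>))"
  shows "pair_covers A D (\<rho> x) x"
proof -
  obtain j where j: "k = Suc j" using assms(5) by (cases k) auto
  let ?a = "\<gamma> ! j"
  have tk: "take k \<gamma> = take j \<gamma> @ [?a]" using assms(3) j by (simp add: take_Suc_conv_app_nth)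
  have dec: "\<gamma> = take j \<gamma> @ ?a # drop k \<gamma>" using assms(3) j by (simp add: id_take_nth_drop)
  obtain D1 where D1: "execution A C (events (take j \<gamma>)) D1" "execution A D1 (events_of ?a) D"
    using assms(4) unfolding tk by (auto simp: execution_append)
  have cov: "\<rho> x \<noteq> actor ?a" "pair_covers A D1 (\<rho> x) x"
    using assms(1,5) dec D1(1) unfolding steady_def tk by blast+
  have P: "\<forall>a \<in> set \<gamma>. \<exists>q \<in> P. \<exists>f w. a = Joint q f w" using assms(1) by (simp add: steady_def)
  have "set (take k \<gamma>) \<subseteq> set \<gamma>" by (rule set_take_subset)
  then have P1: "\<forall>a \<in> set (take j \<gamma>). \<exists>q \<in> P. \<exists>f w. a = Joint q f w"
    "\<forall>a \<in> set [?a]. \<exists>q \<in> P. \<exists>f w. a = Joint q f w" using P tk by auto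
  have "written (events (take k \<gamma>)) \<subseteq> written (events \<gamma>)"
    by (metis append_take_drop_id events_simps(3) sup_ge1 written_simps(2))
  then have "\<rho> x \<in> P" using assms(1,5) by (auto simp: steady_def)
  then show ?thesis
    using pair_covers_idle[OF D1(2)] idle_pair[OF synced_execution[OF assms(2) P1(1) D1(1)] P1(2)] cov by simp
qed

lemma steady_reserving:
  assumes "steady A C P \<rho> \<gamma>" "synced A C P" "m + 1 \<le> card P"
  shows "reserving A m C P \<gamma>"
proof -
  have res: "\<exists>reserved. inj_on reserved (written (events (take k \<gamma>))) \<and>
      (\<forall>x \<in> written (events (take k \<gamma>)). reserved x \<in> P \<and> pair_covers A D (reserved x) x)"
    if "k \<le> length \<gamma>" "execution A C (events (take k \<gamma>)) D" for k D
  proof -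
    have "written (events (take k \<gamma>)) \<subseteq> written (events \<gamma>)"
      by (metis append_take_drop_id events_simps(3) sup_ge1 written_simps(2))
    moreover have "inj_on \<rho> (written (events \<gamma>))" "\<rho> ` written (events \<gamma>) \<subseteq> P"
      using assms(1) unfolding steady_def by blast+
    ultimately have "inj_on \<rho> (written (events (take k \<gamma>)))" "\<rho> ` written (events (take k \<gamma>)) \<subseteq> P"
      by (meson inj_on_subset, blast)
    then show ?thesis using steady_covers_after[OF assms(1,2) that] by blast
  qed
  have ret: "i = length \<gamma> - 1" if "i < length \<gamma>" "\<gamma> ! i = Joint q (Return v) w" for i q v w
  proof (rule ccontr)
    assume "i \<noteq> length \<gamma> - 1"
    then have "\<gamma> ! i \<in> set (butlast \<gamma>)"
      using that(1) by (metis One_nat_def Suc_pred length_butlast less_Suc_eq nth_butlast nth_mem length_pos_if_in_set)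
    then show False using assms(1) that(2) unfolding steady_def by metis
  qed
  have run: "\<exists>D. execution A C (events \<gamma>) D" "\<forall>a \<in> set \<gamma>. \<exists>q \<in> P. \<exists>f w. a = Joint q f w"
    using assms(1) unfolding steady_def by blast+
  show ?thesis unfolding reserving_def
    by (intro conjI allI impI) (fact assms(3) run | erule (1) res | erule (1) ret)+
qed

lemma can_return_Res:
  assumes "can_return A C P b" "synced A C P" "m + 1 \<le> card P"
  shows "\<exists>\<gamma> \<in> Res A m C P. returns \<gamma> b"
  using assms steady_reserving unfolding can_return_def Res_def by blast

lemma steady_agree:
  assumes "steady A C P \<rho> \<gamma>" "agree (members P) C C'"
  shows "steady A C' P \<rho> \<gamma>"
proof -
  note P = steadyD(2)[OF assms(1)]
  obtain D where D: "execution A C (events \<gamma>) D" using steadyD(1)[OF assms(1)] by blast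
  have "\<exists>D. execution A C' (events \<gamma>) D"
    using execution_agree[OF D assms(2) events_Joint_members[OF P]] by blast
  moreover have "\<rho> x \<noteq> actor a \<and> pair_covers A D (\<rho> x) x"
    if eq: "\<gamma> = \<gamma>1 @ a # \<gamma>2" and ex: "execution A C' (events \<gamma>1) D"
      and x: "x \<in> written (events (\<gamma>1 @ [a]))" for \<gamma>1 a \<gamma>2 D x
  proof -
    have "fst ` set (events \<gamma>1) \<subseteq> members P"
      using P eq by (intro events_Joint_members) auto
    then obtain D0 where D0: "execution A C (events \<gamma>1) D0" "agree (members P) D D0"
      using execution_agree[OF ex agree_sym[OF assms(2)]] by blast
    then have "\<rho> x \<noteq> actor a \<and> pair_covers A D0 (\<rho> x) x"
      using steadyD(6)[OF assms(1) eq] x by blast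
    moreover have "\<rho> x \<in> P" using steadyD(4)[OF assms(1)] eq x by auto
    ultimately show ?thesis using D0(2) by (simp add: pair_covers_def covers_def agree_def)
  qed
  ultimately show ?thesis using steadyD[OF assms(1)] by (intro steadyI)
qed

lemma can_return_agree: "can_return A C P b \<Longrightarrow> agree (members P) C C' \<Longrightarrow> can_return A C' P b"
  unfolding can_return_def using steady_agree by blast

lemma returns_execution:
  assumes "steady A C P \<rho> \<gamma>" "returns \<gamma> b" "execution A C (events \<gamma>) D"
  shows "\<exists>q \<in> P. proc D (fst q) = Returned b"
proof -
  obtain q w where q: "\<gamma> \<noteq> []" "last \<gamma> = Joint q (Return b) w" using assms(2) by (auto simp: returns_def)
  then have \<gamma>: "\<gamma> = butlast \<gamma> @ [Joint q (Return b) w]" by (metis append_butlast_last_id)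
  then have "q \<in> P" using steadyD(2)[OF assms(1)] by (metis action.inject(1) last_in_set q)
  obtain D1 where D1: "execution A D1 [(fst q, Return b, w), (snd q, Return b, w)] D"
    using assms(3) by (subst (asm) \<gamma>) (auto simp: execution_append)
  then obtain D2 where "step A D1 (fst q, Return b, w) D2" "step A D2 (snd q, Return b, w) D"
    by (auto simp: execution_Cons_iff)
  then have "proc D (fst q) = Returned b" by (auto simp: step_iff)
  with \<open>q \<in> P\<close> show ?thesis by blast
qed

text \<open>Reserving when the registers in \<open>X\<close> have already been assigned their reserved pairs.\<close>

definition rsv ::
  "('p, 's, 'r, 'v, 'c) system \<Rightarrow> ('p, 's, 'r, 'v) config \<Rightarrow> ('p \<times> 'p) set \<Rightarrow> 'r set \<Rightarrow> ('r \<Rightarrow> 'p \<times> 'p)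
    \<Rightarrow> ('p, 'r, 'v, 'c) action list \<Rightarrow> bool" where
  "rsv A C P X \<rho> \<gamma> \<longleftrightarrow> steady A C P \<rho> \<gamma> \<and> inj_on \<rho> (X \<union> written (events \<gamma>)) \<and> \<rho> ` X \<subseteq> P \<and>
    (\<forall>x \<in> X. pair_covers A C (\<rho> x) x) \<and> actor ` set \<gamma> \<inter> \<rho> ` X = {}"

text \<open>Executions are built from their end towards their beginning. The new first step may
  write only to registers in \<open>X\<close>, because these have a reserved pair before the step;
  and it may be a return only if nothing follows.\<close>

lemma rsv_Cons:
  assumes r: "rsv A C1 P X \<rho> \<gamma>" and sy: "synced A C P" and q: "q \<in> P" "q \<notin> \<rho> ` X" and f: "op_writes f \<subseteq> X"
    and ex: "execution A C [(fst q, f, w), (snd q, f, w)] C1" and ret: "\<gamma> = [] \<or> (\<forall>b. f \<noteq> Return b)"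
  shows "rsv A C P X \<rho> (Joint q f w # \<gamma>)"
proof -
  have s: "steady A C1 P \<rho> \<gamma>" and inj: "inj_on \<rho> (X \<union> written (events \<gamma>))" and XP: "\<rho> ` X \<subseteq> P"
    and cov: "\<forall>x \<in> X. pair_covers A C1 (\<rho> x) x" and act: "actor ` set \<gamma> \<inter> \<rho> ` X = {}"
    using r by (auto simp: rsv_def)
  have sy1: "synced A C1 P" using synced_joint[OF sy q(1) ex] .
  have P: "\<forall>a \<in> set \<gamma>. \<exists>q \<in> P. \<exists>f w. a = Joint q f w" using s by (simp add: steady_def)
  have cov0: "pair_covers A C (\<rho> x) x" if "x \<in> X" for x
  proof -
    have "\<rho> x \<in> P" "\<rho> x \<noteq> q" using that XP q(2) by auto
    then have "fst (\<rho> x) \<notin> {fst q, snd q}" "snd (\<rho> x) \<notin> {fst q, snd q}"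
      using synced_disjoint[OF sy _ q(1)] by blast+
    then show ?thesis using pair_covers_idle[OF ex, of "\<rho> x" x] cov that by auto
  qed
  have "\<exists>D. execution A C (events (Joint q f w # \<gamma>)) D"
    using s ex execution_append[of A C "[(fst q, f, w), (snd q, f, w)]" "events \<gamma>"]
    by (auto simp: steady_def)
  moreover have w: "X \<union> written (events (Joint q f w # \<gamma>)) = X \<union> written (events \<gamma>)"
    using f by auto
  then have "inj_on \<rho> (written (events (Joint q f w # \<gamma>)))"
    using inj by (metis inj_on_subset sup_ge2)
  moreover have "\<rho> ` written (events (Joint q f w # \<gamma>)) \<subseteq> P"
    using s XP f by (auto simp: steady_def)
  moreover have "\<forall>a \<in> set (butlast (Joint q f w # \<gamma>)). \<forall>q v w. a \<noteq> Joint q (Return v) w"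
    using s ret by (auto simp: steady_def)
  moreover have "\<rho> x \<noteq> actor a \<and> pair_covers A D (\<rho> x) x"
    if eq: "Joint q f w # \<gamma> = \<gamma>1 @ a # \<gamma>2" and D: "execution A C (events \<gamma>1) D"
      and x: "x \<in> written (events (\<gamma>1 @ [a]))" for \<gamma>1 a \<gamma>2 D x
  proof (cases \<gamma>1)
    case Nil
    then have "x \<in> X" "a = Joint q f w" "D = C" using eq D x f by auto
    then show ?thesis using cov0 q by auto
  next
    case (Cons a' \<gamma>1')
    then have \<gamma>: "\<gamma> = \<gamma>1' @ a # \<gamma>2" "a' = Joint q f w" using eq by auto
    have D1: "execution A C1 (events \<gamma>1') D"
    proof -
      have "execution A C ([(fst q, f, w), (snd q, f, w)] @ events \<gamma>1') D" using D Cons \<gamma>(2) by simp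
      then show ?thesis using ex unfolding execution_append by (metis execution_det)
    qed
    show ?thesis
    proof (cases "x \<in> written (events (\<gamma>1' @ [a]))")
      case True
      then show ?thesis using steadyD(6)[OF s \<gamma>(1) D1] by blast
    next
      case False
      then have xX: "x \<in> X" using x Cons \<gamma>(2) f by auto
      have "\<rho> x \<notin> actor ` set \<gamma>" using act xX by blast
      then have na: "\<rho> x \<notin> actor ` set \<gamma>1'" "\<rho> x \<noteq> actor a" using \<gamma>(1) by auto
      have P1: "\<forall>a \<in> set \<gamma>1'. \<exists>q \<in> P. \<exists>f w. a = Joint q f w" using P \<gamma>(1) by auto
      have "\<rho> x \<in> P" using XP xX by auto
      then have "pair_covers A D (\<rho> x) x = pair_covers A C1 (\<rho> x) x"
        using pair_covers_idle[OF D1] idle_pair[OF sy1 P1 _ na(1)] by blast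
      then show ?thesis using cov xX na(2) by simp
    qed
  qed
  moreover have "\<forall>a \<in> set (Joint q f w # \<gamma>). \<exists>q \<in> P. \<exists>f w. a = Joint q f w" using P q(1) by auto
  ultimately have "steady A C P \<rho> (Joint q f w # \<gamma>)" by (intro steadyI)
  then show ?thesis unfolding rsv_def using inj w XP cov0 act q(2) by (simp add: insert_Diff_if)
qed

text \<open>The pair \<open>c1\<close> performs the write, and \<open>c2\<close>, poised at the same
  write, stays behind as the pair reserved for \<open>y\<close>. Neither belongs to
  \<open>P\<close>, so the execution that starts after the write does not move them.
  \<open>D\<close> enters only through agreement and may stem from an unrelated execution.\<close>

lemma can_return_prepend_write:
  assumes can: "can_return A D P b" and D: "agree (members P) D (C\<lparr>reg := (reg C)(y := v)\<rparr>)"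
    and c: "c1 \<notin> P" "c2 \<notin> P" "c1 \<noteq> c2" and sy: "synced A C (insert c1 (insert c2 P))"
    and s: "proc C (fst c1) = Active s" "proc C (fst c2) = Active s" "Write y v \<in> ops A s"
  shows "can_return A C (insert c1 (insert c2 P)) b"
proof -
  let ?P = "insert c1 (insert c2 P)"
  define C1 where "C1 = C\<lparr>proc := (proc C)(fst c1 := next_state A s (Write y v) Ack, snd c1 := next_state A s (Write y v) Ack),
    reg := (reg C)(y := v)\<rparr>"
  have ex: "execution A C [(fst c1, Write y v, Ack), (snd c1, Write y v, Ack)] C1"
    using synced_joint_iff[OF sy, of c1] s by (simp add: C1_def)
  have sy1: "synced A C1 ?P" using synced_joint[OF sy _ ex] by simp
  have dis: "{fst c1, snd c1} \<inter> members P = {}"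
  proof -
    have "fst c1 \<noteq> fst q \<and> fst c1 \<noteq> snd q \<and> snd c1 \<noteq> fst q \<and> snd c1 \<noteq> snd q" if "q \<in> P" for q
      using synced_disjoint[OF sy, of c1 q] that c(1) by auto
    then show ?thesis by auto
  qed
  have "p \<noteq> fst c1 \<and> p \<noteq> snd c1" if "p \<in> members P" for p using dis that by blast
  then have "agree (members P) D C1" using D by (simp add: agree_def C1_def)
  then obtain \<rho> \<gamma> where \<gamma>: "steady A C1 P \<rho> \<gamma>" "returns \<gamma> b"
    using can steady_agree unfolding can_return_def by blast
  \<comment> \<open>If \<open>\<gamma>\<close> writes to \<open>y\<close> again, \<open>c2\<close>
    replaces the pair that \<open>\<rho>\<close> had reserved for it. As \<open>c2\<close> is not in
    \<open>P\<close>, the assignment stays injective.\<close>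
  let ?\<rho> = "\<rho>(y := c2)"
  have P: "\<forall>a \<in> set \<gamma>. \<exists>q \<in> P. \<exists>f w. a = Joint q f w" using \<gamma>(1) by (simp add: steady_def)
  have c2c: "pair_covers A C1 c2 y"
  proof -
    have "fst c2 \<notin> {fst c1, snd c1}" "snd c2 \<notin> {fst c1, snd c1}" "proc C (snd c2) = proc C (fst c2)"
      using synced_disjoint[OF sy, of c2 c1] sy c(3) by (auto simp: synced_def)
    then show ?thesis using s by (auto simp: pair_covers_def covers_def C1_def)
  qed
  have inj: "inj_on ?\<rho> ({y} \<union> written (events \<gamma>))"
  proof -
    have "inj_on \<rho> (written (events \<gamma>))" "\<rho> ` written (events \<gamma>) \<subseteq> P" using \<gamma>(1) by (auto simp: steady_def)
    then show ?thesis using c(2) unfolding inj_on_def by auto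
  qed
  have "steady A C1 ?P ?\<rho> \<gamma>"
  proof -
    have "?\<rho> x \<noteq> actor a \<and> pair_covers A E (?\<rho> x) x"
      if eq: "\<gamma> = \<gamma>1 @ a # \<gamma>2" and E: "execution A C1 (events \<gamma>1) E"
        and x: "x \<in> written (events (\<gamma>1 @ [a]))" for \<gamma>1 a \<gamma>2 E x
    proof (cases "x = y")
      case True
      have P1: "\<forall>a \<in> set \<gamma>1. \<exists>q \<in> ?P. \<exists>f w. a = Joint q f w" using P eq by auto
      have "\<forall>a \<in> set \<gamma>. actor a \<in> P" using P by fastforce
      then have "c2 \<notin> actor ` set \<gamma>1" "c2 \<noteq> actor a" using eq c(2) by auto
      then have "pair_covers A E c2 y"
        using pair_covers_idle[OF E] idle_pair[OF sy1 P1, of c2] c2c by blast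
      then show ?thesis using True \<open>c2 \<noteq> actor a\<close> by simp
    next
      case False
      then show ?thesis using steadyD(6)[OF \<gamma>(1) eq E x] by simp
    qed
    moreover have "?\<rho> ` written (events \<gamma>) \<subseteq> ?P" using \<gamma>(1) by (auto simp: steady_def)
    moreover have "inj_on ?\<rho> (written (events \<gamma>))" using inj inj_on_subset by blast
    moreover have "\<forall>a \<in> set \<gamma>. \<exists>q \<in> ?P. \<exists>f w. a = Joint q f w" using P by auto
    ultimately show ?thesis using steadyD(1,5)[OF \<gamma>(1)] by (intro steadyI)
  qed
  then have "rsv A C1 ?P {y} ?\<rho> \<gamma>"
    unfolding rsv_def using inj c2c c(2) P by fastforce
  then have "rsv A C ?P {y} ?\<rho> (Joint c1 (Write y v) Ack # \<gamma>)"
    using rsv_Cons[OF _ sy _ _ _ ex] c(3) by simp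
  moreover have "returns (Joint c1 (Write y v) Ack # \<gamma>) b"
    using \<gamma>(2) by (auto simp: returns_def)
  ultimately show ?thesis unfolding can_return_def rsv_def by blast
qed

section \<open>Existence of steady executions that return\<close>

locale consensus =
  fixes A :: "('p, 's, 'r, 'v, 'c) system" and m :: nat
  assumes correct: "correct_consensus A"
    and solo: "nondet_solo_termination A"
    and registers: "uses_at_most A m"
begin

text \<open>Let the processes of the covering pairs perform their writes one after the other. Each
  of them is still in its original state when its turn comes, and the resulting execution uses all
  registers in \<open>X\<close>.\<close>

lemma covering_bound:
  assumes "reachable A C" "synced A C P" "inj_on \<rho> X" "\<rho> ` X \<subseteq> P" "\<forall>x \<in> X. pair_covers A C (\<rho> x) x" "finite X"
  shows "card X \<le> m"
proof -
  have "\<exists>es D. execution A C es D \<and> written es = X \<and> (\<forall>p. p \<notin> fst ` \<rho> ` X \<longrightarrow> proc D p = proc C p)"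
    using assms(6,3,4,5)
  proof (induction X rule: finite_induct)
    case empty
    then show ?case by (intro exI[of _ "[]"]) auto
  next
    case (insert x X)
    then obtain es D where D: "execution A C es D" "written es = X" "\<forall>p. p \<notin> fst ` \<rho> ` X \<longrightarrow> proc D p = proc C p"
      by auto
    have "fst (\<rho> x) \<notin> fst ` \<rho> ` X"
    proof
      assume "fst (\<rho> x) \<in> fst ` \<rho> ` X"
      then obtain y where y: "y \<in> X" "fst (\<rho> x) = fst (\<rho> y)" by auto
      then have "\<rho> x \<noteq> \<rho> y" using insert.prems(1) insert.hyps by (auto simp: inj_on_def)
      moreover have "\<rho> x \<in> P" "\<rho> y \<in> P" using insert.prems(2) y(1) by auto
      ultimately show False using synced_disjoint[OF assms(2)] y(2) by blast
    qed
    moreover obtain s v where "proc C (fst (\<rho> x)) = Active s" "Write x v \<in> ops A s"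
      using insert.prems(3) by (auto simp: pair_covers_def covers_def)
    moreover have "fst (\<rho> x) \<in> procs A" using insert.prems(2) assms(2) by (auto simp: synced_def)
    ultimately obtain D' where D': "step A D (fst (\<rho> x), Write x v, Ack) D'"
      using D(3) by (simp add: step_iff)
    then have "execution A C (es @ [(fst (\<rho> x), Write x v, Ack)]) D'"
      using D(1) by (auto simp: execution_append execution_Cons_iff)
    moreover have "\<forall>p. p \<notin> fst ` \<rho> ` insert x X \<longrightarrow> proc D' p = proc C p"
      using D' D(3) by (auto simp: step_iff)
    moreover have "written (es @ [(fst (\<rho> x), Write x v, Ack)]) = insert x X" using D(2) by auto
    ultimately show ?case by blast
  qed
  then obtain es D where es: "execution A C es D" "written es = X" by blast
  obtain inp es0 where "execution A (initial A inp) es0 C" using assms(1) by (auto simp: reachable_def)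
  then have "card (written (es0 @ es)) \<le> m"
    using registers es(1) unfolding uses_at_most_def by (metis execution_append)
  moreover have "card X \<le> card (written (es0 @ es))" using es(2) by (intro card_mono) auto
  ultimately show ?thesis by simp
qed

text \<open>
  The pair \<open>p\<close> runs alone until it returns or is about to write to an unreserved register, in which
  case it becomes the pair reserved for that register and never moves again.
\<close>

lemma rsv_run:
  assumes stop: "\<And>D x. \<lbrakk>reachable A D; synced A D P; \<forall>q \<in> P. \<exists>s. proc D (fst q) = Active s;
      \<forall>x \<in> X. pair_covers A D (\<rho> x) x; pair_covers A D p x; x \<notin> X\<rbrakk> \<Longrightarrow> 
      \<exists>\<rho>' \<gamma> b. rsv A D P X \<rho>' \<gamma> \<and> returns \<gamma> b \<and> (\<forall>x \<in> X. \<rho>' x = \<rho> x)"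
    and "execution A S es D" "fst ` set es \<subseteq> {fst p}" "proc D (fst p) = Returned v"
    and "agree {fst p} S C"
    and "reachable A C" "synced A C P" "\<forall>q \<in> P. \<exists>s. proc C (fst q) = Active s"
    and "p \<in> P" "p \<notin> \<rho> ` X" "inj_on \<rho> X" "\<rho> ` X \<subseteq> P" "\<forall>x \<in> X. pair_covers A C (\<rho> x) x"
  shows "\<exists>\<rho>' \<gamma> b. rsv A C P X \<rho>' \<gamma> \<and> returns \<gamma> b \<and> (\<forall>x \<in> X. \<rho>' x = \<rho> x)"
  using assms(2-8,13)
proof (induction arbitrary: C rule: execution.induct)
  case (execution_Nil S)
  then show ?case using \<open>p \<in> P\<close> by (force simp: agree_def)
next
  case (execution_Cons S e S' es D)
  obtain f w where e: "e = (fst p, f, w)" using execution_Cons.prems(1) by (cases e) auto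
  have ag: "reg S = reg C" "proc S (fst p) = proc C (fst p)" using execution_Cons.prems(3) by (auto simp: agree_def)
  obtain s where s: "proc C (fst p) = Active s" "f \<in> ops A s" "outcome_ok (reg C) f w"
    "S' = S\<lparr>proc := (proc S)(fst p := next_state A s f w), reg := apply_op f (reg S)\<rparr>"
    using execution_Cons.hyps(1) unfolding e step_iff ag by blast
  have pp: "proc C (snd p) = proc C (fst p)" using execution_Cons.prems(5) \<open>p \<in> P\<close> by (auto simp: synced_def)
  show ?case
  proof (cases "op_writes f \<subseteq> X")
    case False
    then obtain x u where x: "f = Write x u" "x \<notin> X" by (cases f) auto
    then have "pair_covers A C p x" using s pp by (auto simp: pair_covers_def covers_def)
    then show ?thesis using stop execution_Cons.prems x(2) by blast
  next
    case True
    \<comment> \<open>The clone advances as well, so \<open>C'\<close> differs from the solo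
      configuration \<open>S'\<close>; only the state of \<open>fst p\<close> and the memory are
      compared.\<close>
    define C' where "C' = C\<lparr>proc := (proc C)(fst p := next_state A s f w, snd p := next_state A s f w), reg := apply_op f (reg C)\<rparr>"
    have ex: "execution A C [(fst p, f, w), (snd p, f, w)] C'"
      using synced_joint_iff[OF execution_Cons.prems(5) \<open>p \<in> P\<close>] s C'_def by blast
    have sy: "synced A C' P" using synced_joint[OF execution_Cons.prems(5) \<open>p \<in> P\<close> ex] .
    have cov: "\<forall>x \<in> X. pair_covers A C' (\<rho> x) x"
    proof
      fix x assume x: "x \<in> X"
      have "\<rho> x \<in> P" "\<rho> x \<noteq> p" using x \<open>\<rho> ` X \<subseteq> P\<close> \<open>p \<notin> \<rho> ` X\<close> by auto
      then show "pair_covers A C' (\<rho> x) x"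
        using pair_covers_idle[OF ex, of "\<rho> x"] synced_disjoint[OF execution_Cons.prems(5), of "\<rho> x" p]
          execution_Cons.prems(7) x \<open>p \<in> P\<close> by simp
    qed
    show ?thesis
    proof (cases "\<exists>b. f = Return b")
      case True
      then obtain b where b: "f = Return b" by blast
      have "rsv A C' P X \<rho> []"
        unfolding rsv_def steady_def using cov assms(11,12) by auto
      then have "rsv A C P X \<rho> [Joint p f w]"
        using rsv_Cons[OF _ execution_Cons.prems(5) \<open>p \<in> P\<close> \<open>p \<notin> \<rho> ` X\<close> _ ex] b by simp
      moreover have "returns [Joint p f w] b" using b by (simp add: returns_def)
      ultimately show ?thesis by blast
    next
      case False
      have "\<exists>\<rho>' \<gamma> b. rsv A C' P X \<rho>' \<gamma> \<and> returns \<gamma> b \<and> (\<forall>x \<in> X. \<rho>' x = \<rho> x)"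
      proof (rule execution_Cons.IH)
        show "fst ` set es \<subseteq> {fst p}" "proc D (fst p) = Returned v" using execution_Cons.prems by auto
        show "agree {fst p} S' C'" using ag s by (auto simp: agree_def C'_def)
        show "reachable A C'" using reachable_execution[OF execution_Cons.prems(4) ex] .
        show "\<forall>q \<in> P. \<exists>s. proc C' (fst q) = Active s"
          using execution_Cons.prems(6) False by (cases f) (auto simp: C'_def)
      qed (use sy cov in auto)
      then obtain \<rho>' \<gamma> b where r: "rsv A C' P X \<rho>' \<gamma>" "returns \<gamma> b" "\<forall>x \<in> X. \<rho>' x = \<rho> x" by blast
      have "rsv A C P X \<rho>' (Joint p f w # \<gamma>)"
        using rsv_Cons[OF r(1) execution_Cons.prems(5) \<open>p \<in> P\<close> _ True ex] False r(3) \<open>p \<notin> \<rho> ` X\<close> by auto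
      moreover have "returns (Joint p f w # \<gamma>) b" using r(2) by (auto simp: returns_def)
      ultimately show ?thesis using r(3) by blast
    qed
  qed
qed

text \<open>Whenever a run meets an unreserved register, this register joins \<open>X\<close>. By
  \<open>covering_bound\<close> at most \<open>m\<close> registers are ever reserved, so
  \<open>m - card X\<close> decreases, and among \<open>m + 1\<close> pairs one is always free to
  run.\<close>

lemma rsv_exists:
  assumes "finite P" "m + 1 \<le> card P"
    and "reachable A C" "synced A C P" "\<forall>q \<in> P. \<exists>s. proc C (fst q) = Active s"
    and "finite X" "inj_on \<rho> X" "\<rho> ` X \<subseteq> P" "\<forall>x \<in> X. pair_covers A C (\<rho> x) x"
  shows "\<exists>\<rho>' \<gamma> b. rsv A C P X \<rho>' \<gamma> \<and> returns \<gamma> b \<and> (\<forall>x \<in> X. \<rho>' x = \<rho> x)"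
  using assms(3-9)
proof (induction "m - card X" arbitrary: X \<rho> C rule: less_induct)
  case less
  have "card X \<le> m" by (rule covering_bound) (use less.prems in auto)
  moreover have "card (\<rho> ` X) \<le> card X" using less.prems by (simp add: card_image)
  ultimately have "\<not> P \<subseteq> \<rho> ` X"
    using assms(2) card_mono[of "\<rho> ` X" P] less.prems by force
  then obtain p where p: "p \<in> P" "p \<notin> \<rho> ` X" by blast
  have "fst p \<in> procs A" using p less.prems by (auto simp: synced_def)
  then obtain es D v where es: "execution A C es D" "fst ` set es \<subseteq> {fst p}" "proc D (fst p) = Returned v"
    using solo less.prems(1) unfolding nondet_solo_termination_def by blast
  show ?case
  proof (rule rsv_run[OF _ es])
    fix D x
    assume D: "reachable A D" "synced A D P" "\<forall>q \<in> P. \<exists>s. proc D (fst q) = Active s"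
      "\<forall>x \<in> X. pair_covers A D (\<rho> x) x" "pair_covers A D p x" "x \<notin> X"
    let ?\<rho> = "\<rho>(x := p)" let ?X = "insert x X"
    have inj: "inj_on ?\<rho> ?X" and sub: "?\<rho> ` ?X \<subseteq> P" and cov: "\<forall>y \<in> ?X. pair_covers A D (?\<rho> y) y"
      using less.prems p D by (auto simp: inj_on_def)
    have "card ?X \<le> m" by (rule covering_bound[OF D(1,2) inj sub cov]) (use less.prems in auto)
    then have "m - card ?X < m - card X" using D(6) less.prems by simp
    then obtain \<rho>' \<gamma> b where r: "rsv A D P ?X \<rho>' \<gamma>" "returns \<gamma> b" "\<forall>y \<in> ?X. \<rho>' y = ?\<rho> y"
      using less.hyps[of ?X D ?\<rho>] D inj sub cov less.prems by blast
    have "rsv A D P X \<rho>' \<gamma>" using r(1) unfolding rsv_def by (auto intro: inj_on_subset)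
    moreover have "\<forall>y \<in> X. \<rho>' y = \<rho> y" using r(3) D(6) by auto
    ultimately show "\<exists>\<rho>' \<gamma> b. rsv A D P X \<rho>' \<gamma> \<and> returns \<gamma> b \<and> (\<forall>x \<in> X. \<rho>' x = \<rho> x)"
      using r(2) by blast
  qed (use less.prems p in \<open>auto simp: agree_def\<close>)
qed

lemma can_return_exists:
  assumes "finite P" "m + 1 \<le> card P"
    and "reachable A C" "synced A C P" "\<forall>q \<in> P. \<exists>s. proc C (fst q) = Active s"
  shows "\<exists>b. can_return A C P b"
  using rsv_exists[OF assms, of "{}"] unfolding rsv_def can_return_def by auto

end

section \<open>Arranged configurations\<close>

definition fresh_regs :: "('p \<times> 'p) set \<Rightarrow> ('p, 'r, 'v, 'c) action list \<Rightarrow> 'r set" where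
  "fresh_regs U E = {x. \<exists>q \<in> U. fresh_on E q x}"

text \<open>
  The first two properties of the theorem, with \<open>R\<^sub>s = fresh_regs U E\<close> and \<open>R\<^sub>c = R - R\<^sub>s\<close>. The values of
  \<open>cov\<close> outside \<open>R\<^sub>c\<close> are irrelevant.
\<close>

definition arranged ::
  "('p, 's, 'r, 'v, 'c) system \<Rightarrow> ('p \<Rightarrow> bool) \<Rightarrow> ('p \<times> 'p) set \<Rightarrow> ('p, 'r, 'v, 'c) action list
    \<Rightarrow> ('p, 's, 'r, 'v) config \<Rightarrow> 'r set \<Rightarrow> ('r \<Rightarrow> 'p \<times> 'p) \<Rightarrow> bool" where
  "arranged A inp U E C R cov \<longleftrightarrow>
    clone_pairs A inp U \<and> finite U \<and> pair_execution A inp U E C \<and> finite R \<and>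
    fresh_regs U E \<subseteq> R \<and>
    (\<forall>q \<in> U. \<forall>q' \<in> U. \<forall>x. fresh_on E q x \<and> fresh_on E q' x \<longrightarrow> q = q') \<and>
    (\<forall>x \<in> R - fresh_regs U E. cov x \<in> U \<and> \<not> is_split E (cov x) \<and> pair_covers A C (cov x) x) \<and>
    inj_on cov (R - fresh_regs U E) \<and>
    (\<forall>q \<in> U. \<forall>x. stale_on E q x \<longrightarrow> x \<in> R) \<and>
    (\<forall>q \<in> U. \<forall>q' \<in> U. \<forall>x. stale_on E q x \<and> stale_on E q' x \<longrightarrow> q = q')"

lemma arrangedD:
  assumes "arranged A inp U E C R cov"
  shows "clone_pairs A inp U" "finite U" "pair_execution A inp U E C" "finite R"
    and "fresh_regs U E \<subseteq> R"
    and "\<lbrakk>q \<in> U; q' \<in> U; fresh_on E q x; fresh_on E q' x\<rbrakk> \<Longrightarrow> q = q'"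
    and "x \<in> R - fresh_regs U E \<Longrightarrow> cov x \<in> U"
    and "x \<in> R - fresh_regs U E \<Longrightarrow> \<not> is_split E (cov x)"
    and "x \<in> R - fresh_regs U E \<Longrightarrow> pair_covers A C (cov x) x"
    and "inj_on cov (R - fresh_regs U E)"
    and "\<lbrakk>q \<in> U; stale_on E q x\<rbrakk> \<Longrightarrow> x \<in> R"
    and "\<lbrakk>q \<in> U; q' \<in> U; stale_on E q x; stale_on E q' x\<rbrakk> \<Longrightarrow> q = q'"
  using assms unfolding arranged_def by (elim conjE, blast)+

lemma fresh_regsI: "q \<in> U \<Longrightarrow> fresh_on E q x \<Longrightarrow> x \<in> fresh_regs U E"
  by (auto simp: fresh_regs_def)

lemma arranged_synced:
  assumes "arranged A inp U E C R cov" "P \<subseteq> U" "\<forall>q \<in> P. \<not> is_split E q"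
  shows "synced A C P"
proof -
  note c = arrangedD(1)[OF assms(1)]
  have "proc C (fst q) = proc C (snd q)" if "q \<in> P" for q
    using pair_states[OF c arrangedD(3)[OF assms(1)], of q] that assms(2,3) by blast
  then show ?thesis using c assms(2) unfolding synced_def clone_pairs_iff by blast
qed

lemma clone_pairs_disjoint:
  "clone_pairs A inp U \<Longrightarrow> q \<in> U \<Longrightarrow> q' \<in> U \<Longrightarrow> q \<noteq> q' \<Longrightarrow>
    fst q \<noteq> fst q' \<and> fst q \<noteq> snd q' \<and> snd q \<noteq> fst q' \<and> snd q \<noteq> snd q'"
  unfolding clone_pairs_iff by blast

lemma events_of_actor: "fst ` set (events_of a) \<subseteq> {fst (actor a), snd (actor a)}"
  by (cases a) auto

lemma action_idle:
  assumes "clone_pairs A inp U" "actor a \<in> U" "q \<in> U" "q \<noteq> actor a" "execution A C (events_of a) D"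
  shows "proc D (fst q) = proc C (fst q)" "proc D (snd q) = proc C (snd q)"
    "pair_covers A D q x = pair_covers A C q x"
proof -
  have "fst q \<notin> fst ` set (events_of a)" "snd q \<notin> fst ` set (events_of a)"
    using events_of_actor[of a] clone_pairs_disjoint[OF assms(1,3,2,4)] by auto
  then show "proc D (fst q) = proc C (fst q)" "proc D (snd q) = proc C (snd q)"
    "pair_covers A D q x = pair_covers A C q x"
    using execution_proc_idle[OF assms(5)] pair_covers_idle[OF assms(5)] by auto
qed

text \<open>A second stale pair on a register can arise only if a write hits a register that has a
  fresh pair and a stale one at the same time. The assumption \<open>stale\<close> excludes this,
  except when the stale pair is the one being united by that very write.\<close>

lemma arranged_snoc:
  assumes a: "arranged A inp U E C R cov" and act: "actor a \<in> U" "allowed_after E a"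
    and ex: "execution A C (events_of a) D"
    and split: "\<And>q x v. a = Split q x v \<Longrightarrow> x \<in> R"
    and stale: "\<And>x q. \<lbrakk>x \<in> written (events_of a); x \<in> fresh_regs U E; q \<in> U; stale_on E q x\<rbrakk> \<Longrightarrow> q = actor a"
    and cov: "\<And>x. x \<in> R - fresh_regs U (E @ [a]) \<Longrightarrow>
      cov' x \<in> U \<and> \<not> is_split (E @ [a]) (cov' x) \<and> pair_covers A D (cov' x) x"
    and inj: "inj_on cov' (R - fresh_regs U (E @ [a]))"
  shows "arranged A inp U (E @ [a]) D R cov'"
  unfolding arranged_def
proof (intro conjI ballI allI impI)
  note ad = arrangedD[OF a]
  show "clone_pairs A inp U" "finite U" "finite R" by (fact ad)+
  show "pair_execution A inp U (E @ [a]) D" using ad(3) act ex by (auto simp: pair_execution_snoc)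
  show "fresh_regs U (E @ [a]) \<subseteq> R"
    using ad(5) split unfolding fresh_regs_def by (auto simp: fresh_on_snoc split: if_splits)
  \<comment> \<open>A split also writes to its register, so a pair that was fresh there turns stale,
    and fresh pairs remain unique.\<close>
  have w: "x \<in> written (events_of a)" if "a = Split (actor a) x v" for x v using that by (cases a) auto
  show "q = q'" if "q \<in> U" "q' \<in> U" "fresh_on (E @ [a]) q x \<and> fresh_on (E @ [a]) q' x" for q q' x
    using that ad(6)[of q q' x] by (auto simp: fresh_on_snoc dest: w split: if_splits)
  show "x \<in> R" if "q \<in> U" "stale_on (E @ [a]) q x" for q x
    using that ad(11)[of q x] ad(5) fresh_regsI[of q U E x] by (auto simp: stale_on_snoc)
  show "q = q'" if "q \<in> U" "q' \<in> U" "stale_on (E @ [a]) q x \<and> stale_on (E @ [a]) q' x" for q q' x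
    using that ad(6)[of q q' x] ad(12)[of q q' x] stale[of x q] stale[of x q']
      fresh_regsI[of q U E x] fresh_regsI[of q' U E x] by (auto simp: stale_on_snoc)
  show "inj_on cov' (R - fresh_regs U (E @ [a]))" by (rule inj)
qed (use cov in auto)

text \<open>The only way in which \<open>R\<close> grows. The execution stays the same; a pair that
  was merely reserved is now regarded as covering.\<close>

lemma arranged_extend:
  assumes a: "arranged A inp U E C R cov" and x: "x \<notin> R"
    and g: "g \<in> U" "\<not> is_split E g" "g \<notin> cov ` (R - fresh_regs U E)" "pair_covers A C g x"
  shows "arranged A inp U E C (insert x R) (cov(x := g))"
  unfolding arranged_def
proof (intro conjI)
  note ad = arrangedD[OF a]
  show "clone_pairs A inp U" "finite U" "pair_execution A inp U E C" "finite (insert x R)"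
    using ad(1-4) by auto
  show "fresh_regs U E \<subseteq> insert x R" using ad(5) by auto
  have r: "insert x R - fresh_regs U E = insert x (R - fresh_regs U E)" using x ad(5) by auto
  show "inj_on (cov(x := g)) (insert x R - fresh_regs U E)"
    unfolding r using ad(10) g(3) x by (auto simp: inj_on_def)
  show "\<forall>y \<in> insert x R - fresh_regs U E. (cov(x := g)) y \<in> U \<and> \<not> is_split E ((cov(x := g)) y)
      \<and> pair_covers A C ((cov(x := g)) y) y"
    using ad(7-9) g by auto
qed (use arrangedD(6,11,12)[OF a] in blast)+

section \<open>Writes held back by clones\<close>

text \<open>Forgets what happened since the split: a clone is useful for restoring a value no matter
  whether its pair is fresh or stale.\<close>

definition pending :: "('p, 'r, 'v, 'c) action list \<Rightarrow> 'p \<times> 'p \<Rightarrow> 'r \<Rightarrow> 'v \<Rightarrow> bool" where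
  "pending E q x v \<longleftrightarrow> (\<exists>F. split_since E q x v F)"

lemma pending_snoc: "pending (E @ [a]) q x v \<longleftrightarrow> (if actor a = q then a = Split q x v else pending E q x v)"
  unfolding pending_def split_since_snoc by auto

lemma is_split_pending: "is_split E q \<longleftrightarrow> (\<exists>x v. pending E q x v)"
  by (auto simp: is_split_def pending_def)

lemma pending_unique: "pending E q x v \<Longrightarrow> pending E q y u \<Longrightarrow> x = y \<and> v = u"
  unfolding pending_def by (meson split_since_register)

lemma fresh_on_pending: "fresh_on E q x \<Longrightarrow> \<exists>v. pending E q x v"
  unfolding pending_def fresh_on_def by blast

lemma stale_on_pending: "stale_on E q x \<Longrightarrow> \<exists>v. pending E q x v"
  unfolding pending_def stale_on_def by blast

text \<open>The write held back by the clone of a fresh pair is a copy of the current content of the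
  register. It remains available after the register has been overwritten.\<close>

lemma fresh_on_value:
  assumes "clone_pairs A inp U" "pair_execution A inp U E C" "q \<in> U" "fresh_on E q x" "pending E q x v"
  shows "reg C x = v"
proof -
  obtain u F where F: "split_since E q x u F" "x \<notin> written (events F)" using assms(4) by (auto simp: fresh_on_def)
  then have "u = v" using pending_unique[OF _ assms(5)] unfolding pending_def by blast
  then show ?thesis using pair_states[OF assms(1-3)] F by blast
qed

lemma pending_poised:
  assumes "clone_pairs A inp U" "pair_execution A inp U E C" "q \<in> U" "pending E q x v"
  shows "\<exists>s. proc C (snd q) = Active s \<and> Write x v \<in> ops A s"
  using pair_states[OF assms(1-3)] assms(4) unfolding pending_def by blast

lemma fresh_not_stale: "fresh_on E q x \<Longrightarrow> \<not> stale_on E q y"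
  unfolding fresh_on_def stale_on_def by (metis split_since_register)

section \<open>Imitating pairs\<close>

text \<open>Since operations are idempotent, processes in the same state that perform the same
  operation in a row act like one. With one or two processes this covers all three kinds of
  action.\<close>

lemma bulk_iff:
  assumes "ps \<noteq> []" "distinct ps" "\<forall>p \<in> set ps. proc C p = Active s"
  shows "execution A C (map (\<lambda>p. (p, f, w)) ps) D \<longleftrightarrow>
    set ps \<subseteq> procs A \<and> f \<in> ops A s \<and> outcome_ok (reg C) f w \<and>
    D = C\<lparr>proc := (\<lambda>p. if p \<in> set ps then next_state A s f w else proc C p), reg := apply_op f (reg C)\<rparr>"
  using assms
proof (induction ps arbitrary: C rule: list_nonempty_induct)
  case (single p)
  have "(proc C)(p := z) = (\<lambda>q. if q = p then z else proc C q)" for z by auto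
  then show ?case using single by (auto simp: execution_Cons_iff step_iff)
next
  case (cons p ps)
  define C1 where "C1 = C\<lparr>proc := (proc C)(p := next_state A s f w), reg := apply_op f (reg C)\<rparr>"
  have C1: "\<forall>q \<in> set ps. proc C1 q = Active s" using cons.prems by (auto simp: C1_def)
  have "execution A C (map (\<lambda>p. (p, f, w)) (p # ps)) D \<longleftrightarrow>
      p \<in> procs A \<and> f \<in> ops A s \<and> outcome_ok (reg C) f w \<and> execution A C1 (map (\<lambda>p. (p, f, w)) ps) D"
    using cons.prems by (auto simp: execution_Cons_iff step_iff C1_def)
  moreover have "C1\<lparr>proc := (\<lambda>q. if q \<in> set ps then next_state A s f w else proc C1 q), reg := apply_op f (reg C1)\<rparr> =
      C\<lparr>proc := (\<lambda>q. if q \<in> set (p # ps) then next_state A s f w else proc C q), reg := apply_op f (reg C)\<rparr>"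
    by (simp add: C1_def fun_eq_iff)
  ultimately show ?case using cons.IH[OF _ C1] cons.prems(1) by (auto simp: C1_def)
qed

definition copy_proc :: "'p \<Rightarrow> 'p \<times> 'p \<Rightarrow> ('p, 's, 'r, 'v) config \<Rightarrow> ('p, 's, 'r, 'v) config" where
  "copy_proc z q C = C\<lparr>proc := (proc C)(fst q := proc C z, snd q := proc C z)\<rparr>"

text \<open>
  In hindsight, a new pair can be made to imitate any process \<open>z\<close>: it repeats every operation of \<open>z\<close>
  immediately before \<open>z\<close> performs it, so none of its writes is visible.
\<close>

lemma shadow:
  assumes cl: "clone_pairs A inp U" and pe: "pair_execution A inp U E C" and z: "z \<in> members U"
    and new: "fst n \<in> procs A" "snd n \<in> procs A" "fst n \<noteq> snd n" "{fst n, snd n} \<inter> members U = {}"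
  shows "\<exists>E'. pair_execution A (inp(fst n := inp z, snd n := inp z)) (insert n U) E' (copy_proc z n C) \<and>
    \<not> is_split E' n \<and>
    (\<forall>q \<in> U. \<forall>x. fresh_on E' q x = fresh_on E q x \<and> stale_on E' q x = stale_on E q x \<and>
      (\<forall>v. pending E' q x v = pending E q x v))"
  using pe
proof (induction E arbitrary: C rule: rev_induct)
  case Nil
  then show ?case
    by (intro exI[of _ "[]"]) (auto simp: initial_def copy_proc_def pending_def fun_eq_iff)
next
  case (snoc a E)
  let ?inp = "inp(fst n := inp z, snd n := inp z)"
  obtain C0 where C0: "pair_execution A inp U E C0" and a: "actor a \<in> U" "allowed_after E a"
    and ex: "execution A C0 (events_of a) C"
    using snoc.prems by (auto simp: pair_execution_snoc)
  obtain E' where E': "pair_execution A ?inp (insert n U) E' (copy_proc z n C0)" "\<not> is_split E' n"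
    "\<forall>q \<in> U. \<forall>x. fresh_on E' q x = fresh_on E q x \<and> stale_on E' q x = stale_on E q x \<and>
      (\<forall>v. pending E' q x v = pending E q x v)"
    using snoc.IH[OF C0] by blast
  have nU: "q \<noteq> n" if "q \<in> U" for q using that new(4) by auto
  have na: "actor a \<noteq> n" using nU a(1) by blast
  have sp: "is_split E' q = is_split E q" if "q \<in> U" for q
    using E'(3) that by (simp add: is_split_pending)
  have allow: "allowed_after E' a"
    using a sp E'(3) by (cases a) (auto simp: pending_def[symmetric])
  \<comment> \<open>Each action is one operation performed by one or two processes in the same
    state; only the membership of \<open>z\<close> in \<open>ps\<close> matters below.\<close>
  obtain f w ps where ps: "events_of a = map (\<lambda>p. (p, f, w)) ps" "ps \<noteq> []" "distinct ps"
    "set ps \<subseteq> {fst (actor a), snd (actor a)}" "\<exists>s. \<forall>p \<in> set ps. proc C0 p = Active s"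
  proof (cases a)
    case (Joint q f w)
    have q: "q \<in> U" "\<not> is_split E q" using a Joint by auto
    have eq: "fst q \<noteq> snd q" "proc C0 (fst q) = proc C0 (snd q)"
      using cl q pair_states[OF cl C0 q(1)] by (auto simp: clone_pairs_iff)
    have "execution A C0 [(fst q, f, w), (snd q, f, w)] C" using ex Joint by simp
    then obtain s where "proc C0 (fst q) = Active s" unfolding joint_iff[OF eq] by blast
    then show ?thesis using that[of f w "[fst q, snd q]"] Joint eq by auto
  next
    case (Split q x v)
    then have "step A C0 (fst q, Write x v, Ack) C" using ex by (simp add: execution_Cons_iff)
    then show ?thesis using that[of "Write x v" Ack "[fst q]"] Split by (auto simp: step_iff)
  next
    case (Unite q x v)
    then have "step A C0 (snd q, Write x v, Ack) C" using ex by (simp add: execution_Cons_iff)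
    then show ?thesis using that[of "Write x v" Ack "[snd q]"] Unite by (auto simp: step_iff)
  qed
  obtain s where s: "\<forall>p \<in> set ps. proc C0 p = Active s" using ps(5) by blast
  have C: "set ps \<subseteq> procs A" "f \<in> ops A s" "outcome_ok (reg C0) f w"
    "C = C0\<lparr>proc := (\<lambda>p. if p \<in> set ps then next_state A s f w else proc C0 p), reg := apply_op f (reg C0)\<rparr>"
    using ex bulk_iff[OF ps(2,3) s, of A f w C] unfolding ps(1) by auto
  have psU: "set ps \<subseteq> members U" using ps(4) a(1) by auto
  then have nps: "fst n \<notin> set ps" "snd n \<notin> set ps" using new(4) by auto
  have wr: "written (events_of a) = op_writes f"
    using ps(1,2) by (cases a) (auto simp: map_eq_Cons_conv)
  show ?case
  proof (cases "z \<in> set ps")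
    case False
    have s': "\<forall>p \<in> set ps. proc (copy_proc z n C0) p = Active s"
      using s nps by (auto simp: copy_proc_def)
    have "execution A (copy_proc z n C0) (events_of a) (copy_proc z n C)"
      unfolding ps(1) bulk_iff[OF ps(2,3) s']
      using C nps False by (auto simp: copy_proc_def fun_eq_iff)
    then have "pair_execution A ?inp (insert n U) (E' @ [a]) (copy_proc z n C)"
      using E'(1) allow a(1) by (auto simp: pair_execution_snoc)
    moreover have "\<not> is_split (E' @ [a]) n" using E'(2) na by (simp add: is_split_snoc)
    moreover have "fresh_on (E' @ [a]) q x = fresh_on (E @ [a]) q x \<and>
        stale_on (E' @ [a]) q x = stale_on (E @ [a]) q x \<and>
        (\<forall>v. pending (E' @ [a]) q x v = pending (E @ [a]) q x v)" if "q \<in> U" for q x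
      using E'(3) that by (simp add: fresh_on_snoc stale_on_snoc pending_snoc)
    ultimately show ?thesis by blast
  next
    case True
    let ?J = "Joint n f w"
    define C1 where "C1 = (copy_proc z n C0)\<lparr>proc := (proc C0)(fst n := next_state A s f w, snd n := next_state A s f w),
      reg := apply_op f (reg C0)\<rparr>"
    have sz: "proc C0 z = Active s" using s True by blast
    have "execution A (copy_proc z n C0) (events_of ?J) C1"
    proof -
      have "fst n \<noteq> snd n" "proc (copy_proc z n C0) (fst n) = proc (copy_proc z n C0) (snd n)"
        using new(3) by (auto simp: copy_proc_def)
      then show ?thesis using joint_iff[of "fst n" "snd n" "copy_proc z n C0" A f w C1] sz C new(1-3)
        by (auto simp: copy_proc_def C1_def)
    qed
    moreover have "allowed_after E' ?J" using E'(2) by simp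
    ultimately have pe1: "pair_execution A ?inp (insert n U) (E' @ [?J]) C1"
      using E'(1) by (auto simp: pair_execution_snoc)
    have s': "\<forall>p \<in> set ps. proc C1 p = Active s"
      using s nps by (auto simp: C1_def)
    have "execution A C1 (events_of a) (copy_proc z n C)"
      unfolding ps(1) bulk_iff[OF ps(2,3) s']
      using C nps True by (auto simp: copy_proc_def fun_eq_iff C1_def)
    moreover have "allowed_after (E' @ [?J]) a"
      using allow na by (cases a) (auto simp: is_split_snoc pending_def[symmetric] pending_snoc)
    ultimately have "pair_execution A ?inp (insert n U) ((E' @ [?J]) @ [a]) (copy_proc z n C)"
      using pe1 a(1) unfolding pair_execution_snoc[of A ?inp "insert n U" "E' @ [?J]"] by blast
    moreover have "\<not> is_split ((E' @ [?J]) @ [a]) n"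
      unfolding is_split_snoc using na by simp
    \<comment> \<open>The inserted step writes to the same register as \<open>a\<close>, so it can
      make stale only those pairs that \<open>a\<close> makes stale anyway; a pair split by
      \<open>a\<close> itself becomes fresh after the inserted step.\<close>
    moreover have "fresh_on ((E' @ [?J]) @ [a]) q x = fresh_on (E @ [a]) q x \<and>
        stale_on ((E' @ [?J]) @ [a]) q x = stale_on (E @ [a]) q x \<and>
        (\<forall>v. pending ((E' @ [?J]) @ [a]) q x v = pending (E @ [a]) q x v)" if "q \<in> U" for q x
      using E'(3) that nU[OF that] wr
      unfolding fresh_on_snoc[of "E' @ [?J]"] stale_on_snoc[of "E' @ [?J]"] pending_snoc[of "E' @ [?J]"]
      by (auto simp: fresh_on_snoc stale_on_snoc pending_snoc)
    ultimately show ?thesis by blast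
  qed
qed

lemma arranged_shadow:
  assumes a: "arranged A inp U E C R cov" and z: "z \<in> members U"
    and new: "fst n \<in> procs A" "snd n \<in> procs A" "fst n \<noteq> snd n" "{fst n, snd n} \<inter> members U = {}"
  shows "\<exists>inp' E'. arranged A inp' (insert n U) E' (copy_proc z n C) R cov \<and> \<not> is_split E' n \<and>
    (\<forall>q \<in> U. is_split E' q = is_split E q) \<and> fresh_regs (insert n U) E' = fresh_regs U E"
proof -
  note ad = arrangedD[OF a]
  let ?inp = "inp(fst n := inp z, snd n := inp z)"
  obtain E' where E': "pair_execution A ?inp (insert n U) E' (copy_proc z n C)" "\<not> is_split E' n"
    "\<forall>q \<in> U. \<forall>x. fresh_on E' q x = fresh_on E q x \<and> stale_on E' q x = stale_on E q x \<and>
      (\<forall>v. pending E' q x v = pending E q x v)"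
    using shadow[OF ad(1,3) z new] by blast
  have n: "\<not> fresh_on E' n x" "\<not> stale_on E' n x" for x using E'(2) by (auto simp: is_split_iff)
  have fr: "fresh_regs (insert n U) E' = fresh_regs U E" using E'(3) n by (auto simp: fresh_regs_def)
  have sp: "\<forall>q \<in> U. is_split E' q = is_split E q" using E'(3) by (simp add: is_split_pending)
  have nU: "fst q \<noteq> fst n \<and> fst q \<noteq> snd n \<and> snd q \<noteq> fst n \<and> snd q \<noteq> snd n" if "q \<in> U" for q
    using that new(4) by (auto intro: rev_image_eqI)
  have "clone_pairs A ?inp (insert n U)"
    unfolding clone_pairs_iff
  proof (intro conjI ballI impI)
    fix q q' assume q: "q \<in> insert n U" "q' \<in> insert n U" "q \<noteq> q'"
    then consider "q \<in> U" "q' \<in> U" | "q = n" "q' \<in> U" | "q \<in> U" "q' = n" by blast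
    then show "{fst q, snd q} \<inter> {fst q', snd q'} = {}"
      using clone_pairs_disjoint[OF ad(1) _ _ q(3)] nU[of q] nU[of q'] by cases auto
  next
    fix q assume q: "q \<in> insert n U"
    have u: "fst q \<in> procs A \<and> snd q \<in> procs A \<and> fst q \<noteq> snd q \<and> inp (fst q) = inp (snd q)" if "q \<in> U"
      using ad(1) that unfolding clone_pairs_iff by blast
    show "fst q \<in> procs A" "snd q \<in> procs A" "fst q \<noteq> snd q" using q u new(1-3) by auto
    show "?inp (fst q) = ?inp (snd q)" using q u nU[of q] by auto
  qed
  moreover have "pair_covers A (copy_proc z n C) q x = pair_covers A C q x" if "q \<in> U" for q x
    using nU[OF that] by (simp add: pair_covers_def covers_def copy_proc_def)
  ultimately have "arranged A ?inp (insert n U) E' (copy_proc z n C) R cov"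
    unfolding arranged_def fr using ad E'(1,3) sp n by auto
  then show ?thesis using E'(2) sp fr by blast
qed

section \<open>Arranged configurations along a reserving execution\<close>

text \<open>If the register written by \<open>f\<close> has a fresh pair, that pair turns stale and
  the register moves from \<open>R\<^sub>s\<close> to \<open>R\<^sub>c\<close>, so \<open>g\<close>
  has to supply a covering pair for it. The assumption \<open>nostale\<close> keeps the stale pairs
  on different registers.\<close>

lemma arranged_overwrite:
  assumes a: "arranged A inp U E C R cov" and p: "p \<in> U" "\<not> is_split E p" "p \<notin> cov ` (R - fresh_regs U E)"
    and ex: "execution A C [(fst p, f, w), (snd p, f, w)] D"
    and g: "\<And>y. y \<in> op_writes f \<inter> fresh_regs U E \<Longrightarrow> g y \<in> U \<and> \<not> is_split E (g y) \<and> g y \<noteq> p \<and>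
      g y \<notin> cov ` (R - fresh_regs U E) \<and> pair_covers A C (g y) y"
    and nostale: "\<And>y q. \<lbrakk>y \<in> op_writes f \<inter> fresh_regs U E; q \<in> U\<rbrakk> \<Longrightarrow> \<not> stale_on E q y"
  shows "arranged A inp U (E @ [Joint p f w]) D R
    (\<lambda>x. if x \<in> op_writes f \<inter> fresh_regs U E then g x else cov x)"
proof (rule arranged_snoc[OF a])
  note ad = arrangedD[OF a]
  let ?J = "Joint p f w" and ?cov = "\<lambda>x. if x \<in> op_writes f \<inter> fresh_regs U E then g x else cov x"
  have fresh: "fresh_on (E @ [?J]) q x \<longleftrightarrow> fresh_on E q x \<and> x \<notin> op_writes f" for q x
    using p(2) by (auto simp: fresh_on_snoc is_split_iff)
  then have fr: "fresh_regs U (E @ [?J]) = fresh_regs U E - op_writes f" by (auto simp: fresh_regs_def)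
  show "?cov x \<in> U \<and> \<not> is_split (E @ [?J]) (?cov x) \<and> pair_covers A D (?cov x) x"
    if "x \<in> R - fresh_regs U (E @ [?J])" for x
  proof -
    have c: "?cov x \<in> U \<and> \<not> is_split E (?cov x) \<and> ?cov x \<noteq> p \<and> pair_covers A C (?cov x) x"
      using that g[of x] ad(7-9)[of x] p(3) unfolding fr by auto
    then have "pair_covers A D (?cov x) x = pair_covers A C (?cov x) x"
      by (intro action_idle(3)[OF ad(1), of ?J]) (use p ex in auto)
    then show ?thesis using c by (simp add: is_split_snoc)
  qed
  show "inj_on ?cov (R - fresh_regs U (E @ [?J]))"
  proof (rule inj_onI)
    fix x y assume xy: "x \<in> R - fresh_regs U (E @ [?J])" "y \<in> R - fresh_regs U (E @ [?J])" "?cov x = ?cov y"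
    have one: "x = y" if "x \<in> op_writes f" "y \<in> op_writes f" using that by (cases f) auto
    have im: "u \<in> R - fresh_regs U E \<and> ?cov u = cov u \<and> cov u \<in> cov ` (R - fresh_regs U E)"
      if "u \<in> R - fresh_regs U (E @ [?J])" "u \<notin> op_writes f \<inter> fresh_regs U E" for u
      using that unfolding fr by auto
    show "x = y"
    proof (cases "x \<in> op_writes f \<inter> fresh_regs U E"; cases "y \<in> op_writes f \<inter> fresh_regs U E")
      assume xn: "x \<notin> op_writes f \<inter> fresh_regs U E" and yn: "y \<notin> op_writes f \<inter> fresh_regs U E"
      then show ?thesis using im[OF xy(1) xn] im[OF xy(2) yn] xy(3) ad(10) unfolding inj_on_def by simp
    next
      assume xn: "x \<notin> op_writes f \<inter> fresh_regs U E" and yi: "y \<in> op_writes f \<inter> fresh_regs U E"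
      then show ?thesis using im[OF xy(1) xn] g[OF yi] xy(3) by auto
    next
      assume xi: "x \<in> op_writes f \<inter> fresh_regs U E" and yn: "y \<notin> op_writes f \<inter> fresh_regs U E"
      then show ?thesis using im[OF xy(2) yn] g[OF xi] xy(3) by auto
    qed (use one in auto)
  qed
  show "q = actor ?J" if "x \<in> written (events_of ?J)" "x \<in> fresh_regs U E" "q \<in> U" "stale_on E q x" for x q
    using that nostale[of x q] by auto
qed (use p ex in auto)

lemma unite_executable:
  assumes a: "arranged A inp U E C R cov" and t: "t \<in> U" "pending E t y u"
  shows "\<exists>C1. execution A C (events_of (Unite t y u)) C1 \<and> allowed_after E (Unite t y u) \<and>
    reg C1 = (reg C)(y := u) \<and> (\<forall>p. p \<noteq> snd t \<longrightarrow> proc C1 p = proc C p)"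
proof -
  note ad = arrangedD[OF a]
  obtain s where s: "proc C (snd t) = Active s" "Write y u \<in> ops A s"
    using pending_poised[OF ad(1,3) t] by blast
  have "snd t \<in> procs A" using ad(1) t(1) by (auto simp: clone_pairs_iff)
  then have "\<exists>C1. step A C (snd t, Write y u, Ack) C1 \<and> reg C1 = (reg C)(y := u) \<and>
      (\<forall>p. p \<noteq> snd t \<longrightarrow> proc C1 p = proc C p)"
    unfolding step_iff using s by auto
  then show ?thesis using t(2) by (auto simp: execution_Cons_iff pending_def)
qed

text \<open>
  If the joint step overwrites a register with a fresh pair, a stale pair on that register is united
  just before the step. Its write is immediately overwritten, and there is only one stale pair again.
\<close>

lemma arranged_joint:
  assumes a: "arranged A inp U E C R cov" and p: "p \<in> U" "\<not> is_split E p" "p \<notin> cov ` (R - fresh_regs U E)"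
    and ex: "execution A C [(fst p, f, w), (snd p, f, w)] D"
    and g: "\<And>y. y \<in> op_writes f \<inter> fresh_regs U E \<Longrightarrow> g y \<in> U \<and> \<not> is_split E (g y) \<and> g y \<noteq> p \<and>
      g y \<notin> cov ` (R - fresh_regs U E) \<and> pair_covers A C (g y) y"
  shows "\<exists>E' C'. arranged A inp U E' C' R (\<lambda>x. if x \<in> op_writes f \<inter> fresh_regs U E then g x else cov x) \<and>
    agree (members {q \<in> U. \<not> is_split E q}) D C' \<and>
    (\<forall>q \<in> U. \<not> is_split E q \<longrightarrow> \<not> is_split E' q) \<and>
    (\<forall>q \<in> U. \<forall>x. fresh_on E' q x \<longleftrightarrow> fresh_on E q x \<and> x \<notin> op_writes f) \<and>
    (\<forall>q \<in> U. \<forall>x v. pending E q x v \<and> (fresh_on E q x \<or> x \<notin> fresh_regs U E) \<longrightarrow> pending E' q x v)"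
proof -
  note ad = arrangedD[OF a]
  let ?J = "Joint p f w"
  let ?cov = "\<lambda>x. if x \<in> op_writes f \<inter> fresh_regs U E then g x else cov x"
  have pending_p: "\<not> pending E p x v" for x v using p(2) by (auto simp: is_split_pending)
  have fresh_p: "\<not> fresh_on E p x" for x using p(2) by (auto simp: is_split_iff)
  show ?thesis
  proof (cases "\<exists>t \<in> U. \<exists>y \<in> op_writes f \<inter> fresh_regs U E. stale_on E t y")
    case False
    have "arranged A inp U (E @ [?J]) D R ?cov"
      by (rule arranged_overwrite[OF a p ex]) (use g False in auto)
    moreover have "\<forall>q \<in> U. \<not> is_split E q \<longrightarrow> \<not> is_split (E @ [?J]) q" by (auto simp: is_split_snoc)
    moreover have "\<forall>q \<in> U. \<forall>x. fresh_on (E @ [?J]) q x \<longleftrightarrow> fresh_on E q x \<and> x \<notin> op_writes f"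
      using fresh_p by (auto simp: fresh_on_snoc)
    moreover have "\<forall>q \<in> U. \<forall>x v. pending E q x v \<and> (fresh_on E q x \<or> x \<notin> fresh_regs U E) \<longrightarrow> pending (E @ [?J]) q x v"
      using pending_p by (auto simp: pending_snoc)
    moreover have "agree (members {q \<in> U. \<not> is_split E q}) D D" by (simp add: agree_def)
    ultimately show ?thesis by blast
  next
    case True
    then obtain t y where t: "t \<in> U" "y \<in> op_writes f" "y \<in> fresh_regs U E" "stale_on E t y" by blast
    then obtain v where f: "f = Write y v" by (auto simp: op_writes_def)
    have ow: "op_writes f = {y}" using f by simp
    obtain u where u: "pending E t y u" using stale_on_pending[OF t(4)] by blast
    let ?T = "Unite t y u"
    obtain C1 where C1: "execution A C (events_of ?T) C1" "allowed_after E ?T" "reg C1 = (reg C)(y := u)"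
      "\<forall>p. p \<noteq> snd t \<longrightarrow> proc C1 p = proc C p"
      using unite_executable[OF a t(1) u] by blast
    have tsplit: "is_split E t" using u by (auto simp: is_split_pending)
    have tp: "t \<noteq> p" using tsplit p(2) by blast
    have fresh_t: "\<not> fresh_on E t x" for x using fresh_not_stale[of E t x y] t(4) by blast
    have fresh1: "fresh_on (E @ [?T]) q x \<longleftrightarrow> fresh_on E q x \<and> x \<noteq> y" for q x
      using fresh_t by (auto simp: fresh_on_snoc)
    have fr1: "fresh_regs U (E @ [?T]) = fresh_regs U E - {y}"
      unfolding fresh_regs_def fresh1 by auto
    have gy: "g y \<in> U" "\<not> is_split E (g y)" "g y \<noteq> p" "g y \<notin> cov ` (R - fresh_regs U E)" "pair_covers A C (g y) y"
      using g[of y] t(2,3) by auto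
    have yR: "y \<in> R" using ad(5) t(3) by blast
    have reg1: "R - fresh_regs U (E @ [?T]) = insert y (R - fresh_regs U E)"
      using fr1 yR by auto
    have a1: "arranged A inp U (E @ [?T]) C1 R (cov(y := g y))"
    proof (rule arranged_snoc[OF a])
      show "q = actor ?T" if "x \<in> written (events_of ?T)" "x \<in> fresh_regs U E" "q \<in> U" "stale_on E q x" for x q
        using that ad(12)[of q t y] t(1,4) by auto
      show "(cov(y := g y)) x \<in> U \<and> \<not> is_split (E @ [?T]) ((cov(y := g y)) x) \<and> pair_covers A C1 ((cov(y := g y)) x) x"
        if "x \<in> R - fresh_regs U (E @ [?T])" for x
      proof -
        let ?c = "(cov(y := g y)) x"
        have c: "?c \<in> U \<and> \<not> is_split E ?c \<and> pair_covers A C ?c x"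
          using that gy ad(7-9)[of x] unfolding reg1 by auto
        then have "pair_covers A C1 ?c x = pair_covers A C ?c x"
          by (intro action_idle(3)[OF ad(1), of ?T]) (use t(1) C1(1) tsplit in auto)
        then show ?thesis using c by (simp add: is_split_snoc)
      qed
      show "inj_on (cov(y := g y)) (R - fresh_regs U (E @ [?T]))"
        unfolding reg1
      proof (rule inj_onI)
        fix x x' assume x: "x \<in> insert y (R - fresh_regs U E)" "x' \<in> insert y (R - fresh_regs U E)"
          "(cov(y := g y)) x = (cov(y := g y)) x'"
        have ne: "(cov(y := g y)) v \<noteq> g y" if "v \<in> R - fresh_regs U E" for v
        proof -
          have "v \<noteq> y" using t(3) that by auto
          moreover have "cov v \<noteq> g y" using gy(4) imageI[OF that, of cov] by metis
          ultimately show ?thesis by simp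
        qed
        have "y \<notin> R - fresh_regs U E" using t(3) by blast
        then show "x = x'" using x ne[of x] ne[of x'] ad(10)
          by (cases "x = y"; cases "x' = y") (auto simp: inj_on_def)
      qed
    qed (use t(1) C1 in auto)
    \<comment> \<open>The configuration reached if the clone of \<open>t\<close> writes just before
      the step of \<open>p\<close>. As \<open>f\<close> overwrites that value, it differs from
      \<open>D\<close> at most in the state of \<open>snd t\<close>, which belongs to a split
      pair.\<close>
    define D' where "D' = C1\<lparr>proc := (\<lambda>q. if q = fst p \<or> q = snd p then proc D q else proc C1 q), reg := reg D\<rparr>"
    have peq: "fst p \<noteq> snd p" using ad(1) p(1) by (auto simp: clone_pairs_iff)
    have dis: "fst t \<noteq> fst p \<and> fst t \<noteq> snd p \<and> snd t \<noteq> fst p \<and> snd t \<noteq> snd p"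
      using clone_pairs_disjoint[OF ad(1) t(1) p(1) tp] .
    have eqp: "proc C (fst p) = proc C (snd p)" using pair_states[OF ad(1,3) p(1)] p(2) by blast
    obtain s where s: "fst p \<in> procs A" "snd p \<in> procs A" "proc C (fst p) = Active s" "f \<in> ops A s"
      "outcome_ok (reg C) f w" "D = C\<lparr>proc := (proc C)(fst p := next_state A s f w, snd p := next_state A s f w), reg := apply_op f (reg C)\<rparr>"
      using ex unfolding joint_iff[OF peq eqp] by blast
    have C1p: "proc C1 (fst p) = Active s" "proc C1 (snd p) = Active s" using C1(4) dis s(3) eqp by auto
    have "D' = C1\<lparr>proc := (proc C1)(fst p := next_state A s f w, snd p := next_state A s f w), reg := apply_op f (reg C1)\<rparr>"
      using s(6) f C1(3) by (auto simp: D'_def fun_eq_iff)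
    then have ex1: "execution A C1 [(fst p, f, w), (snd p, f, w)] D'"
      using joint_iff[OF peq, of C1 A f w D'] C1p s f by auto
    let ?E = "(E @ [?T]) @ [?J]"
    have "arranged A inp U ?E D' R (\<lambda>x. if x \<in> op_writes f \<inter> fresh_regs U (E @ [?T]) then g x else (cov(y := g y)) x)"
    proof (rule arranged_overwrite[OF a1 p(1) _ _ ex1])
      show "\<not> is_split (E @ [?T]) p" using p(2) tp by (simp add: is_split_snoc)
      show "p \<notin> (cov(y := g y)) ` (R - fresh_regs U (E @ [?T]))"
        unfolding reg1 using p(3) gy(3) t(3) by auto
    qed (use fr1 ow in auto)
    moreover have "(\<lambda>x. if x \<in> op_writes f \<inter> fresh_regs U (E @ [?T]) then g x else (cov(y := g y)) x) = ?cov"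
      using ow t(3) unfolding fr1 by (auto simp: fun_eq_iff)
    ultimately have "arranged A inp U ?E D' R ?cov" by simp
    moreover have "agree (members {q \<in> U. \<not> is_split E q}) D D'"
    proof -
      have "proc D z = proc D' z" if z: "z \<in> members {q \<in> U. \<not> is_split E q}" for z
      proof -
        obtain q where q: "q \<in> U" "\<not> is_split E q" "z = fst q \<or> z = snd q" using z by auto
        then have "q \<noteq> t" using tsplit by blast
        then have "z \<noteq> snd t" using q clone_pairs_disjoint[OF ad(1) q(1) t(1)] by auto
        then show ?thesis using C1(4) s(6) by (simp add: D'_def)
      qed
      then show ?thesis by (simp add: agree_def D'_def)
    qed
    moreover have "\<forall>q \<in> U. \<not> is_split E q \<longrightarrow> \<not> is_split ?E q"
      unfolding is_split_snoc[of "E @ [?T]"] is_split_snoc[of E] by simp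
    moreover have "\<forall>q \<in> U. \<forall>x. fresh_on ?E q x \<longleftrightarrow> fresh_on E q x \<and> x \<notin> op_writes f"
      using fresh_p fresh1 ow unfolding fresh_on_snoc[of "E @ [?T]"] by auto
    \<comment> \<open>Only \<open>t\<close> loses its pending write, and \<open>t\<close> is stale
      on a register that has a fresh pair; both alternatives of the assumption exclude this.\<close>
    moreover have "pending ?E q x v" if "q \<in> U" "pending E q x v" "fresh_on E q x \<or> x \<notin> fresh_regs U E" for q x v
    proof -
      have "q \<noteq> p" using that(2) pending_p by blast
      moreover have "q \<noteq> t" using that(2,3) pending_unique[OF u] fresh_t t(3) by blast
      ultimately show ?thesis using that(2) unfolding pending_snoc[of "E @ [?T]"] by (simp add: pending_snoc)
    qed
    ultimately show ?thesis by blast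
  qed
qed

text \<open>A register that is fresh at the start loses its fresh pair at the first write of
  \<open>\<gamma>\<close> to it. At that moment an older stale pair on it may be united, but
  afterwards the register has no fresh pair, so the newly stale pair is left alone. Thus the
  original contents stay pending, and the reserved pairs, which no longer move, cover the
  overwritten registers.\<close>

lemma walk:
  assumes a: "arranged A inp U E C R cov" and P: "P \<subseteq> U" "\<forall>q \<in> P. \<not> is_split E q"
    "P \<inter> cov ` (R - fresh_regs U E) = {}"
    and s: "steady A C P \<rho> \<gamma>" and i: "i \<le> length \<gamma>"
  shows "\<exists>E' C' D. execution A C (events (take i \<gamma>)) D \<and>
    arranged A inp U E' C' R (\<lambda>x. if x \<in> fresh_regs U E \<inter> written (events (take i \<gamma>)) then \<rho> x else cov x) \<and>
    agree (members {q \<in> U. \<not> is_split E q}) D C' \<and>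
    (\<forall>q \<in> U. \<not> is_split E q \<longrightarrow> \<not> is_split E' q) \<and>
    (\<forall>q \<in> U. \<forall>x. fresh_on E' q x \<longleftrightarrow> fresh_on E q x \<and> x \<notin> written (events (take i \<gamma>))) \<and>
    (\<forall>q \<in> U. \<forall>x v. fresh_on E q x \<and> pending E q x v \<longrightarrow> pending E' q x v)"
  using i
proof (induction i)
  case 0
  show ?case
    by (intro exI[of _ E] exI[of _ C]) (use a in \<open>auto simp: agree_def\<close>)
next
  case (Suc i)
  note ad = arrangedD[OF a]
  let ?W = "written (events (take i \<gamma>))"
  let ?ci = "\<lambda>x. if x \<in> fresh_regs U E \<inter> ?W then \<rho> x else cov x"
  let ?N = "{q \<in> U. \<not> is_split E q}"
  obtain E1 C1 D where IH: "execution A C (events (take i \<gamma>)) D" "arranged A inp U E1 C1 R ?ci"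
    "agree (members ?N) D C1" "\<forall>q \<in> U. \<not> is_split E q \<longrightarrow> \<not> is_split E1 q"
    "\<forall>q \<in> U. \<forall>x. fresh_on E1 q x \<longleftrightarrow> fresh_on E q x \<and> x \<notin> ?W"
    "\<forall>q \<in> U. \<forall>x v. fresh_on E q x \<and> pending E q x v \<longrightarrow> pending E1 q x v"
    using Suc by auto
  have fr1: "fresh_regs U E1 = fresh_regs U E - ?W" using IH(5) by (auto simp: fresh_regs_def)
  have il: "i < length \<gamma>" using Suc.prems by simp
  have "\<gamma> ! i \<in> set \<gamma>" using il by simp
  then obtain p f w where J: "\<gamma> ! i = Joint p f w" "p \<in> P" using steadyD(2)[OF s] by fastforce
  have dec: "\<gamma> = take i \<gamma> @ Joint p f w # drop (Suc i) \<gamma>" using il J(1) by (metis id_take_nth_drop)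
  have tk: "take (Suc i) \<gamma> = take i \<gamma> @ [Joint p f w]" using il J(1) by (simp add: take_Suc_conv_app_nth)
  have WW: "written (events (take (Suc i) \<gamma>)) = ?W \<union> op_writes f" unfolding tk by auto
  have "written (events (take (Suc i) \<gamma>)) \<subseteq> written (events \<gamma>)"
    by (metis append_take_drop_id events_simps(3) sup_ge1 written_simps(2))
  then have inj: "inj_on \<rho> (?W \<union> op_writes f)" and \<rho>P: "\<rho> ` (?W \<union> op_writes f) \<subseteq> P"
    using steadyD(3,4)[OF s] unfolding WW by (meson inj_on_subset, blast)
  have \<rho>: "\<rho> x \<noteq> p" "pair_covers A D (\<rho> x) x" if "x \<in> ?W \<union> op_writes f" for x
    using steadyD(6)[OF s dec IH(1), of x] that by auto
  obtain D2 where D2: "execution A D [(fst p, f, w), (snd p, f, w)] D2"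
  proof -
    obtain Dn where "execution A C (events \<gamma>) Dn" using steadyD(1)[OF s] by blast
    then have "execution A C (events (take i \<gamma>) @ [(fst p, f, w), (snd p, f, w)] @ events (drop (Suc i) \<gamma>)) Dn"
      by (subst (asm) dec) simp
    then obtain X where X: "execution A C (events (take i \<gamma>)) X"
      "execution A X ([(fst p, f, w), (snd p, f, w)] @ events (drop (Suc i) \<gamma>)) Dn"
      unfolding execution_append[of A C] by blast
    have "X = D" using execution_det[OF X(1) IH(1)] .
    then show ?thesis using X(2) that unfolding execution_append[of A X] by blast
  qed
  have pN: "p \<in> ?N" using J(2) P by auto
  obtain D2' where D2': "execution A C1 [(fst p, f, w), (snd p, f, w)] D2'" "agree (members ?N) D2 D2'"
    using execution_agree[OF D2 IH(3)] pN by auto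
  \<comment> \<open>A pair of \<open>P\<close> can be covering at this time only as the pair
    reserved for an overwritten register. It is therefore neither \<open>p\<close> nor the pair
    reserved for another register.\<close>
  have cimg: "?ci x \<notin> P \<or> x \<in> ?W \<and> ?ci x = \<rho> x" if "x \<in> R - fresh_regs U E1" for x
    using that P(3) unfolding fr1 by auto
  have "p \<in> U" "\<not> is_split E1 p" using pN IH(4) by auto
  moreover have "p \<notin> ?ci ` (R - fresh_regs U E1)"
  proof
    assume "p \<in> ?ci ` (R - fresh_regs U E1)"
    then obtain x where x: "x \<in> R - fresh_regs U E1" "p = ?ci x" by blast
    have "x \<in> ?W \<and> p = \<rho> x" using cimg[OF x(1)] J(2) unfolding x(2)[symmetric] by blast
    then show False using \<rho>(1)[of x] by blast
  qed
  moreover have "\<rho> y \<in> U \<and> \<not> is_split E1 (\<rho> y) \<and> \<rho> y \<noteq> p \<and> \<rho> y \<notin> ?ci ` (R - fresh_regs U E1) \<and> pair_covers A C1 (\<rho> y) y"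
    if y: "y \<in> op_writes f \<inter> fresh_regs U E1" for y
  proof (intro conjI)
    have yP: "\<rho> y \<in> P" using \<rho>P y by blast
    then have yN: "\<rho> y \<in> ?N" using P by auto
    then show "\<rho> y \<in> U" "\<not> is_split E1 (\<rho> y)" using IH(4) by auto
    show "\<rho> y \<noteq> p" using \<rho>(1) y by auto
    show "\<rho> y \<notin> ?ci ` (R - fresh_regs U E1)"
    proof
      assume "\<rho> y \<in> ?ci ` (R - fresh_regs U E1)"
      then obtain x where "x \<in> R - fresh_regs U E1" "\<rho> y = ?ci x" by blast
      then have "x \<in> ?W" "\<rho> y = \<rho> x" using cimg[of x] yP by auto
      then have "x = y" using inj y by (auto simp: inj_on_def)
      then show False using \<open>x \<in> ?W\<close> y fr1 by auto
    qed
    show "pair_covers A C1 (\<rho> y) y"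
      using \<rho>(2)[of y] y yN IH(3) by (auto simp: pair_covers_def covers_def agree_def)
  qed
  ultimately obtain E2 C2 where E2: "arranged A inp U E2 C2 R (\<lambda>x. if x \<in> op_writes f \<inter> fresh_regs U E1 then \<rho> x else ?ci x)"
    "agree (members {q \<in> U. \<not> is_split E1 q}) D2' C2"
    "\<forall>q \<in> U. \<not> is_split E1 q \<longrightarrow> \<not> is_split E2 q"
    "\<forall>q \<in> U. \<forall>x. fresh_on E2 q x \<longleftrightarrow> fresh_on E1 q x \<and> x \<notin> op_writes f"
    "\<forall>q \<in> U. \<forall>x v. pending E1 q x v \<and> (fresh_on E1 q x \<or> x \<notin> fresh_regs U E1) \<longrightarrow> pending E2 q x v"
    using arranged_joint[OF IH(2) _ _ _ D2'(1), of \<rho>] by blast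
  have "execution A C (events (take (Suc i) \<gamma>)) D2" unfolding tk using IH(1) D2 by (auto simp: execution_append)
  moreover have "(\<lambda>x. if x \<in> op_writes f \<inter> fresh_regs U E1 then \<rho> x else ?ci x) =
      (\<lambda>x. if x \<in> fresh_regs U E \<inter> written (events (take (Suc i) \<gamma>)) then \<rho> x else cov x)"
    unfolding WW fr1 by (auto simp: fun_eq_iff)
  then have "arranged A inp U E2 C2 R (\<lambda>x. if x \<in> fresh_regs U E \<inter> written (events (take (Suc i) \<gamma>)) then \<rho> x else cov x)"
    using E2(1) by simp
  moreover have "agree (members ?N) D2 C2"
  proof -
    have "members ?N \<subseteq> members {q \<in> U. \<not> is_split E1 q}" using IH(4) by blast
    from agree_mono[OF E2(2) this] show ?thesis using agree_trans[OF D2'(2)] by blast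
  qed
  moreover have "\<forall>q \<in> U. \<not> is_split E q \<longrightarrow> \<not> is_split E2 q" using IH(4) E2(3) by blast
  moreover have "\<forall>q \<in> U. \<forall>x. fresh_on E2 q x \<longleftrightarrow> fresh_on E q x \<and> x \<notin> written (events (take (Suc i) \<gamma>))"
    using E2(4) IH(5) unfolding WW by auto
  moreover have "pending E2 q x v" if q: "q \<in> U" "fresh_on E q x" "pending E q x v" for q x v
  proof -
    have "fresh_on E1 q x \<or> x \<notin> fresh_regs U E1" using IH(5) q(1,2) fr1 by blast
    then show ?thesis using E2(5) IH(6) q by blast
  qed
  ultimately show ?case by blast
qed

section \<open>Restoring the memory\<close>

text \<open>\<open>N\<close> consists of bystanders: pairs free of every obligation, from which the
  sets of the next round are formed.\<close>

definition point ::
  "('p, 's, 'r, 'v, 'c) system \<Rightarrow> ('p \<Rightarrow> bool) \<Rightarrow> ('p \<times> 'p) set \<Rightarrow> 'r set \<Rightarrow> ('r \<Rightarrow> 'p \<times> 'p) \<Rightarrow> ('p \<times> 'p) set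
    \<Rightarrow> ('p, 'r, 'v, 'c) action list \<Rightarrow> ('p, 's, 'r, 'v) config \<Rightarrow> bool" where
  "point A inp U R cov N E C \<longleftrightarrow> arranged A inp U E C R cov \<and> N \<subseteq> U \<and> (\<forall>q \<in> N. \<not> is_split E q) \<and>
    N \<inter> cov ` (R - fresh_regs U E) = {}"

text \<open>Leaves open which action took place. All that the search for a critical write uses is
  that some process was poised to perform this very write and that the bystanders did not
  move.\<close>

definition single_write ::
  "('p, 's, 'r, 'v, 'c) system \<Rightarrow> ('p \<Rightarrow> bool) \<Rightarrow> ('p \<times> 'p) set \<Rightarrow> 'r set \<Rightarrow> ('r \<Rightarrow> 'p \<times> 'p) \<Rightarrow> ('p \<times> 'p) set
    \<Rightarrow> ('p, 'r, 'v, 'c) action list \<times> ('p, 's, 'r, 'v) config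
    \<Rightarrow> ('p, 'r, 'v, 'c) action list \<times> ('p, 's, 'r, 'v) config \<Rightarrow> bool" where
  "single_write A inp U R cov N K K' \<longleftrightarrow>
    point A inp U R cov N (fst K) (snd K) \<and> point A inp U R cov N (fst K') (snd K') \<and>
    (\<exists>z \<in> members U. \<exists>s y v. proc (snd K) z = Active s \<and> Write y v \<in> ops A s \<and>
      reg (snd K') = (reg (snd K))(y := v)) \<and>
    (\<exists>es. execution A (snd K) es (snd K')) \<and>
    (\<forall>p \<in> members N. proc (snd K') p = proc (snd K) p)"

text \<open>There are two sources for the value. If it is held back by a stale clone, uniting leaves
  \<open>y\<close> covered as before; if it is written by the process of the covering pair alone,
  \<open>y\<close> acquires a fresh pair and needs no covering pair any more. The last clause keeps
  the sources for all other registers intact.\<close>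

lemma restore_one:
  assumes pt: "point A inp U R cov N E C" and y: "y \<in> R - fresh_regs U E"
    and src: "(\<exists>t \<in> U. pending E t y u) \<or> (\<exists>s. proc C (fst (cov y)) = Active s \<and> Write y u \<in> ops A s)"
  shows "\<exists>E' C'. single_write A inp U R cov N (E, C) (E', C') \<and> reg C' = (reg C)(y := u) \<and>
    (\<forall>x \<in> R - fresh_regs U E - {y}. \<forall>v. x \<in> R - fresh_regs U E' \<and>
      proc C' (fst (cov x)) = proc C (fst (cov x)) \<and> (\<forall>t. pending E t x v \<longrightarrow> pending E' t x v))"
proof -
  have a: "arranged A inp U E C R cov" and N: "N \<subseteq> U" "\<forall>q \<in> N. \<not> is_split E q"
    "N \<inter> cov ` (R - fresh_regs U E) = {}" using pt by (auto simp: point_def)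
  note ad = arrangedD[OF a]
  note cy = ad(7,8,9)[OF y]
  obtain b z s C' where b: "actor b \<in> U" "allowed_after E b" "execution A C (events_of b) C'"
      "reg C' = (reg C)(y := u)" "written (events_of b) = {y}"
    and z: "z \<in> members U" "proc C z = Active s" "Write y u \<in> ops A s"
    and kind: "b = Unite (actor b) y u \<and> pending E (actor b) y u \<or> b = Split (cov y) y u"
  proof (cases "\<exists>t \<in> U. pending E t y u")
    case True
    then obtain t where t: "t \<in> U" "pending E t y u" by blast
    obtain s where "proc C (snd t) = Active s" "Write y u \<in> ops A s" using pending_poised[OF ad(1,3) t] by blast
    then show ?thesis using unite_executable[OF a t] that[of "Unite t y u" _ "snd t" s] t by fastforce
  next
    case False
    then obtain s where s: "proc C (fst (cov y)) = Active s" "Write y u \<in> ops A s" using src by blast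
    have "fst (cov y) \<in> procs A" using ad(1) cy(1) by (auto simp: clone_pairs_iff)
    then have "\<exists>C'. step A C (fst (cov y), Write y u, Ack) C' \<and> reg C' = (reg C)(y := u)"
      unfolding step_iff using s by auto
    then obtain C' where "execution A C (events_of (Split (cov y) y u)) C'" "reg C' = (reg C)(y := u)"
      by (auto simp: execution_Cons_iff)
    then show ?thesis using that[of "Split (cov y) y u" C' "fst (cov y)" s] cy s by auto
  qed
  have nofresh: "\<not> fresh_on E q y" if "q \<in> U" for q using y that by (auto simp: fresh_regs_def)
  have act_fresh: "\<not> fresh_on E (actor b) x" for x
  proof
    assume f: "fresh_on E (actor b) x"
    from fresh_on_pending[OF this] obtain v where v: "pending E (actor b) x v" by blast
    then have "is_split E (actor b)" by (auto simp: is_split_pending)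
    then have "pending E (actor b) y u" using kind cy(2) by auto
    then have "x = y" using pending_unique[OF v] by simp
    then show False using f nofresh b(1) by blast
  qed
  have fresh': "fresh_on (E @ [b]) q x \<longleftrightarrow> fresh_on E q x \<or> q = actor b \<and> x = y \<and> b = Split (cov y) y u"
    if "q \<in> U" for q x
  proof (cases "actor b = q")
    case True
    then show ?thesis using kind act_fresh[of x] by (cases b) (auto simp: fresh_on_snoc)
  next
    case False
    then show ?thesis using nofresh[OF that] b(5) by (auto simp: fresh_on_snoc)
  qed
  have fr': "fresh_regs U E \<subseteq> fresh_regs U (E @ [b])" "fresh_regs U (E @ [b]) \<subseteq> insert y (fresh_regs U E)"
    using fresh' by (auto simp: fresh_regs_def)
  have split_y: "y \<in> fresh_regs U (E @ [b])" if "b = Split (cov y) y u"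
    using fresh'[of "cov y" y] that cy(1) by (auto simp: fresh_regs_def)
  have cov_ne: "cov x \<noteq> actor b" if "x \<in> R - fresh_regs U (E @ [b])" for x
  proof
    assume eq: "cov x = actor b"
    have x: "x \<in> R - fresh_regs U E" using that fr'(1) by blast
    then have "\<not> is_split E (actor b)" using ad(8)[OF x] eq by simp
    then have "b = Split (cov y) y u" using kind by (auto simp: is_split_pending)
    then have "x = y" using eq ad(10) x y by (auto simp: inj_on_def)
    then show False using split_y \<open>b = Split (cov y) y u\<close> that by blast
  qed
  have a': "arranged A inp U (E @ [b]) C' R cov"
  proof (rule arranged_snoc[OF a b(1-3)])
    show "x \<in> R" if "b = Split q x v" for q x v using that kind y by auto
    show "q = actor b" if "x \<in> written (events_of b)" "x \<in> fresh_regs U E" for x q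
      using that b(5) y by auto
    show "cov x \<in> U \<and> \<not> is_split (E @ [b]) (cov x) \<and> pair_covers A C' (cov x) x"
      if x: "x \<in> R - fresh_regs U (E @ [b])" for x
    proof -
      have "x \<in> R - fresh_regs U E" using x fr'(1) by blast
      note c = ad(7-9)[OF this]
      show ?thesis using c cov_ne[OF x] action_idle(3)[OF ad(1) b(1) c(1) cov_ne[OF x] b(3)]
        by (simp add: is_split_snoc)
    qed
    show "inj_on cov (R - fresh_regs U (E @ [b]))" using ad(10) fr'(1) by (auto intro: inj_on_subset)
  qed
  have N_ne: "q \<noteq> actor b" if "q \<in> N" for q
    using kind N(2,3) that y by (auto simp: is_split_pending)
  have pt': "point A inp U R cov N (E @ [b]) C'"
    unfolding point_def
  proof (intro conjI)
    show "\<forall>q \<in> N. \<not> is_split (E @ [b]) q" using N(2) N_ne unfolding is_split_snoc by metis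
    show "N \<inter> cov ` (R - fresh_regs U (E @ [b])) = {}" using N(3) fr'(1) by blast
  qed (fact a' N(1))+
  have procN: "\<forall>p \<in> members N. proc C' p = proc C p"
    using action_idle(1,2)[OF ad(1) b(1) _ _ b(3)] N_ne N(1) by auto
  have "single_write A inp U R cov N (E, C) (E @ [b], C')"
    unfolding single_write_def using pt pt' z b(3,4) procN by auto
  moreover have "x \<in> R - fresh_regs U (E @ [b]) \<and> proc C' (fst (cov x)) = proc C (fst (cov x)) \<and>
      (\<forall>t. pending E t x v \<longrightarrow> pending (E @ [b]) t x v)" if x: "x \<in> R - fresh_regs U E - {y}" for x v
  proof (intro conjI allI impI)
    show x': "x \<in> R - fresh_regs U (E @ [b])" using x fr'(2) by auto
    show "proc C' (fst (cov x)) = proc C (fst (cov x))"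
      using action_idle(1)[OF ad(1) b(1) _ cov_ne[OF x'] b(3)] ad(7) x by blast
    show "pending (E @ [b]) t x v" if t: "pending E t x v" for t
    proof -
      have "t \<noteq> actor b"
      proof
        assume "t = actor b"
        then have "is_split E (actor b)" using t by (auto simp: is_split_pending)
        then have "pending E (actor b) y u" using kind cy(2) by auto
        then show False using pending_unique[OF t] \<open>t = actor b\<close> x by auto
      qed
      then show ?thesis using t by (simp add: pending_snoc)
    qed
  qed
  ultimately show ?thesis using b(4) by blast
qed

text \<open>The writes to different registers come from different pairs and do not disturb each
  other, so they can be performed in any order.\<close>

lemma restore:
  assumes "finite X" "point A inp U R cov N E C" "X \<subseteq> R - fresh_regs U E"
    and "\<forall>y \<in> X. (\<exists>t \<in> U. pending E t y (d y)) \<or> (\<exists>s. proc C (fst (cov y)) = Active s \<and> Write y (d y) \<in> ops A s)"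
  shows "\<exists>E' C'. (single_write A inp U R cov N)\<^sup>*\<^sup>* (E, C) (E', C') \<and>
    reg C' = (\<lambda>x. if x \<in> X then d x else reg C x)"
  using assms
proof (induction X arbitrary: E C rule: finite_induct)
  case empty
  then show ?case by auto
next
  case (insert y X)
  obtain E1 C1 where 1: "single_write A inp U R cov N (E, C) (E1, C1)" "reg C1 = (reg C)(y := d y)"
    "\<forall>x \<in> R - fresh_regs U E - {y}. \<forall>v. x \<in> R - fresh_regs U E1 \<and>
      proc C1 (fst (cov x)) = proc C (fst (cov x)) \<and> (\<forall>t. pending E t x v \<longrightarrow> pending E1 t x v)"
    using restore_one[OF insert.prems(1), of y "d y"] insert.prems(2,3) by auto
  have X: "X \<subseteq> R - fresh_regs U E - {y}" using insert by auto
  have "point A inp U R cov N E1 C1" using 1(1) by (simp add: single_write_def)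
  moreover have "X \<subseteq> R - fresh_regs U E1" using X 1(3) by blast
  moreover have "\<forall>y \<in> X. (\<exists>t \<in> U. pending E1 t y (d y)) \<or>
      (\<exists>s. proc C1 (fst (cov y)) = Active s \<and> Write y (d y) \<in> ops A s)"
  proof
    fix x assume x: "x \<in> X"
    then have "\<forall>v. proc C1 (fst (cov x)) = proc C (fst (cov x)) \<and> (\<forall>t. pending E t x v \<longrightarrow> pending E1 t x v)"
      using 1(3) X by blast
    moreover have "(\<exists>t \<in> U. pending E t x (d x)) \<or> (\<exists>s. proc C (fst (cov x)) = Active s \<and> Write x (d x) \<in> ops A s)"
      using insert.prems(3) x by blast
    ultimately show "(\<exists>t \<in> U. pending E1 t x (d x)) \<or> (\<exists>s. proc C1 (fst (cov x)) = Active s \<and> Write x (d x) \<in> ops A s)"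
      by metis
  qed
  ultimately obtain E' C' where 2: "(single_write A inp U R cov N)\<^sup>*\<^sup>* (E1, C1) (E', C')"
    "reg C' = (\<lambda>x. if x \<in> X then d x else reg C1 x)"
    using insert.IH by blast
  have "reg C' = (\<lambda>x. if x \<in> insert y X then d x else reg C x)"
    using 2(2) 1(2) insert.hyps by (auto simp: fun_eq_iff)
  then show ?case using converse_rtranclp_into_rtranclp[of "single_write A inp U R cov N", OF 1(1) 2(1)] by blast
qed

section \<open>Undoing a reserving execution\<close>

definition walked ::
  "('p, 's, 'r, 'v, 'c) system \<Rightarrow> ('p \<Rightarrow> bool) \<Rightarrow> ('p \<times> 'p) set \<Rightarrow> ('p, 'r, 'v, 'c) action list
    \<Rightarrow> ('p, 's, 'r, 'v) config \<Rightarrow> 'r set \<Rightarrow> ('r \<Rightarrow> 'p \<times> 'p) \<Rightarrow> ('r \<Rightarrow> 'p \<times> 'p) \<Rightarrow> ('p, 'r, 'v, 'c) action list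
    \<Rightarrow> ('p, 'r, 'v, 'c) action list \<Rightarrow> ('p, 's, 'r, 'v) config \<Rightarrow> ('p, 's, 'r, 'v) config \<Rightarrow> bool" where
  "walked A inp U E C R cov \<rho> \<gamma> E' C' D \<longleftrightarrow> execution A C (events \<gamma>) D \<and>
    arranged A inp U E' C' R (\<lambda>x. if x \<in> fresh_regs U E \<inter> written (events \<gamma>) then \<rho> x else cov x) \<and>
    agree (members {q \<in> U. \<not> is_split E q}) D C' \<and>
    (\<forall>q \<in> U. \<not> is_split E q \<longrightarrow> \<not> is_split E' q) \<and>
    (\<forall>q \<in> U. \<forall>x. fresh_on E' q x \<longleftrightarrow> fresh_on E q x \<and> x \<notin> written (events \<gamma>)) \<and>
    (\<forall>q \<in> U. \<forall>x v. fresh_on E q x \<and> pending E q x v \<longrightarrow> pending E' q x v)"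

lemma walkedD:
  assumes "walked A inp U E C R cov \<rho> \<gamma> E' C' D"
  shows "execution A C (events \<gamma>) D"
    "arranged A inp U E' C' R (\<lambda>x. if x \<in> fresh_regs U E \<inter> written (events \<gamma>) then \<rho> x else cov x)"
    "agree (members {q \<in> U. \<not> is_split E q}) D C'"
    "q \<in> U \<Longrightarrow> \<not> is_split E q \<Longrightarrow> \<not> is_split E' q"
    "fresh_regs U E' = fresh_regs U E - written (events \<gamma>)"
    "q \<in> U \<Longrightarrow> fresh_on E q x \<Longrightarrow> pending E q x v \<Longrightarrow> pending E' q x v"
  using assms unfolding walked_def fresh_regs_def by auto

lemma walked_exists:
  assumes "arranged A inp U E C R cov" "P \<subseteq> U" "\<forall>q \<in> P. \<not> is_split E q"
    "P \<inter> cov ` (R - fresh_regs U E) = {}" "steady A C P \<rho> \<gamma>" "i \<le> length \<gamma>"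
  shows "\<exists>E' C' D. walked A inp U E C R cov \<rho> (take i \<gamma>) E' C' D"
  unfolding walked_def using walk[OF assms] by blast

lemma single_writeD:
  assumes "single_write A inp U R cov N K K'"
  shows "point A inp U R cov N (fst K) (snd K)" "point A inp U R cov N (fst K') (snd K')"
    "\<exists>z \<in> members U. \<exists>s y v. proc (snd K) z = Active s \<and> Write y v \<in> ops A s \<and>
      reg (snd K') = (reg (snd K))(y := v)"
    "\<exists>es. execution A (snd K) es (snd K')" "\<forall>p \<in> members N. proc (snd K') p = proc (snd K) p"
  by (insert assms, unfold single_write_def) (elim conjE, assumption)+

lemma single_writes:
  assumes "(single_write A inp U R cov N)\<^sup>*\<^sup>* K K'" "point A inp U R cov N (fst K) (snd K)"
  shows "point A inp U R cov N (fst K') (snd K') \<and> (\<exists>es. execution A (snd K) es (snd K')) \<and>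
    (\<forall>p \<in> members N. proc (snd K') p = proc (snd K) p)"
  using assms(1)
proof (induction rule: rtranclp_induct)
  case base
  have "execution A (snd K) [] (snd K)" by simp
  then show ?case using assms(2) by blast
next
  case (step K1 K2)
  have s: "point A inp U R cov N (fst K2) (snd K2)" "\<exists>es. execution A (snd K1) es (snd K2)"
    "\<forall>p \<in> members N. proc (snd K2) p = proc (snd K1) p"
    using single_writeD[OF step.hyps(2)] by blast+
  obtain es fs where "execution A (snd K) es (snd K1)" "execution A (snd K1) fs (snd K2)"
    using step.IH s(2) by blast
  then have "execution A (snd K) (es @ fs) (snd K2)" unfolding execution_append by blast
  moreover have "\<forall>p \<in> members N. proc (snd K2) p = proc (snd K) p"
    using step.IH s(3) by simp
  ultimately show ?case using s(1) by blast
qed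

lemma idle_members:
  assumes a: "arranged A inp U E C R cov" and S: "S \<subseteq> U"
    and J: "\<forall>a \<in> set \<gamma>. \<exists>q \<in> S. \<exists>f w. a = Joint q f w"
    and ex: "execution A C (events \<gamma>) D" and q: "q \<in> U" "q \<notin> S"
  shows "proc D (fst q) = proc C (fst q)" "proc D (snd q) = proc C (snd q)"
proof -
  have "fst q \<notin> members S \<and> snd q \<notin> members S"
    using clone_pairs_disjoint[OF arrangedD(1)[OF a] q(1)] S q(2) by fastforce
  then have "fst q \<notin> fst ` set (events \<gamma>)" "snd q \<notin> fst ` set (events \<gamma>)"
    using events_Joint_members[OF J] by blast+
  then show "proc D (fst q) = proc C (fst q)" "proc D (snd q) = proc C (snd q)"
    using execution_proc_idle[OF ex] by blast+
qed

text \<open>To the bystanders the result looks as if \<open>\<gamma>\<close> had never happened and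
  the covering pairs had written \<open>d\<close> right away. \<open>R'\<close> and
  \<open>cov'\<close> may extend \<open>R\<close> and \<open>cov\<close>, because this is applied
  both with and without an additional arranged register.\<close>

lemma reset:
  assumes a: "arranged A inp U E C R cov" and S: "S \<subseteq> U" "\<forall>q \<in> S. \<not> is_split E q"
    "S \<inter> cov ` (R - fresh_regs U E) = {}"
    and J: "\<forall>a \<in> set \<gamma>. \<exists>q \<in> S. \<exists>f w. a = Joint q f w"
    and W: "written (events \<gamma>) \<subseteq> R"
    and w: "walked A inp U E C R cov \<rho> \<gamma> E' C' D"
    and pt: "point A inp U R' cov' N E' C'" and R': "R \<subseteq> R'" "\<forall>y \<in> R - fresh_regs U E. cov' y = cov y"
    and N: "N \<inter> S = {}" "N \<subseteq> U" "\<forall>q \<in> N. \<not> is_split E q"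
    and d: "\<forall>y \<in> R - fresh_regs U E. \<exists>s. proc C (fst (cov y)) = Active s \<and> Write y (d y) \<in> ops A s"
  shows "\<exists>E'' K. (single_write A inp U R' cov' N)\<^sup>*\<^sup>* (E', C') (E'', K) \<and>
    agree (members N) K (C\<lparr>reg := \<lambda>x. if x \<in> R - fresh_regs U E then d x else reg C x\<rparr>)"
proof -
  note ad = arrangedD[OF a] and wd = walkedD[OF w]
  let ?F = "fresh_regs U E" and ?W = "written (events \<gamma>)"
  \<comment> \<open>Overwritten registers that were fresh get their old content from the clones. The
    registers in \<open>R\<^sub>c\<close> get \<open>d\<close> from the covering pairs, which lie
    outside \<open>S\<close> and are still poised. No other register is written by
    \<open>\<gamma>\<close>.\<close>
  let ?X = "(?F \<inter> ?W) \<union> (R - ?F)" and ?d = "\<lambda>y. if y \<in> ?F then reg C y else d y"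
  have same: "proc C' (fst q) = proc C (fst q)" "proc C' (snd q) = proc C (snd q)"
    if "q \<in> U" "\<not> is_split E q" "q \<notin> S" for q
    using idle_members[OF a S(1) J wd(1) that(1,3)] wd(3) that(1,2) by (auto simp: agree_def)
  have "\<forall>y \<in> ?X. (\<exists>t \<in> U. pending E' t y (?d y)) \<or> (\<exists>s. proc C' (fst (cov' y)) = Active s \<and> Write y (?d y) \<in> ops A s)"
  proof
    fix y assume y: "y \<in> ?X"
    show "(\<exists>t \<in> U. pending E' t y (?d y)) \<or> (\<exists>s. proc C' (fst (cov' y)) = Active s \<and> Write y (?d y) \<in> ops A s)"
    proof (cases "y \<in> ?F")
      case True
      then obtain t where t: "t \<in> U" "fresh_on E t y" by (auto simp: fresh_regs_def)
      then obtain v where v: "pending E t y v" using fresh_on_pending[OF t(2)] by blast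
      then have "v = reg C y" using fresh_on_value[OF ad(1,3) t] by simp
      then show ?thesis using wd(6)[OF t v] t(1) True by auto
    next
      case False
      then have y: "y \<in> R - ?F" using y by blast
      have "cov y \<notin> S" using S(3) y by blast
      then have "proc C' (fst (cov' y)) = proc C (fst (cov y))"
        using same(1)[OF ad(7)[OF y] ad(8)[OF y]] R'(2) y by simp
      then show ?thesis using d y False by auto
    qed
  qed
  moreover have "?X \<subseteq> R' - fresh_regs U E'" using wd(5) ad(5) R'(1) by blast
  moreover have "finite ?X" using ad(4) by simp
  ultimately obtain E'' K where K: "(single_write A inp U R' cov' N)\<^sup>*\<^sup>* (E', C') (E'', K)"
    "reg K = (\<lambda>x. if x \<in> ?X then ?d x else reg C' x)"
    using restore[OF _ pt, of ?X ?d] by blast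
  have "reg C' x = reg C x" if "x \<notin> ?W" for x
    using execution_reg_unwritten[OF wd(1) that] wd(3) by (simp add: agree_def)
  then have "reg K = (\<lambda>x. if x \<in> R - ?F then d x else reg C x)"
    unfolding K(2) using W ad(5) by (auto simp: fun_eq_iff)
  moreover have "proc K p = proc C p" if p: "p \<in> members N" for p
  proof -
    obtain q where q: "q \<in> N" "p = fst q \<or> p = snd q" using p by auto
    then have "proc C' p = proc C p" using same[of q] N by blast
    moreover have "proc K p = proc C' p" using single_writes[OF K(1)] pt p by auto
    ultimately show ?thesis by simp
  qed
  ultimately have "agree (members N) K (C\<lparr>reg := \<lambda>x. if x \<in> R - ?F then d x else reg C x\<rparr>)"
    by (simp add: agree_def)
  then show ?thesis using K(1) by blast
qed

section \<open>Enlarging the set of arranged registers\<close>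

lemma card_members: "finite U \<Longrightarrow> card (members U) \<le> 2 * card U"
  using card_Un_le[of "fst ` U" "snd ` U"] card_image_le[of U fst] card_image_le[of U snd] by simp

lemma new_pair:
  assumes "finite U" "infinite (procs A) \<or> 2 * card U + 2 \<le> card (procs A)"
  shows "\<exists>n. fst n \<in> procs A \<and> snd n \<in> procs A \<and> fst n \<noteq> snd n \<and> {fst n, snd n} \<inter> members U = {}"
proof -
  have fin: "finite (members U)" using assms(1) by simp
  have "infinite (procs A - members U) \<or> 2 \<le> card (procs A - members U)"
    using assms(2)
  proof
    assume "2 * card U + 2 \<le> card (procs A)"
    moreover have "card (procs A) - card (members U) \<le> card (procs A - members U)"
      using fin by (rule diff_card_le_card_Diff)
    ultimately show ?thesis using card_members[OF assms(1)] by linarith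
  qed (use fin in auto)
  then obtain T where "T \<subseteq> procs A - members U" "card T = 2"
    using infinite_arbitrarily_large obtain_subset_with_card_n by metis
  then obtain x y where "x \<noteq> y" "{x, y} \<subseteq> procs A - members U" by (auto simp: card_2_iff)
  then show ?thesis by (intro exI[of _ "(x, y)"]) auto
qed

text \<open>The imitating pair also joins the bystanders, so that it may take part in the reserving
  executions of the next round.\<close>

lemma add_pair:
  assumes pt: "point A inp U R cov N E C" and z: "z \<in> members U"
    and big: "infinite (procs A) \<or> 2 * card U + 2 \<le> card (procs A)"
  shows "\<exists>n inp' E' C'. n \<notin> U \<and> point A inp' (insert n U) R cov (insert n N) E' C' \<and>
    agree (members U) C C' \<and> proc C' (fst n) = proc C z \<and> proc C' (snd n) = proc C z"
proof -
  have a: "arranged A inp U E C R cov" and N: "N \<subseteq> U" "\<forall>q \<in> N. \<not> is_split E q"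
    "N \<inter> cov ` (R - fresh_regs U E) = {}" using pt by (auto simp: point_def)
  note ad = arrangedD[OF a]
  obtain n where n: "fst n \<in> procs A" "snd n \<in> procs A" "fst n \<noteq> snd n" "{fst n, snd n} \<inter> members U = {}"
    using new_pair[OF ad(2) big] by blast
  have nU: "n \<notin> U" using n(4) by auto
  obtain inp' E' where E': "arranged A inp' (insert n U) E' (copy_proc z n C) R cov" "\<not> is_split E' n"
    "\<forall>q \<in> U. is_split E' q = is_split E q" "fresh_regs (insert n U) E' = fresh_regs U E"
    using arranged_shadow[OF a z n] by blast
  have "n \<notin> cov ` (R - fresh_regs U E)" using ad(7) nU by auto
  then have "point A inp' (insert n U) R cov (insert n N) E' (copy_proc z n C)"
    unfolding point_def using E' N by auto
  moreover have "p \<noteq> fst n \<and> p \<noteq> snd n" if "p \<in> members U" for p using n(4) that by blast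
  then have "agree (members U) C (copy_proc z n C)" by (simp add: agree_def copy_proc_def)
  moreover have "proc (copy_proc z n C) (fst n) = proc C z" "proc (copy_proc z n C) (snd n) = proc C z"
    by (auto simp: copy_proc_def)
  ultimately show ?thesis using nU by blast
qed

text \<open>Sending a fresh pair to its register is a bijection: a pair is split on one register
  only, and no register has two fresh pairs.\<close>

lemma card_fresh:
  assumes "arranged A inp U E C R cov"
  shows "card {q \<in> U. \<exists>x. fresh_on E q x} = card (fresh_regs U E)"
proof -
  define h where "h q = (SOME x. fresh_on E q x)" for q
  have h: "h q = x" if "fresh_on E q x" for q x
    unfolding h_def using that fresh_on_unique[OF _ that] by (rule some_equality)
  have "bij_betw h {q \<in> U. \<exists>x. fresh_on E q x} (fresh_regs U E)"
    unfolding bij_betw_def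
  proof
    show "inj_on h {q \<in> U. \<exists>x. fresh_on E q x}"
      using arrangedD(6)[OF assms] h by (auto intro!: inj_onI)
    show "h ` {q \<in> U. \<exists>x. fresh_on E q x} = fresh_regs U E"
      using h by (force simp: fresh_regs_def image_iff)
  qed
  then show ?thesis by (rule bij_betw_same_card)
qed

lemma card_stale:
  assumes "arranged A inp U E C R cov"
  shows "card {q \<in> U. \<exists>x. stale_on E q x} \<le> card R"
proof -
  define h where "h q = (SOME x. stale_on E q x)" for q
  have h: "h q = x" if "stale_on E q x" for q x
    unfolding h_def using that stale_on_unique[OF _ that] by (rule some_equality)
  have "inj_on h {q \<in> U. \<exists>x. stale_on E q x}"
    using arrangedD(12)[OF assms] h by (auto intro!: inj_onI)
  moreover have "h ` {q \<in> U. \<exists>x. stale_on E q x} \<subseteq> R"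
    using h arrangedD(11)[OF assms] by auto
  ultimately show ?thesis using arrangedD(4)[OF assms] by (rule card_inj_on_le)
qed

lemma card_cov:
  assumes "arranged A inp U E C R cov"
  shows "card (fresh_regs U E) + card (cov ` (R - fresh_regs U E)) = card R"
proof -
  note ad = arrangedD[OF assms]
  have "card (cov ` (R - fresh_regs U E)) = card (R - fresh_regs U E)" using ad(10) by (rule card_image)
  then show ?thesis using ad(4,5) by (simp add: card_Diff_subset finite_subset card_mono)
qed

section \<open>The critical write\<close>

text \<open>As far as \<open>Q\<close> can see, at most one write for which some process is poised
  leads from \<open>C\<close> to \<open>D\<close>. Only agreement is required, because the two
  configurations may be reached by different executions.\<close>

definition near ::
  "('p, 's, 'r, 'v, 'c) system \<Rightarrow> ('p \<times> 'p) set \<Rightarrow> ('p \<times> 'p) set \<Rightarrow> ('p, 's, 'r, 'v) config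
    \<Rightarrow> ('p, 's, 'r, 'v) config \<Rightarrow> bool" where
  "near A U Q C D \<longleftrightarrow> agree (members Q) D C \<or>
    (\<exists>z \<in> members U. \<exists>s y v. proc C z = Active s \<and> Write y v \<in> ops A s \<and>
      agree (members Q) D (C\<lparr>reg := (reg C)(y := v)\<rparr>))"

lemma nearI:
  assumes "z \<in> members U" "proc C z = Active s" "Write y v \<in> ops A s"
    and "agree (members Q) D (C\<lparr>reg := (reg C)(y := v)\<rparr>)"
  shows "near A U Q C D"
  using assms unfolding near_def by blast

context consensus
begin

text \<open>The value \<open>b\<close> is left open, so the two sets may exchange their roles.
  \<open>can_return\<close> takes the place of \<open>Res\<close> because only fixed, immobile
  reserved pairs can become covering pairs; the lower bounds \<open>m + 1\<close> are those that
  \<open>reserving\<close> demands.\<close>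

definition bivalent :: "nat \<Rightarrow> bool" where
  "bivalent r \<longleftrightarrow> (\<exists>inp U E C R cov b P Q. arranged A inp U E C R cov \<and> card R = r \<and> card U = 5 * m + 6 + 2 * r \<and>
    P \<subseteq> U \<and> Q \<subseteq> U \<and> P \<inter> Q = {} \<and> (\<forall>q \<in> P \<union> Q. \<not> is_split E q) \<and>
    (P \<union> Q) \<inter> cov ` (R - fresh_regs U E) = {} \<and> m + 1 \<le> card P \<and> m + 1 \<le> card Q \<and>
    card P + card Q \<le> 2 * m + 4 \<and> can_return A C P b \<and> can_return A C Q (\<not> b))"

lemma bivalentI:
  assumes "arranged A inp U E C R cov" "card R = r" "card U = 5 * m + 6 + 2 * r"
    "P \<subseteq> U" "Q \<subseteq> U" "P \<inter> Q = {}" "\<forall>q \<in> P \<union> Q. \<not> is_split E q"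
    "(P \<union> Q) \<inter> cov ` (R - fresh_regs U E) = {}" "m + 1 \<le> card P" "m + 1 \<le> card Q"
    "card P + card Q \<le> 2 * m + 4" "can_return A C P b" "can_return A C Q (\<not> b)"
  shows "bivalent r"
  unfolding bivalent_def
  by (rule exI[of _ inp], rule exI[of _ U], rule exI[of _ E], rule exI[of _ C], rule exI[of _ R],
      rule exI[of _ cov], rule exI[of _ b], rule exI[of _ P], rule exI[of _ Q]) (intro conjI assms)

text \<open>Two pairs that imitate \<open>z\<close> can prepend the critical write to the execution
  of \<open>Q\<close>, so \<open>P\<close> and the enlarged \<open>Q\<close> return different values
  from one configuration. The enlarged \<open>Q\<close> has at most \<open>m + 3\<close> pairs,
  whence \<open>2 * m + 4\<close>, and the two new pairs bring \<open>U\<close> to the size required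
  for \<open>Suc r\<close>.\<close>

lemma finish:
  assumes pt: "point A inp U R cov (P \<union> Q) E C" and R: "card R = Suc r" and U: "card U = 5 * m + 6 + 2 * r"
    and PQ: "card P = m + 1" "card Q = m + 1" "P \<inter> Q = {}"
    and can: "can_return A C P b" "can_return A D Q (\<not> b)" and D: "near A U Q C D"
    and big: "infinite (procs A) \<or> 2 * card U + 4 \<le> card (procs A)"
  shows "bivalent (Suc r)"
proof -
  have finU: "finite U" and PQU: "P \<subseteq> U" "Q \<subseteq> U"
    using pt arrangedD(2) by (auto simp: point_def)
  obtain z where z: "z \<in> members U" and nearD: "agree (members Q) D C \<or>
      (\<exists>s y v. proc C z = Active s \<and> Write y v \<in> ops A s \<and> agree (members Q) D (C\<lparr>reg := (reg C)(y := v)\<rparr>))"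
  proof (cases "agree (members Q) D C")
    case True
    \<comment> \<open>No write separates the configurations, so any process may be imitated; the new
      pairs only serve to enlarge \<open>U\<close>.\<close>
    have "U \<noteq> {}" using U by auto
    then show ?thesis using True that by blast
  next
    case False
    then show ?thesis using D that unfolding near_def by blast
  qed
  obtain n inp1 E1 C1 where 1: "n \<notin> U" "point A inp1 (insert n U) R cov (insert n (P \<union> Q)) E1 C1"
    "agree (members U) C C1" "proc C1 (fst n) = proc C z" "proc C1 (snd n) = proc C z"
    using add_pair[OF pt z] big by auto
  have "infinite (procs A) \<or> 2 * card (insert n U) + 2 \<le> card (procs A)"
    using big finU 1(1) by auto
  moreover have "z \<in> members (insert n U)" using z by auto
  ultimately obtain n' inp2 E2 C2 where 2: "n' \<notin> insert n U"
    "point A inp2 (insert n' (insert n U)) R cov (insert n' (insert n (P \<union> Q))) E2 C2"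
    "agree (members (insert n U)) C1 C2" "proc C2 (fst n') = proc C1 z" "proc C2 (snd n') = proc C1 z"
    using add_pair[OF 1(2)] by blast
  let ?U = "insert n' (insert n U)"
  have agU: "agree (members U) C C2"
    using agree_trans[OF 1(3) agree_mono[OF 2(3)]] by auto
  then have agP: "agree (members P) C C2" and agQ: "agree (members Q) C C2"
    using agree_mono[OF agU, of "members P"] agree_mono[OF agU, of "members Q"] PQU by blast+
  have st: "proc C2 (fst n) = proc C z" "proc C2 (fst n') = proc C z"
    using 1(3,4) 2(3,4) z by (auto simp: agree_def)
  have a2: "arranged A inp2 ?U E2 C2 R cov" and N2: "insert n' (insert n (P \<union> Q)) \<subseteq> ?U"
    "\<forall>q \<in> insert n' (insert n (P \<union> Q)). \<not> is_split E2 q"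
    "insert n' (insert n (P \<union> Q)) \<inter> cov ` (R - fresh_regs ?U E2) = {}"
    using 2(2) unfolding point_def by blast+
  have sy: "synced A C2 (insert n' (insert n Q))"
    using arranged_synced[OF a2, of "insert n' (insert n Q)"] N2(1,2) by blast
  have canP: "can_return A C2 P b" using can_return_agree[OF can(1) agP] .
  have nQ: "n \<notin> Q" "n' \<notin> Q" "n \<noteq> n'" "n \<notin> P" "n' \<notin> P" using 1(1) 2(1) PQU by auto
  have "\<exists>Q'. Q \<subseteq> Q' \<and> Q' \<subseteq> insert n' (insert n Q) \<and> can_return A C2 Q' (\<not> b)"
    using nearD
  proof
    assume "agree (members Q) D C"
    then have "can_return A C2 Q (\<not> b)" using can_return_agree[OF can(2)] agree_trans[OF _ agQ] by blast
    then show ?thesis by blast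
  next
    assume "\<exists>s y v. proc C z = Active s \<and> Write y v \<in> ops A s \<and> agree (members Q) D (C\<lparr>reg := (reg C)(y := v)\<rparr>)"
    then obtain s y v where s: "proc C z = Active s" "Write y v \<in> ops A s"
      and D: "agree (members Q) D (C\<lparr>reg := (reg C)(y := v)\<rparr>)" by blast
    have D2: "agree (members Q) D (C2\<lparr>reg := (reg C2)(y := v)\<rparr>)"
      using D agQ by (auto simp: agree_def)
    have "proc C2 (fst n) = Active s" "proc C2 (fst n') = Active s" using st s(1) by auto
    \<comment> \<open>Here \<open>n\<close> writes and \<open>n'\<close> is the pair reserved for
      the written register.\<close>
    then have "can_return A C2 (insert n' (insert n Q)) (\<not> b)"
      using can_return_prepend_write[OF can(2) D2 nQ(2,1) _ sy _ _ s(2)] nQ(3) by blast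
    then show ?thesis by (intro exI[of _ "insert n' (insert n Q)"]) auto
  qed
  then obtain Q' where Q': "Q \<subseteq> Q'" "Q' \<subseteq> insert n' (insert n Q)" "can_return A C2 Q' (\<not> b)" by blast
  have finQ: "finite Q" using PQU(2) finU finite_subset by blast
  then have "card Q' \<le> card (insert n' (insert n Q))" using Q'(2) by (intro card_mono) auto
  moreover have "card (insert n' (insert n Q)) = m + 3" using finQ nQ PQ(2) by simp
  moreover have "card Q \<le> card Q'" using Q' finQ by (intro card_mono) (auto intro: finite_subset)
  moreover have "card ?U = 5 * m + 6 + 2 * Suc r" using finU 1(1) 2(1) U by simp
  moreover have "P \<inter> Q' = {}" using Q'(2) nQ(4,5) PQ(3) by blast
  moreover have "P \<union> Q' \<subseteq> insert n' (insert n (P \<union> Q))" using Q'(2) by blast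
  moreover have "\<forall>q \<in> P \<union> Q'. \<not> is_split E2 q" "(P \<union> Q') \<inter> cov ` (R - fresh_regs ?U E2) = {}" "P \<subseteq> ?U" "Q' \<subseteq> ?U"
    using N2 Q'(2) by blast+
  ultimately show ?thesis
    by (intro bivalentI[OF a2 R _ _ _ _ _ _ _ _ _ canP Q'(3)]) (use PQ(1,2) in linarith)+
qed

end

lemma returned_conflict:
  assumes "correct_consensus A" "reachable A C" "steady A C S \<rho> \<gamma>" "returns \<gamma> b" "proc C p = Returned b'"
  shows "b' = b"
proof -
  obtain D where D: "execution A C (events \<gamma>) D" using steadyD(1)[OF assms(3)] by blast
  then obtain q where "proc D q = Returned b" using returns_execution[OF assms(3,4)] by blast
  then show ?thesis
    using agreement[OF assms(1) reachable_execution[OF assms(2) D] execution_Returned[OF D assms(5)]] by simp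
qed

lemma can_return_conflict:
  assumes "correct_consensus A" "reachable A C" "can_return A C S b" "proc C p = Returned b'"
  shows "b' = b"
  using returned_conflict[OF assms(1,2) _ _ assms(4)] assms(3) unfolding can_return_def by blast

lemma point_reachable: "point A inp U R cov N E C \<Longrightarrow> reachable A C"
  unfolding point_def using arrangedD(3)[THEN pair_execution_reachable] by (elim conjE)

context consensus
begin

lemma can_return_exists_point:
  assumes pt: "point A inp U R cov N E C" and P: "P \<subseteq> N" "card P = m + 1"
    and act: "\<forall>q \<in> P. \<exists>s. proc C (fst q) = Active s"
  shows "\<exists>b. can_return A C P b"
proof (rule can_return_exists)
  have a: "arranged A inp U E C R cov" and N: "N \<subseteq> U" "\<forall>q \<in> N. \<not> is_split E q"
    using pt by (auto simp: point_def)
  show "finite P" using P N arrangedD(2)[OF a] by (meson finite_subset)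
  show "reachable A C" using arrangedD(3)[OF a] by (rule pair_execution_reachable)
  show "synced A C P" using arranged_synced[OF a, of P] N P(1) by blast
qed (use P act in auto)

text \<open>The form in which the failure of the claim for \<open>Suc r\<close> is exploited:
  \<open>Q\<close> tests the configuration after a write and \<open>P\<close> the one before it.
  Opposite values would yield a bivalent configuration by \<open>finish\<close>, and
  \<open>P\<close> can return some value in any case.\<close>

lemma univalent:
  assumes "\<not> bivalent (Suc r)" and pt: "point A inp U R cov (P \<union> Q) E C" and R: "card R = Suc r"
    and U: "card U = 5 * m + 6 + 2 * r"
    and PQ: "card P = m + 1" "card Q = m + 1" "P \<inter> Q = {}"
    and act: "\<forall>q \<in> P. \<exists>s. proc C (fst q) = Active s"
    and big: "infinite (procs A) \<or> 2 * card U + 4 \<le> card (procs A)"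
    and can: "can_return A D Q b" and D: "near A U Q C D"
  shows "can_return A C P b \<and> \<not> can_return A C P (\<not> b)"
proof -
  have no: "\<not> can_return A C P (\<not> b)"
    using finish[OF pt R U PQ _ _ D big, of "\<not> b"] can assms(1) by auto
  moreover obtain b' where "can_return A C P b'"
    using can_return_exists_point[OF pt _ PQ(1) act] by auto
  ultimately show ?thesis by (cases "b' = b") auto
qed

text \<open>
  Suppose the claim fails for \<open>Suc r\<close>. Then \<open>P\<close> and \<open>Q\<close> always return the same value where \<open>Suc r\<close>
  registers are arranged, and no single write can change that value. Running \<open>\<gamma>\<close> up to its first write
  outside \<open>R\<close> arranges one more register. From there, restoring the memory in which \<open>b\<close> is returned
  forces the value \<open>b\<close>, whereas completing \<open>\<gamma>\<close> forces \<open>\<not> b\<close>.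
\<close>

lemma step_core:
  assumes a: "arranged A inp U E C R cov" and card: "card R = r" "card U = 5 * m + 6 + 2 * r"
    and big: "infinite (procs A) \<or> 2 * card U + 4 \<le> card (procs A)"
    and S: "S \<subseteq> U" "\<forall>q \<in> S. \<not> is_split E q" "S \<inter> cov ` (R - fresh_regs U E) = {}"
    and PQ: "card P = m + 1" "card Q = m + 1" "P \<inter> Q = {}"
    and N: "P \<union> Q \<subseteq> U" "\<forall>q \<in> P \<union> Q. \<not> is_split E q" "(P \<union> Q) \<inter> cov ` (R - fresh_regs U E) = {}"
      "(P \<union> Q) \<inter> S = {}"
    and act: "\<forall>q \<in> P \<union> Q. \<exists>s. proc C (fst q) = Active s"
    and s: "steady A C S \<rho> \<gamma>" "returns \<gamma> (\<not> b)"
    and d: "\<forall>y \<in> R - fresh_regs U E. \<exists>s. proc C (fst (cov y)) = Active s \<and> Write y (d y) \<in> ops A s"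
    and Pb: "can_return A (C\<lparr>reg := \<lambda>x. if x \<in> R - fresh_regs U E then d x else reg C x\<rparr>) P b"
  shows "bivalent (Suc r)"
proof (rule ccontr)
  assume bad: "\<not> bivalent (Suc r)"
  let ?N = "P \<union> Q" and ?n = "length \<gamma>"
  note ad = arrangedD[OF a]
  have PN: "P \<subseteq> U" "Q \<subseteq> U" using N(1) by auto
  have J: "\<forall>a \<in> set \<gamma>. \<exists>q \<in> S. \<exists>f w. a = Joint q f w" using steadyD(2)[OF s(1)] .
  have Jt: "\<forall>a \<in> set (take i \<gamma>). \<exists>q \<in> S. \<exists>f w. a = Joint q f w" for i
    using J set_take_subset[of i \<gamma>] by blast
  have wsub: "written (events (take i \<gamma>)) \<subseteq> written (events \<gamma>)" for i
    by (metis append_take_drop_id events_simps(3) sup_ge1 written_simps(2))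
  have injW: "inj_on \<rho> (written (events \<gamma>))" and \<rho>S: "\<rho> ` written (events \<gamma>) \<subseteq> S" using steadyD(3,4)[OF s(1)] .
  have NS: "?N \<subseteq> {q \<in> U. \<not> is_split E q}" using N(1,2) by auto
  then have NSm: "members ?N \<subseteq> members {q \<in> U. \<not> is_split E q}" by blast
  have walk: "\<exists>E' C' D. walked A inp U E C R cov \<rho> (take i \<gamma>) E' C' D" if "i \<le> ?n" for i
    using walked_exists[OF a S s(1) that] .
  \<comment> \<open>\<open>D i\<close> lies on \<open>\<gamma>\<close> run directly from
    \<open>C\<close>. Each walk yields an arranged configuration of its own; these are compared only
    through their agreement with the \<open>D i\<close>.\<close>
  obtain D where D: "\<And>i. i \<le> ?n \<Longrightarrow> execution A C (events (take i \<gamma>)) (D i)"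
    using walkedD(1) walk by metis
  have walkD: "\<exists>E' C'. walked A inp U E C R cov \<rho> (take i \<gamma>) E' C' (D i)" if i: "i \<le> ?n" for i
  proof -
    obtain E' C' D' where w: "walked A inp U E C R cov \<rho> (take i \<gamma>) E' C' D'" using walk[OF i] by blast
    have "D' = D i" using execution_det[OF walkedD(1)[OF w] D[OF i]] .
    then show ?thesis using w by blast
  qed
  have procN: "proc (D i) p = proc C p" if i: "i \<le> ?n" and p: "p \<in> members ?N" for i p
  proof -
    obtain q where q: "q \<in> ?N" "p = fst q \<or> p = snd q" using p by auto
    then have "q \<in> U" "q \<notin> S" using N(1,4) by blast+
    then show ?thesis using idle_members[OF a S(1) Jt D[OF i]] q(2) by blast
  qed
  have actD: "\<forall>q \<in> ?N. \<exists>s. proc K (fst q) = Active s" if "\<forall>p \<in> members ?N. proc K p = proc C p" for K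
    using act that by auto
  have no_cov: "?N \<inter> (\<lambda>x. if x \<in> fresh_regs U E \<inter> W then \<rho> x else cov x) ` (R - (fresh_regs U E - W)) = {}"
    if "W \<subseteq> written (events \<gamma>)" for W
  proof -
    have "(if x \<in> fresh_regs U E \<inter> W then \<rho> x else cov x) \<notin> ?N" if "x \<in> R - (fresh_regs U E - W)" for x
    proof (cases "x \<in> fresh_regs U E \<inter> W")
      case True
      then have "\<rho> x \<in> S" using \<rho>S \<open>W \<subseteq> written (events \<gamma>)\<close> by blast
      then show ?thesis using True N(4) by auto
    next
      case False
      then have "cov x \<in> cov ` (R - fresh_regs U E)" using that by blast
      then show ?thesis using N(3) unfolding if_not_P[OF False] by blast
    qed
    then show ?thesis by blast
  qed
  obtain qr where qr: "proc (D ?n) qr = Returned (\<not> b)"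
    using returns_execution[OF s] D[of ?n] by auto
  have reachC: "reachable A C" using ad(3) by (rule pair_execution_reachable)
  have reachD: "reachable A (D i)" if "i \<le> ?n" for i
    using reachable_execution[OF reachC D[OF that]] .

  \<comment> \<open>Otherwise a reset after the whole of \<open>\<gamma>\<close> lets
    \<open>P\<close> return \<open>b\<close> although a pair of \<open>S\<close> has already
    returned \<open>\<not> b\<close>.\<close>
  have "\<not> written (events \<gamma>) \<subseteq> R"
  proof
    assume W: "written (events \<gamma>) \<subseteq> R"
    obtain E' C' where w: "walked A inp U E C R cov \<rho> \<gamma> E' C' (D ?n)" using walkD[of ?n] by auto
    let ?c = "\<lambda>x. if x \<in> fresh_regs U E \<inter> written (events \<gamma>) then \<rho> x else cov x"
    have pt: "point A inp U R ?c ?N E' C'"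
      unfolding point_def
    proof (intro conjI)
      show "?N \<inter> ?c ` (R - fresh_regs U E') = {}" using no_cov[of "written (events \<gamma>)"] walkedD(5)[OF w] by simp
      show "\<forall>q \<in> ?N. \<not> is_split E' q" using walkedD(4)[OF w] N by blast
    qed (use walkedD(2)[OF w] N in auto)
    obtain E'' K where K: "(single_write A inp U R ?c ?N)\<^sup>*\<^sup>* (E', C') (E'', K)"
      "agree (members ?N) K (C\<lparr>reg := \<lambda>x. if x \<in> R - fresh_regs U E then d x else reg C x\<rparr>)"
      using reset[OF a S J W w pt _ _ N(4,1,2) d] by auto
    have "agree (members P) (C\<lparr>reg := \<lambda>x. if x \<in> R - fresh_regs U E then d x else reg C x\<rparr>) K"
      using agree_sym[OF agree_members_Un(1)[OF K(2)]] .
    then have "can_return A K P b" using can_return_agree[OF Pb] by blast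
    moreover have "reachable A K"
      using single_writes[OF K(1)] pt point_reachable[of A inp U R ?c ?N E'' K] by simp
    moreover have "\<exists>q. proc K q = Returned (\<not> b)"
    proof -
      obtain q where q: "q \<in> S" "proc (D ?n) (fst q) = Returned (\<not> b)"
        using returns_execution[OF s, of "D ?n"] D[of ?n] by auto
      then have "proc C' (fst q) = Returned (\<not> b)"
        using walkedD(3)[OF w] S(1,2) by (auto simp: agree_def)
      moreover obtain es where "execution A C' es K" using single_writes[OF K(1)] pt by auto
      ultimately have "proc K (fst q) = Returned (\<not> b)" by (rule execution_Returned[rotated])
      then show ?thesis by blast
    qed
    ultimately show False using can_return_conflict[OF correct, of K P b _ "\<not> b"] by auto
  qed
  then have "\<not> written (events (take ?n \<gamma>)) \<subseteq> R" by simp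
  \<comment> \<open>Action \<open>i0 - 1\<close>, called \<open>j\<close> below, is the earliest one
    that writes outside \<open>R\<close>; the prefix before it can still be undone by
    \<open>reset\<close>.\<close>
  define i0 where "i0 = (LEAST i. \<not> written (events (take i \<gamma>)) \<subseteq> R)"
  have i0: "\<not> written (events (take i0 \<gamma>)) \<subseteq> R" "i0 \<le> ?n"
    using \<open>\<not> written (events (take ?n \<gamma>)) \<subseteq> R\<close> unfolding i0_def by (fact LeastI, fact Least_le)
  have "i0 \<noteq> 0" using i0(1) by (cases "i0 = 0") auto
  then obtain j where j: "i0 = Suc j" using not0_implies_Suc by blast
  have Wj: "written (events (take j \<gamma>)) \<subseteq> R"
    using not_less_Least[of j "\<lambda>i. \<not> written (events (take i \<gamma>)) \<subseteq> R"] j unfolding i0_def by auto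
  have jn: "j < ?n" using i0(2) j by simp
  have step_i: "\<exists>p f w. p \<in> S \<and> \<gamma> ! i = Joint p f w \<and> take (Suc i) \<gamma> = take i \<gamma> @ [Joint p f w] \<and>
      \<gamma> = take i \<gamma> @ Joint p f w # drop (Suc i) \<gamma>" if "i < ?n" for i
  proof -
    have "\<gamma> ! i \<in> set \<gamma>" using that by simp
    then obtain p f w where "p \<in> S" "\<gamma> ! i = Joint p f w" using J by blast
    then show ?thesis using that by (metis id_take_nth_drop take_Suc_conv_app_nth)
  qed
  obtain x where x: "x \<in> written (events (take (Suc j) \<gamma>))" "x \<notin> R" using i0(1) j by blast
  have xW: "x \<in> written (events \<gamma>)" using x(1) wsub by blast
  let ?R = "insert x R"
  have cardR: "card ?R = Suc r" using x(2) card(1) ad(4) by simp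
  \<comment> \<open>At \<open>i = j\<close> the register \<open>x\<close> is not yet written, but
    \<open>steady\<close> provides its reserved pair just before the write; from then on this pair
    never moves.\<close>
  have \<rho>x: "pair_covers A (D i) (\<rho> x) x" if i: "j \<le> i" "i \<le> ?n" for i
  proof (cases "i = j")
    case True
    obtain p f w where "take (Suc j) \<gamma> = take j \<gamma> @ [Joint p f w]" "\<gamma> = take j \<gamma> @ Joint p f w # drop (Suc j) \<gamma>"
      using step_i[OF jn] by blast
    then show ?thesis using steadyD(6)[OF s(1) _ D[of j], of _ _ x] x(1) jn True by auto
  next
    case False
    then have "take (Suc j) \<gamma> = take (Suc j) (take i \<gamma>)" using i by (simp add: min_def)
    then have "x \<in> written (events (take i \<gamma>))"
      using x(1) by (metis append_take_drop_id events_simps(3) UnI1 written_simps(2))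
    then show ?thesis using steady_covers_after[OF s(1) arranged_synced[OF a S(1,2)] i(2) D[OF i(2)]] by blast
  qed
  have PT: "\<exists>E' C' cov'. walked A inp U E C R cov \<rho> (take i \<gamma>) E' C' (D i) \<and> point A inp U ?R cov' ?N E' C' \<and>
      (\<forall>y \<in> R - fresh_regs U E. cov' y = cov y)" if i: "j \<le> i" "i \<le> ?n" for i
  proof -
    obtain E' C' where w: "walked A inp U E C R cov \<rho> (take i \<gamma>) E' C' (D i)" using walkD[OF i(2)] by blast
    let ?W = "written (events (take i \<gamma>))"
    let ?c = "\<lambda>x. if x \<in> fresh_regs U E \<inter> ?W then \<rho> x else cov x"
    have \<rho>xS: "\<rho> x \<in> S" using \<rho>S xW by blast
    \<comment> \<open>\<open>\<rho>\<close> is injective on the written registers, and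
      \<open>S\<close> contains none of the old covering pairs, so \<open>\<rho> x\<close> is not
      yet in use for a register in \<open>R\<close>.\<close>
    have nx: "\<rho> x \<notin> ?c ` (R - fresh_regs U E')"
    proof
      assume "\<rho> x \<in> ?c ` (R - fresh_regs U E')"
      then obtain y where y: "y \<in> R - fresh_regs U E'" "\<rho> x = ?c y" by blast
      show False
      proof (cases "y \<in> fresh_regs U E \<inter> ?W")
        case True
        then have "\<rho> x = \<rho> y" "y \<in> written (events \<gamma>)" using y(2) wsub by auto
        then have "x = y" using injW xW by (auto simp: inj_on_def)
        then show False using y(1) x(2) by blast
      next
        case False
        then have "y \<in> R - fresh_regs U E" "\<rho> x = cov y" using y walkedD(5)[OF w] by auto
        then show False using \<rho>xS S(3) by auto
      qed
    qed
    have "\<not> is_split E (\<rho> x)" "\<rho> x \<in> U" using S \<rho>xS by auto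
    moreover have "\<rho> x \<in> {q \<in> U. \<not> is_split E q}" using S(1,2) \<rho>xS by blast
    then have "proc C' (fst (\<rho> x)) = proc (D i) (fst (\<rho> x))" "proc C' (snd (\<rho> x)) = proc (D i) (snd (\<rho> x))"
      using walkedD(3)[OF w] unfolding agree_def by simp_all
    then have "pair_covers A C' (\<rho> x) x" using \<rho>x[OF i] by (simp add: pair_covers_def covers_def)
    ultimately have a': "arranged A inp U E' C' ?R (?c(x := \<rho> x))"
      using arranged_extend[OF walkedD(2)[OF w] x(2) _ _ nx] walkedD(4)[OF w] by blast
    have "point A inp U ?R (?c(x := \<rho> x)) ?N E' C'"
      unfolding point_def
    proof (intro conjI)
      have "?N \<inter> ?c ` (R - fresh_regs U E') = {}" using no_cov[OF wsub] walkedD(5)[OF w] by simp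
      moreover have "\<rho> x \<notin> ?N" using \<rho>xS N(4) by blast
      ultimately show "?N \<inter> (?c(x := \<rho> x)) ` (?R - fresh_regs U E') = {}"
        by (auto simp del: Un_iff split: if_splits)
      show "\<forall>q \<in> ?N. \<not> is_split E' q" using walkedD(4)[OF w] N by blast
    qed (use a' N in auto)
    moreover have "\<forall>y \<in> R - fresh_regs U E. (?c(x := \<rho> x)) y = cov y" using x(2) by auto
    ultimately show ?thesis using w by blast
  qed
  have uni: "can_return A K P u \<and> \<not> can_return A K P (\<not> u)"
    if "point A inp U ?R cov' ?N E' K" "can_return A K' Q u" "near A U Q K K'" "\<forall>p \<in> members ?N. proc K p = proc C p"
    for cov' E' K K' u
    using univalent[OF bad that(1) cardR card(2) PQ _ big that(2,3)] actD[OF that(4)] by blast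
  have near_refl: "near A U Q K K" for K by (simp add: near_def agree_def)
  \<comment> \<open>\<open>K\<close> is compared with itself: whatever \<open>Q\<close> can return
    there is the only value that \<open>P\<close> can return.\<close>
  have same: "\<exists>u. can_return A K Q u \<and> can_return A K P u \<and> \<not> can_return A K P (\<not> u)"
    if pt: "point A inp U ?R cov' ?N E' K" and pr: "\<forall>p \<in> members ?N. proc K p = proc C p" for cov' E' K
  proof -
    obtain u where "can_return A K Q u"
      using can_return_exists_point[OF pt _ PQ(2)] actD[OF pr] by auto
    then show ?thesis using uni[OF pt _ near_refl pr] by blast
  qed

  show False
  proof (cases "can_return A (D j) P (\<not> b)")
    case True
    obtain E' C' cov' where w: "walked A inp U E C R cov \<rho> (take j \<gamma>) E' C' (D j)"
      and pt: "point A inp U ?R cov' ?N E' C'" and c: "\<forall>y \<in> R - fresh_regs U E. cov' y = cov y"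
      using PT[of j] jn by auto
    have agC': "agree (members ?N) (D j) C'" using agree_mono[OF walkedD(3)[OF w] NSm] .
    obtain E'' K where K: "(single_write A inp U ?R cov' ?N)\<^sup>*\<^sup>* (E', C') (E'', K)"
      "agree (members ?N) K (C\<lparr>reg := \<lambda>x. if x \<in> R - fresh_regs U E then d x else reg C x\<rparr>)"
      using reset[OF a S Jt Wj w pt _ c N(4,1,2) d] by auto
    have "agree (members P) (C\<lparr>reg := \<lambda>x. if x \<in> R - fresh_regs U E then d x else reg C x\<rparr>) K"
      using agree_sym[OF agree_members_Un(1)[OF K(2)]] .
    then have Kb: "can_return A K P b" using can_return_agree[OF Pb] by blast
    have base: "\<forall>p \<in> members ?N. proc C' p = proc C p"
      using agC' procN[of j] jn by (auto simp: agree_def)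
    \<comment> \<open>The value \<open>\<not> b\<close> persists along the restoring writes. The
      value \<open>u\<close> of \<open>K2\<close> is forced on \<open>K1\<close> as well, since one
      write leads from \<open>K1\<close> to \<open>K2\<close>, and hence it is
      \<open>\<not> b\<close>. At the end this collides with the value \<open>b\<close> given by the
      restored memory.\<close>
    have "can_return A (snd KK) P (\<not> b) \<and> (\<forall>p \<in> members ?N. proc (snd KK) p = proc C p) \<and>
        point A inp U ?R cov' ?N (fst KK) (snd KK)"
      if "(single_write A inp U ?R cov' ?N)\<^sup>*\<^sup>* (E', C') KK" for KK
      using that
    proof (induction rule: rtranclp_induct)
      case base
      have "agree (members P) (D j) C'" using agree_members_Un(1)[OF agC'] .
      then show ?case using can_return_agree[OF True] pt \<open>\<forall>p \<in> members ?N. proc C' p = proc C p\<close> by auto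
    next
      case (step K1 K2)
      note sw = single_writeD[OF step.hyps(2)]
      have pr: "\<forall>p \<in> members ?N. proc (snd K2) p = proc C p" using sw(5) step.IH by simp
      obtain u where u: "can_return A (snd K2) Q u" "can_return A (snd K2) P u" using same[OF sw(2) pr] by blast
      have "agree (members Q) (snd K2) ((snd K1)\<lparr>reg := reg (snd K2)\<rparr>)"
        using sw(5) by (auto simp: agree_def)
      then have "near A U Q (snd K1) (snd K2)"
        unfolding near_def using sw(3) by metis
      then have "\<not> can_return A (snd K1) P (\<not> u)" using uni[OF sw(1) u(1)] step.IH by blast
      then have "u = (\<not> b)" using step.IH by (cases u; cases b) auto
      then show ?case using u(2) pr sw(2) by simp
    qed
    from this[OF K(1)] have Knb: "can_return A K P (\<not> b)" and pr: "\<forall>p \<in> members ?N. proc K p = proc C p"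
      and ptK: "point A inp U ?R cov' ?N E'' K" by auto
    obtain u where "\<not> can_return A K P (\<not> u)" using same[OF ptK pr] by blast
    then show False using Kb Knb by (cases u; cases b) auto
  next
    case False
    have agP: "agree (members P) (D i) K" "agree (members P) K (D i)" "agree (members Q) (D i) K" "agree (members Q) K (D i)"
      "\<forall>p \<in> members ?N. proc K p = proc C p"
      if "walked A inp U E C R cov \<rho> (take i \<gamma>) E' K (D i)" "i \<le> ?n" for i E' K
    proof -
      have ag: "agree (members ?N) (D i) K" using agree_mono[OF walkedD(3)[OF that(1)] NSm] .
      show "agree (members P) (D i) K" "agree (members Q) (D i) K" using agree_members_Un[OF ag] .
      then show "agree (members P) K (D i)" "agree (members Q) K (D i)" by (auto intro: agree_sym)
      show "\<forall>p \<in> members ?N. proc K p = proc C p"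
      proof
        fix p assume p: "p \<in> members ?N"
        then have "proc (D i) p = proc K p" using ag unfolding agree_def by blast
        then show "proc K p = proc C p" using procN[OF that(2) p] by simp
      qed
    qed
    \<comment> \<open>Now \<open>b\<close> persists along the rest of \<open>\<gamma>\<close>. Each
      step is examined at two separately walked configurations, \<open>K1\<close> for
      \<open>D i\<close> and \<open>K2\<close> for \<open>D (Suc i)\<close>.\<close>
    have "can_return A (D i) P b" if "j \<le> i" "i \<le> ?n" for i
      using that
    proof (induction i rule: dec_induct)
      case base
      obtain E' C' cov' where w: "walked A inp U E C R cov \<rho> (take j \<gamma>) E' C' (D j)"
        and pt: "point A inp U ?R cov' ?N E' C'" using PT[of j] jn by auto
      note ag = agP[OF w]
      obtain u where u: "can_return A C' P u" using same[OF pt ag(5)] jn by auto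
      then have "can_return A (D j) P u" using can_return_agree[OF u ag(2)] jn by simp
      then show ?case using False by (cases "u = b") auto
    next
      case (step i)
      have i: "j \<le> i" "i < ?n" using step by auto
      obtain E1 K1 c1 where w1: "walked A inp U E C R cov \<rho> (take i \<gamma>) E1 K1 (D i)"
        and pt1: "point A inp U ?R c1 ?N E1 K1" using PT[of i] i by auto
      obtain E2 K2 c2 where w2: "walked A inp U E C R cov \<rho> (take (Suc i) \<gamma>) E2 K2 (D (Suc i))"
        and pt2: "point A inp U ?R c2 ?N E2 K2" using PT[of "Suc i"] i by auto
      have ag1: "agree (members P) (D i) K1" "agree (members Q) (D i) K1" "\<forall>p \<in> members ?N. proc K1 p = proc C p"
        using agP[OF w1] i by auto
      have ag2: "agree (members P) K2 (D (Suc i))" "agree (members Q) K2 (D (Suc i))" "\<forall>p \<in> members ?N. proc K2 p = proc C p"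
        using agP[OF w2] i by auto
      obtain u where u: "can_return A K2 Q u" "can_return A K2 P u" using same[OF pt2 ag2(3)] by blast
      obtain p f w where pfw: "p \<in> S" "take (Suc i) \<gamma> = take i \<gamma> @ [Joint p f w]" using step_i[OF i(2)] by blast
      have ex: "execution A (D i) [(fst p, f, w), (snd p, f, w)] (D (Suc i))"
      proof -
        obtain X where X: "execution A C (events (take i \<gamma>)) X" "execution A X [(fst p, f, w), (snd p, f, w)] (D (Suc i))"
          using D[of "Suc i"] i unfolding pfw(2) by (auto simp: execution_append)
        have "X = D i" using execution_det[OF X(1) D] i by simp
        then show ?thesis using X(2) by simp
      qed
      have "synced A (D i) S"
        using synced_execution[OF arranged_synced[OF a S(1,2)] Jt D] i by simp
      then obtain st where st: "proc (D i) (fst p) = Active st" "f \<in> ops A st" "reg (D (Suc i)) = apply_op f (reg (D i))"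
        using ex synced_joint_iff[OF _ pfw(1)] by fastforce
      have regK: "reg K1 = reg (D i)" using ag1(1) by (simp add: agree_def)
      have "proc (D (Suc i)) p = proc K1 p" if "p \<in> members Q" for p
      proof -
        have "p \<in> members ?N" using that by blast
        then show ?thesis using procN[of "Suc i" p] i ag1(3) by simp
      qed
      then have "agree (members Q) (D (Suc i)) (K1\<lparr>reg := apply_op f (reg K1)\<rparr>)"
        using st(3) regK by (simp add: agree_def)
      then have agK: "agree (members Q) K2 (K1\<lparr>reg := apply_op f (reg K1)\<rparr>)" using agree_trans[OF ag2(2)] by blast
      have pK: "proc K1 (fst p) = Active st"
        using st(1) walkedD(3)[OF w1] pfw(1) S(1,2) by (auto simp: agree_def)
      \<comment> \<open>To \<open>Q\<close> a read, a coin flip or a return changes nothing, and a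
        write of the pair \<open>p\<close> is the write at which \<open>fst p\<close> is poised in
        \<open>K1\<close>.\<close>
      have "near A U Q K1 K2"
      proof (cases "op_writes f = {}")
        case True
        then show ?thesis using agK unfolding near_def by (simp add: apply_op_id)
      next
        case False
        then obtain y v where "f = Write y v" by (cases f) auto
        moreover have "fst p \<in> members U" using pfw(1) S(1) by blast
        ultimately show ?thesis using nearI[OF _ pK] agK st(2) by simp
      qed
      then have "\<not> can_return A K1 P (\<not> u)" using uni[OF pt1 u(1)] ag1(3) by blast
      moreover have "can_return A K1 P b" using can_return_agree[OF step.IH ag1(1)] i by simp
      ultimately have "u = b" by (cases u; cases b) auto
      then show ?case using can_return_agree[OF u(2) ag2(1)] by simp
    qed
    then have "can_return A (D ?n) P b" using jn by simp
    then show False using can_return_conflict[OF correct reachD _ qr, of P b] by simp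
  qed
qed

section \<open>The induction on \<open>r\<close>\<close>

text \<open>A split pair is fresh or stale. Fresh and covering pairs together number
  \<open>card R\<close>, and there are at most \<open>card R\<close> stale ones; hence the factor
  2.\<close>

lemma card_unused:
  assumes a: "arranged A inp U E C R cov" and T: "finite T"
  shows "card U \<le> card (U - T - {q \<in> U. is_split E q} - cov ` (R - fresh_regs U E)) + card T + 2 * card R"
proof -
  note ad = arrangedD[OF a]
  let ?F = "{q \<in> U. \<exists>x. fresh_on E q x}" and ?S = "{q \<in> U. \<exists>x. stale_on E q x}"
  let ?X = "{q \<in> U. is_split E q}" and ?V = "cov ` (R - fresh_regs U E)"
  have "?X = ?F \<union> ?S" by (auto simp: is_split_iff)
  then have "card ?X \<le> card ?F + card ?S" by (simp add: card_Un_le)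
  then have "card ?X + card ?V \<le> 2 * card R"
    using card_fresh[OF a] card_stale[OF a] card_cov[OF a] by linarith
  moreover have "card U - card T \<le> card (U - T)" using T by (rule diff_card_le_card_Diff)
  moreover have "card (U - T) - card ?X \<le> card (U - T - ?X)" using ad(2) by (intro diff_card_le_card_Diff) simp
  moreover have "card (U - T - ?X) - card ?V \<le> card (U - T - ?X - ?V)"
    using ad(4) by (intro diff_card_le_card_Diff) simp
  ultimately show ?thesis by linarith
qed

lemma bivalent_Suc:
  assumes "bivalent r" and big: "infinite (procs A) \<or> 2 * (5 * m + 6 + 2 * Suc r) \<le> card (procs A)"
  shows "bivalent (Suc r)"
proof -
  obtain inp U E C R cov b P Q where a: "arranged A inp U E C R cov" and card: "card R = r" "card U = 5 * m + 6 + 2 * r"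
    and PQ: "P \<subseteq> U" "Q \<subseteq> U" "P \<inter> Q = {}" "\<forall>q \<in> P \<union> Q. \<not> is_split E q"
      "(P \<union> Q) \<inter> cov ` (R - fresh_regs U E) = {}" "card P + card Q \<le> 2 * m + 4"
    and can: "can_return A C P b" "can_return A C Q (\<not> b)"
    using assms(1) unfolding bivalent_def by (elim exE conjE) (rule that; assumption)
  note ad = arrangedD[OF a]
  have reachC: "reachable A C" using ad(3) by (rule pair_execution_reachable)
  let ?B = "U - (P \<union> Q) - {q \<in> U. is_split E q} - cov ` (R - fresh_regs U E)"
  have "finite (P \<union> Q)" using PQ(1,2) ad(2) finite_subset by blast
  then have "card U \<le> card ?B + card (P \<union> Q) + 2 * card R" by (rule card_unused[OF a])
  then have "5 * m + 6 + 2 * r \<le> card ?B + card (P \<union> Q) + 2 * r" unfolding card .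
  moreover have "card (P \<union> Q) \<le> 2 * m + 4" using card_Un_le[of P Q] PQ(6) by simp
  \<comment> \<open>At least \<open>3 * m + 2\<close> pairs remain, which is enough for two sets of
    \<open>m + 1\<close> pairs.\<close>
  ultimately have B: "2 * (m + 1) \<le> card ?B" by arith
  then obtain M where M: "M \<subseteq> ?B" "card M = 2 * (m + 1)" by (meson obtain_subset_with_card_n)
  then obtain P' where P': "P' \<subseteq> M" "card P' = m + 1" proof -
    have "m + 1 \<le> card M" using M(2) by simp
    then show ?thesis using that by (rule obtain_subset_with_card_n)
  qed
  define Q' where "Q' = M - P'"
  have "finite M" using M(1) ad(2) by (meson Diff_subset finite_Diff finite_subset)
  then have Q': "card Q' = m + 1" "P' \<inter> Q' = {}" "P' \<union> Q' = M"
    using P' M(2) card_Diff_subset[of P' M] finite_subset[of P' M] unfolding Q'_def by auto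
  have N: "P' \<union> Q' \<subseteq> U" "\<forall>q \<in> P' \<union> Q'. \<not> is_split E q" "(P' \<union> Q') \<inter> cov ` (R - fresh_regs U E) = {}"
    "(P' \<union> Q') \<inter> (P \<union> Q) = {}"
    unfolding Q'(3) using M(1) by blast+
  \<comment> \<open>A process that had already returned would contradict one of the two values that
    are still possible from \<open>C\<close>.\<close>
  have act: "\<exists>s. proc C q = Active s" for q
  proof (cases "proc C q")
    case (Returned v)
    then show ?thesis using can_return_conflict[OF correct reachC can(1)] can_return_conflict[OF correct reachC can(2)] by blast
  qed simp
  have "\<forall>y \<in> R - fresh_regs U E. \<exists>v s. proc C (fst (cov y)) = Active s \<and> Write y v \<in> ops A s"
    using ad(9) unfolding pair_covers_def covers_def by blast
  then obtain d where d: "\<forall>y \<in> R - fresh_regs U E. \<exists>s. proc C (fst (cov y)) = Active s \<and> Write y (d y) \<in> ops A s"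
    by (meson bchoice)
  have pt: "point A inp U R cov (P' \<union> Q') E C" using a N(1-3) by (simp add: point_def)
  obtain E' K where K: "(single_write A inp U R cov (P' \<union> Q'))\<^sup>*\<^sup>* (E, C) (E', K)"
    "reg K = (\<lambda>x. if x \<in> R - fresh_regs U E then d x else reg C x)"
    using restore[OF _ pt, of "R - fresh_regs U E" d] d ad(4) by blast
  have ptK: "point A inp U R cov (P' \<union> Q') E' K" and prK: "\<forall>p \<in> members (P' \<union> Q'). proc K p = proc C p"
    using single_writes[OF K(1)] pt by auto
  have "\<forall>q \<in> P'. \<exists>s. proc K (fst q) = Active s" using prK act by auto
  then obtain u where u: "can_return A K P' u" using can_return_exists_point[OF ptK _ P'(2)] by auto
  have "agree (members P') K (C\<lparr>reg := \<lambda>x. if x \<in> R - fresh_regs U E then d x else reg C x\<rparr>)"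
    using K(2) prK by (auto simp: agree_def)
  then have Pu: "can_return A (C\<lparr>reg := \<lambda>x. if x \<in> R - fresh_regs U E then d x else reg C x\<rparr>) P' u"
    using can_return_agree[OF u] by blast
  \<comment> \<open>The values of \<open>P\<close> and \<open>Q\<close> are opposite, so one of them
    conflicts with \<open>u\<close>, whichever \<open>u\<close> is.\<close>
  obtain S where S: "S = P \<or> S = Q" "can_return A C S (\<not> u)"
    using can by (cases u; cases b) auto
  then obtain \<rho> \<gamma> where s: "steady A C S \<rho> \<gamma>" "returns \<gamma> (\<not> u)" by (auto simp: can_return_def)
  have "S \<subseteq> P \<union> Q" using S(1) by blast
  then have S': "S \<subseteq> U" "\<forall>q \<in> S. \<not> is_split E q" "S \<inter> cov ` (R - fresh_regs U E) = {}" "(P' \<union> Q') \<inter> S = {}"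
    using PQ(1,2,4,5) N(4) by blast+
  have big': "infinite (procs A) \<or> 2 * card U + 4 \<le> card (procs A)" using big card(2) by auto
  show ?thesis
    by (rule step_core[OF a card big' S'(1-3) P'(2) Q'(1,2) N(1-3) S'(4) _ s d Pu]) (use act in blast)
qed

text \<open>From an initial configuration only members of \<open>P\<close> participate, so validity
  leaves their common input as the only possible output.\<close>

lemma can_return_valid:
  assumes s: "can_return A (initial A inp) P b" and P: "\<forall>p \<in> members P. inp p = c"
  shows "b = c"
proof -
  obtain \<rho> \<gamma> where \<gamma>: "steady A (initial A inp) P \<rho> \<gamma>" "returns \<gamma> b" using s by (auto simp: can_return_def)
  obtain D where D: "execution A (initial A inp) (events \<gamma>) D" using steadyD(1)[OF \<gamma>(1)] by blast
  obtain q w where q: "\<gamma> \<noteq> []" "last \<gamma> = Joint q (Return b) w" using \<gamma>(2) by (auto simp: returns_def)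
  then have "\<gamma> = butlast \<gamma> @ [Joint q (Return b) w]" by (metis append_butlast_last_id)
  then have ret: "(fst q, Return b, w) \<in> set (events \<gamma>)" by (metis Un_iff events_simps(2,3) events_of.simps(1) list.set_intros(1) set_append)
  obtain p where "p \<in> fst ` set (events \<gamma>)" "inp p = b"
    using validity[OF correct D ret] by blast
  moreover have "fst ` set (events \<gamma>) \<subseteq> members P" using events_Joint_members[OF steadyD(2)[OF \<gamma>(1)]] .
  ultimately show ?thesis using P by auto
qed

lemma bivalent_0:
  assumes big: "infinite (procs A) \<or> 2 * (5 * m + 6) \<le> card (procs A)"
  shows "bivalent 0"
proof -
  let ?k = "5 * m + 6"
  obtain T where T: "T \<subseteq> procs A" "card T = 2 * ?k" "finite T"
  proof (cases "finite (procs A)")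
    case True
    then show ?thesis using big obtain_subset_with_card_n[of "2 * ?k" "procs A"] that finite_subset by metis
  next
    case False
    then show ?thesis using infinite_arbitrarily_large[of "procs A" "2 * ?k"] that by blast
  qed
  obtain e where e: "bij_betw e {0..<2 * ?k} T" using ex_bij_betw_nat_finite[OF T(3)] T(2) by auto
  define g where "g i = (e (2 * i), e (2 * i + 1))" for i
  \<comment> \<open>The members of the \<open>m + 1\<close> pairs in \<open>?P\<close> get input 0
    and everybody else gets 1. By validity, \<open>?P\<close> returns 0 and \<open>?Q\<close>
    returns 1.\<close>
  define inp where "inp p \<longleftrightarrow> p \<notin> e ` {0..<2 * (m + 1)}" for p
  let ?U = "g ` {0..<?k}" and ?P = "g ` {0..<m + 1}" and ?Q = "g ` {m + 1..<2 * (m + 1)}"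
  note inj_e = bij_betw_imp_inj_on[OF e]
  have inj: "i = j" if "e i = e j" "i < 2 * ?k" "j < 2 * ?k" for i j
    by (rule inj_onD[OF inj_e that(1)]) (use that(2,3) in simp_all)
  have eT: "e i \<in> procs A" if "i < 2 * ?k" for i
  proof -
    have "e i \<in> e ` {0..<2 * ?k}" using that by simp
    then show ?thesis using T(1) bij_betw_imp_surj_on[OF e] by blast
  qed
  have ig: "inj_on g {0..<?k}"
  proof (rule inj_onI)
    fix x y assume xy: "x \<in> {0..<?k}" "y \<in> {0..<?k}" "g x = g y"
    then have "2 * x = 2 * y" by (intro inj) (auto simp: g_def)
    then show "x = y" by simp
  qed
  have inpe: "inp (e i) \<longleftrightarrow> 2 * (m + 1) \<le> i" if "i < 2 * ?k" for i
  proof -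
    have "e i \<in> e ` {0..<2 * (m + 1)} \<longleftrightarrow> i \<in> {0..<2 * (m + 1)}"
      by (rule inj_on_image_mem_iff[OF inj_e]) (use that in auto)
    then show ?thesis unfolding inp_def by auto
  qed
  have cl: "clone_pairs A inp ?U"
    unfolding clone_pairs_iff
  proof (intro conjI ballI impI)
    fix q assume "q \<in> ?U"
    then obtain i where i: "i < ?k" "q = g i" by auto
    show "fst q \<in> procs A" "snd q \<in> procs A" using i eT by (auto simp: g_def)
    show "fst q \<noteq> snd q" using i inj[of "2 * i" "2 * i + 1"] by (auto simp: g_def)
    \<comment> \<open>The boundary between the inputs is even, so it does not cut through a
      pair.\<close>
    have "2 * (m + 1) \<le> 2 * i + 1 \<longleftrightarrow> 2 * (m + 1) \<le> 2 * i" by presburger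
    moreover have "2 * i < 2 * ?k" "2 * i + 1 < 2 * ?k" using i(1) by auto
    ultimately show "inp (fst q) = inp (snd q)" unfolding i(2) g_def fst_conv snd_conv using inpe by blast
  next
    fix q q' assume q: "q \<in> ?U" "q' \<in> ?U" "q \<noteq> q'"
    then obtain i j where i: "i < ?k" "q = g i" and j: "j < ?k" "q' = g j" by auto
    then have "i \<noteq> j" using q(3) by auto
    have ne: "e x \<noteq> e y" if "x \<noteq> y" "x < 2 * ?k" "y < 2 * ?k" for x y using inj that by blast
    have "2 * i \<noteq> 2 * j + 1" "2 * i + 1 \<noteq> 2 * j" by presburger+
    then show "{fst q, snd q} \<inter> {fst q', snd q'} = {}"
      using ne[of "2 * i" "2 * j"] ne[of "2 * i" "2 * j + 1"] ne[of "2 * i + 1" "2 * j"] ne[of "2 * i + 1" "2 * j + 1"]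
        i j \<open>i \<noteq> j\<close> by (auto simp: g_def)
  qed
  have a: "arranged A inp ?U [] (initial A inp) {} undefined"
    unfolding arranged_def using cl by (simp add: fresh_regs_def)
  have sub: "?P \<subseteq> ?U" "?Q \<subseteq> ?U" by auto
  have cards: "card ?U = ?k" "card ?P = m + 1" "card ?Q = m + 1"
    using ig by (auto simp: card_image inj_on_subset)
  have disj: "?P \<inter> ?Q = {}"
  proof -
    have "?P \<inter> ?Q = g ` ({0..<m + 1} \<inter> {m + 1..<2 * (m + 1)})"
      by (rule inj_on_image_Int[OF ig, symmetric]) auto
    then show ?thesis by simp
  qed
  have act: "\<exists>s. proc (initial A inp) p = Active s" for p by (simp add: initial_def)
  have pt: "point A inp ?U {} undefined ?U [] (initial A inp)" using a by (simp add: point_def)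
  obtain b b' where b: "can_return A (initial A inp) ?P b" "can_return A (initial A inp) ?Q b'"
    using can_return_exists_point[OF pt sub(1) cards(2)] can_return_exists_point[OF pt sub(2) cards(3)] act by blast
  have inpP: "\<forall>p \<in> members ?P. inp p = False"
    using inpe by (auto simp: g_def)
  have inpQ: "\<forall>p \<in> members ?Q. inp p = True"
    using inpe by (auto simp: g_def)
  have "b = False" "b' = True" using can_return_valid[OF b(1) inpP] can_return_valid[OF b(2) inpQ] .
  then show ?thesis
    by (intro bivalentI[OF a _ _ sub disj _ _ _ _ _ b(1)]) (use b(2) cards in auto)
qed

lemma bivalent_all:
  "infinite (procs A) \<or> 2 * (5 * m + 6 + 2 * r) \<le> card (procs A) \<Longrightarrow> bivalent r"
proof (induction r)
  case 0
  then show ?case using bivalent_0 by simp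
next
  case (Suc r)
  then have "bivalent r" by auto
  then show ?case using bivalent_Suc Suc.prems by blast
qed

end

theorem theorem2p6:
  fixes A :: "('p, 's, 'r, 'v, 'c) system" and m r :: nat
  assumes "correct_consensus A"
    and "nondet_solo_termination A"
    and "uses_at_most A m"
    and "r \<le> m"
    and "infinite (procs A) \<or> 2 * (5 * m + 6 + 2 * r) \<le> card (procs A)"
  shows "\<exists>U inp E C.
    clone_pairs A inp U \<and> card U = 5 * m + 6 + 2 * r \<and> pair_execution A inp U E C \<and>
    (\<exists>R Rs Rc cov V L.
      finite R \<and> card R = r \<and> R = Rs \<union> Rc \<and> Rs \<inter> Rc = {} \<and>
      Rs = {x. \<exists>q \<in> U. fresh_on E q x} \<and>
      (\<forall>x \<in> Rs. \<exists>!q. q \<in> U \<and> fresh_on E q x) \<and>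
      inj_on cov Rc \<and>
      (\<forall>x \<in> Rc. cov x \<in> U \<and> \<not> is_split E (cov x) \<and> pair_covers A C (cov x) x) \<and>
      V = {q \<in> U. \<exists>x. fresh_on E q x} \<union> cov ` Rc \<and> card V = r \<and>
      L = {q \<in> U. \<exists>x. stale_on E q x} \<and> card L \<le> r \<and>
      (\<forall>q \<in> L. \<forall>x. stale_on E q x \<longrightarrow> x \<in> R) \<and>
      (\<forall>q \<in> L. \<forall>q' \<in> L. \<forall>x. stale_on E q x \<and> stale_on E q' x \<longrightarrow> q = q') \<and>
      (\<exists>P Q. P \<subseteq> U - V - L \<and> Q \<subseteq> U - V - L \<and> P \<inter> Q = {} \<and>
        (\<forall>q \<in> P \<union> Q. \<not> is_split E q) \<and>
        card P + card Q \<le> 2 * m + 4 \<and>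
        (\<exists>\<gamma> \<in> Res A m C P. returns \<gamma> False) \<and>
        (\<exists>\<gamma> \<in> Res A m C Q. returns \<gamma> True)))"
proof -
  interpret consensus A m using assms(1-3) by unfold_locales
  have "bivalent r" using bivalent_all assms(5) by blast
  then obtain inp U E C R cov b P Q where a: "arranged A inp U E C R cov" and card: "card R = r" "card U = 5 * m + 6 + 2 * r"
    and PQ: "P \<subseteq> U" "Q \<subseteq> U" "P \<inter> Q = {}" "\<forall>q \<in> P \<union> Q. \<not> is_split E q"
      "(P \<union> Q) \<inter> cov ` (R - fresh_regs U E) = {}" "m + 1 \<le> card P" "m + 1 \<le> card Q" "card P + card Q \<le> 2 * m + 4"
    and can: "can_return A C P b" "can_return A C Q (\<not> b)"
    unfolding bivalent_def by (elim exE conjE) (rule that; assumption)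
  note ad = arrangedD[OF a]
  \<comment> \<open>In \<open>bivalent\<close> the value \<open>b\<close> is arbitrary; the sets are
    renamed so that the first one returns 0.\<close>
  define P0 where "P0 = (if b then Q else P)"
  define Q0 where "Q0 = (if b then P else Q)"
  have PQ0: "P0 \<union> Q0 = P \<union> Q" "P0 \<inter> Q0 = {}" "card P0 + card Q0 \<le> 2 * m + 4" "m + 1 \<le> card P0" "m + 1 \<le> card Q0"
    using PQ(3,6-8) unfolding P0_def Q0_def by auto
  have can0: "can_return A C P0 False" "can_return A C Q0 True" using can unfolding P0_def Q0_def by auto
  define Rs where "Rs = {x. \<exists>q \<in> U. fresh_on E q x}"
  have Rs: "Rs = fresh_regs U E" by (simp add: Rs_def fresh_regs_def)
  define V where "V = {q \<in> U. \<exists>x. fresh_on E q x} \<union> cov ` (R - Rs)"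
  define L where "L = {q \<in> U. \<exists>x. stale_on E q x}"
  have split: "is_split E q" if "fresh_on E q x \<or> stale_on E q x" for q x using that by (auto simp: is_split_iff)
  have "{q \<in> U. \<exists>x. fresh_on E q x} \<inter> cov ` (R - Rs) = {}"
    using ad(8) split unfolding Rs by blast
  then have cardV: "card V = r"
    unfolding V_def Rs using ad(2,4) card_fresh[OF a] card_cov[OF a] card(1)
    by (subst card_Un_disjoint) auto
  have PQU: "P0 \<union> Q0 \<subseteq> U" using PQ(1,2) unfolding PQ0(1) by blast
  have nsplit: "\<forall>q \<in> P0 \<union> Q0. \<not> is_split E q" using PQ(4) unfolding PQ0(1) .
  have "(P0 \<union> Q0) \<inter> cov ` (R - Rs) = {}" using PQ(5) unfolding PQ0(1) Rs .
  then have PQV: "P0 \<union> Q0 \<subseteq> U - V - L" unfolding V_def L_def using PQU nsplit split by blast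
  have sub: "P0 \<subseteq> U" "Q0 \<subseteq> U" "P0 \<subseteq> U - V - L" "Q0 \<subseteq> U - V - L" using PQU PQV by blast+
  have sy: "synced A C P0" "synced A C Q0"
    using arranged_synced[OF a sub(1)] arranged_synced[OF a sub(2)] nsplit by blast+
  have res: "\<exists>\<gamma> \<in> Res A m C P0. returns \<gamma> False" "\<exists>\<gamma> \<in> Res A m C Q0. returns \<gamma> True"
    by (rule can_return_Res[OF can0(1) sy(1) PQ0(4)], rule can_return_Res[OF can0(2) sy(2) PQ0(5)])
  have R: "R = Rs \<union> (R - Rs)" "Rs \<inter> (R - Rs) = {}" using ad(5) unfolding Rs by blast+
  have ex1: "\<forall>x \<in> Rs. \<exists>!q. q \<in> U \<and> fresh_on E q x"
    unfolding Rs_def using ad(6) by blast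
  have cov: "\<forall>x \<in> R - Rs. cov x \<in> U \<and> \<not> is_split E (cov x) \<and> pair_covers A C (cov x) x"
    using ad(7-9) unfolding Rs by blast
  have inj: "inj_on cov (R - Rs)" using ad(10) unfolding Rs .
  have L: "card L \<le> r" "\<forall>q \<in> L. \<forall>x. stale_on E q x \<longrightarrow> x \<in> R"
    "\<forall>q \<in> L. \<forall>q' \<in> L. \<forall>x. stale_on E q x \<and> stale_on E q' x \<longrightarrow> q = q'"
    using card_stale[OF a] card(1) ad(11,12) unfolding L_def by blast+
  show ?thesis
    by (rule exI[of _ U], rule exI[of _ inp], rule exI[of _ E], rule exI[of _ C], intro conjI ad(1) card(2) ad(3),
        rule exI[of _ R], rule exI[of _ Rs], rule exI[of _ "R - Rs"], rule exI[of _ cov], rule exI[of _ V],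
        rule exI[of _ L])
      (intro conjI ad(4) card(1) R Rs_def ex1 inj cov V_def cardV L_def L,
        rule exI[of _ P0], rule exI[of _ Q0], intro conjI sub(3,4) PQ0(2,3) nsplit res)
qed

end
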